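(* Let $N\ge 1$ be an integer, $m\ge 0$ a real number, $R>0$, and let $p,q>1$, with $q\le \frac{2N}{N-2}$ if $N\ge 3$. Define $$\Lambda(p,q,N,m):=(q-1)\big[(m+1)(N-1)p-m(p-2)-2\big],$$ and assume that $$\Lambda(p,q,N,m)<4,\qquad p>p_{tr}(N,m),\qquad q>q_C(N,m).$$ Let $f,g\in \mathcal{C}_0^\infty(\mathbb{R}^N)$ be non-negative functions, neither identically zero, with supports contained in the ball $B_{\mathbb{R}^N}(0,R)$. Then there exist constants $\varepsilon_0=\varepsilon_0(f,g,N,R,p,q,m)>0$ and $C>0$, with $C$ independent of $\varepsilon$, such that the following holds for every $0<\varepsilon\le \varepsilon_0$: if $u$ is an energy solution on $[0,T_\varepsilon)$ of $$u_{tt}-t^{2m}\Delta u=|u_t|^p+|u|^q \ \text{ in } \mathbb{R}^N\times[0,\infty),\qquad u(x,0)=\varepsilon f(x),\quad u_t(x,0)=\varepsilon g(x),\quad x\in\mathbb{R}^N,$$ such that $\operatorname{supp}(u)\subset\{(x,t)\in\mathbb{R}^N\times[0,\infty): |x|\le \xi(t)+R\}$ with $\xi(t)=\frac{t^{m+1}}{m+1}$, then $$T_\varepsilon\le C\,\varepsilon^{-\frac{2p(q-1)}{4-\Lambda(p,q,N,m)}}.$$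
   Context: All functions are real-valued. Exponents. $p_{tr}(N,m):=1+\frac{2}{(m+1)(N-1)-m}$, and $q_C(N,m)$ is the greatest root of the quadratic equation $$((m+1)N-1)q^2-((m+1)N+1-2m)q-2(m+1)=0.$$ In the degenerate case $N=1$, $m=0$ (where the denominator and the leading coefficient vanish) one sets $p_{tr}=q_C=+\infty$. Energy solution. Let $f,g\in \mathcal{C}_0^\infty(\mathbb{R}^N)$. A function $u$ is an energy solution on $[0,T)$ of the Cauchy problem $$u_{tt}-t^{2m}\Delta u=|u_t|^p+|u|^q \ \text{ in } \mathbb{R}^N\times[0,\infty),\qquad u(x,0)=\varepsilon f(x),\quad u_t(x,0)=\varepsilon g(x),\quad x\in\mathbb{R}^N,$$ if $u(\cdot,0)=\varepsilon f$, $u_t(\cdot,0)=\varepsilon g$, $$u\in \mathcal{C}([0,T),H^1(\mathbb{R}^N))\cap \mathcal{C}^1([0,T),L^2(\mathbb{R}^N)),\quad u\in L^q_{loc}((0,T)\times\mathbb{R}^N),\quad u_t\in L^p_{loc}((0,T)\times\mathbb{R}^N),$$ and for all $\Phi\in \mathcal{C}_0^\infty(\mathbb{R}^N\times[0,T))$ and all $t\in[0,T)$, $$\int_{\mathbb{R}^N}u_t(x,t)\Phi(x,t)\,dx-\int_{\mathbb{R}^N}u_t(x,0)\Phi(x,0)\,dx-\int_0^t\int_{\mathbb{R}^N}u_t(x,s)\Phi_t(x,s)\,dx\,ds+\int_0^t s^{2m}\int_{\mathbb{R}^N}\nabla u(x,s)\cdot\nabla\Phi(x,s)\,dx\,ds$$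 $$=\int_0^t\int_{\mathbb{R}^N}\left\{|u_t(x,s)|^p+|u(x,s)|^q\right\}\Phi(x,s)\,dx\,ds.$$ *)

theory Defs
  imports "HOL-Analysis.Analysis"
begin

primrec Ck :: "nat \<Rightarrow> ('a::real_normed_vector \<Rightarrow> real) \<Rightarrow> bool" where
  "Ck 0 f \<longleftrightarrow> continuous_on UNIV f"
| "Ck (Suc k) f \<longleftrightarrow> (\<forall>x. f differentiable (at x)) \<and>
     (\<forall>v. Ck k (\<lambda>x. frechet_derivative f (at x) v))"

definition smooth :: "('a::real_normed_vector \<Rightarrow> real) \<Rightarrow> bool" where
  "smooth f \<longleftrightarrow> (\<forall>k. Ck k f)"

definition supp :: "('a::real_normed_vector \<Rightarrow> real) \<Rightarrow> 'a set" where
  "supp f = closure (support_on UNIV f)"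

definition Cc_infty :: "('a::real_normed_vector \<Rightarrow> real) \<Rightarrow> bool" where
  "Cc_infty f \<longleftrightarrow> smooth f \<and> compact (supp f)"

definition grad :: "(real^'n \<Rightarrow> real) \<Rightarrow> real^'n \<Rightarrow> real^'n" where
  "grad f x = (\<chi> i. frechet_derivative f (at x) (axis i 1))"

text \<open>Elements of Lebesgue and Sobolev spaces are represented by functions, not by classes modulo
  null sets.\<close>

definition square_integrable :: "('a::euclidean_space \<Rightarrow> 'b::euclidean_space) \<Rightarrow> bool" where
  "square_integrable f \<longleftrightarrow>
     f \<in> borel_measurable lebesgue \<and> integrable lebesgue (\<lambda>x. (norm (f x))\<^sup>2)"

definition L2_norm :: "('a::euclidean_space \<Rightarrow> 'b::euclidean_space) \<Rightarrow> real" where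
  "L2_norm f = sqrt (\<integral>x. (norm (f x))\<^sup>2 \<partial>lebesgue)"

definition is_weak_gradient :: "(real^'n \<Rightarrow> real) \<Rightarrow> (real^'n \<Rightarrow> real^'n) \<Rightarrow> bool" where
  "is_weak_gradient f G \<longleftrightarrow> (\<forall>\<phi>. Cc_infty \<phi> \<longrightarrow>
     (\<forall>i. (\<integral>x. f x * grad \<phi> x $ i \<partial>lebesgue) = - (\<integral>x. G x $ i * \<phi> x \<partial>lebesgue)))"

definition H1 :: "(real^'n \<Rightarrow> real) \<Rightarrow> bool" where
  "H1 f \<longleftrightarrow> square_integrable f \<and> (\<exists>G. square_integrable G \<and> is_weak_gradient f G)"

text \<open>The weak gradient is determined only up to a null set; a representative is chosen.\<close>

definition weak_grad :: "(real^'n \<Rightarrow> real) \<Rightarrow> real^'n \<Rightarrow> real^'n" where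
  "weak_grad f = (SOME G. square_integrable G \<and> is_weak_gradient f G)"

definition H1_norm :: "(real^'n \<Rightarrow> real) \<Rightarrow> real" where
  "H1_norm f = sqrt ((L2_norm f)\<^sup>2 + (L2_norm (weak_grad f))\<^sup>2)"

definition Lr_loc :: "'a::euclidean_space set \<Rightarrow> real \<Rightarrow> ('a \<Rightarrow> real) \<Rightarrow> bool" where
  "Lr_loc \<Omega> r w \<longleftrightarrow> set_borel_measurable lebesgue \<Omega> w \<and>
     (\<forall>K. compact K \<and> K \<subseteq> \<Omega> \<longrightarrow> set_integrable lebesgue K (\<lambda>z. \<bar>w z\<bar> powr r))"

text \<open>A function \<open>u\<close> of \<open>(x,t)\<close> is viewed as the curve \<open>t \<mapsto> u(\<cdot>,t)\<close>.\<close>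

definition C0_H1 :: "real set \<Rightarrow> ((real^'n) \<times> real \<Rightarrow> real) \<Rightarrow> bool" where
  "C0_H1 I u \<longleftrightarrow> (\<forall>t\<in>I. H1 (\<lambda>x. u (x,t))) \<and>
     (\<forall>t\<in>I. ((\<lambda>s. H1_norm (\<lambda>x. u (x,s) - u (x,t))) \<longlongrightarrow> 0) (at t within I))"

definition C0_L2 :: "real set \<Rightarrow> ((real^'n) \<times> real \<Rightarrow> real) \<Rightarrow> bool" where
  "C0_L2 I u \<longleftrightarrow> (\<forall>t\<in>I. square_integrable (\<lambda>x. u (x,t))) \<and>
     (\<forall>t\<in>I. ((\<lambda>s. L2_norm (\<lambda>x. u (x,s) - u (x,t))) \<longlongrightarrow> 0) (at t within I))"

definition has_L2_time_derivative ::
  "((real^'n) \<times> real \<Rightarrow> real) \<Rightarrow> ((real^'n) \<times> real \<Rightarrow> real) \<Rightarrow> real set \<Rightarrow> bool" where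
  "has_L2_time_derivative u v I \<longleftrightarrow> (\<forall>t\<in>I.
     ((\<lambda>s. L2_norm (\<lambda>x. (u (x,s) - u (x,t)) / (s - t) - v (x,t))) \<longlongrightarrow> 0) (at t within I))"

definition C1_L2 ::
  "real set \<Rightarrow> ((real^'n) \<times> real \<Rightarrow> real) \<Rightarrow> ((real^'n) \<times> real \<Rightarrow> real) \<Rightarrow> bool" where
  "C1_L2 I u v \<longleftrightarrow> C0_L2 I u \<and> C0_L2 I v \<and> has_L2_time_derivative u v I"

text \<open>The lifespan \<open>T\<close> may be infinite.\<close>

definition time_interval :: "ereal \<Rightarrow> real set" where
  "time_interval T = {t. 0 \<le> t \<and> ereal t < T}"

text \<open>Test functions in \<open>C\<^sub>0\<^sup>\<infinity>(\<real>\<^sup>N \<times> [0,T))\<close>, which need not vanish at \<open>t = 0\<close>: they are given as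
  the restrictions to \<open>t \<ge> 0\<close> of smooth functions on the whole space-time with compact support
  in \<open>{t < T}\<close>.\<close>

definition test_function :: "ereal \<Rightarrow> ((real^'n) \<times> real \<Rightarrow> real) \<Rightarrow> bool" where
  "test_function T \<Phi> \<longleftrightarrow> Cc_infty \<Phi> \<and> supp \<Phi> \<subseteq> {(x,t). ereal t < T}"

text \<open>The Cauchy problem \<open>u\<^sub>t\<^sub>t - t\<^sup>2\<^sup>m \<Delta>u = |u\<^sub>t|\<^sup>p + |u|\<^sup>q\<close>, \<open>u(x,0) = u0 x\<close>, \<open>u\<^sub>t(x,0) = u1 x\<close>;
  \<open>v\<close> is \<open>u\<^sub>t\<close>.  Local integrability on the open slab does not by itself make the
  right-hand side of the weak identity meaningful near \<open>t = 0\<close>, so its integrability, implicit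
  in the identity, is stated separately.\<close>

definition energy_solution ::
  "real \<Rightarrow> real \<Rightarrow> real \<Rightarrow> (real^'n \<Rightarrow> real) \<Rightarrow> (real^'n \<Rightarrow> real) \<Rightarrow> ereal
     \<Rightarrow> ((real^'n) \<times> real \<Rightarrow> real) \<Rightarrow> bool" where
  "energy_solution m p q u0 u1 T u \<longleftrightarrow> 0 < T \<and> (\<exists>v.
     (AE x in lebesgue. u (x,0) = u0 x) \<and>
     (AE x in lebesgue. v (x,0) = u1 x) \<and>
     C0_H1 (time_interval T) u \<and>
     C1_L2 (time_interval T) u v \<and>
     Lr_loc (UNIV \<times> {t. 0 < t \<and> ereal t < T}) q u \<and>
     Lr_loc (UNIV \<times> {t. 0 < t \<and> ereal t < T}) p v \<and>
     (\<forall>\<Phi>. test_function T \<Phi> \<longrightarrow> (\<forall>t\<in>time_interval T.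
        set_integrable lebesgue (UNIV \<times> {0..t})
          (\<lambda>z. (\<bar>v z\<bar> powr p + \<bar>u z\<bar> powr q) * \<Phi> z) \<and>
        (\<integral>x. v (x,t) * \<Phi> (x,t) \<partial>lebesgue)
        - (\<integral>x. v (x,0) * \<Phi> (x,0) \<partial>lebesgue)
        - (LINT s:{0..t}|lebesgue. \<integral>x. v (x,s) * deriv (\<lambda>\<tau>. \<Phi> (x,\<tau>)) s \<partial>lebesgue)
        + (LINT s:{0..t}|lebesgue. s powr (2 * m) *
             (\<integral>x. weak_grad (\<lambda>y. u (y,s)) x \<bullet> grad (\<lambda>y. \<Phi> (y,s)) x \<partial>lebesgue))
        = (LINT s:{0..t}|lebesgue.
             \<integral>x. (\<bar>v (x,s)\<bar> powr p + \<bar>u (x,s)\<bar> powr q) * \<Phi> (x,s) \<partial>lebesgue))))"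

text \<open>The support in \<open>S\<close> of a function defined almost everywhere on \<open>S\<close>: the complement in \<open>S\<close> of
  the largest relatively open set on which it vanishes almost everywhere.\<close>

definition ess_supp :: "'a::euclidean_space set \<Rightarrow> ('a \<Rightarrow> real) \<Rightarrow> 'a set" where
  "ess_supp S u = {z \<in> S. \<forall>U. open U \<and> z \<in> U \<longrightarrow>
     \<not> (AE w in lebesgue. w \<in> U \<inter> S \<longrightarrow> u w = 0)}"

definition \<xi> :: "real \<Rightarrow> real \<Rightarrow> real" where
  "\<xi> m t = t powr (m + 1) / (m + 1)"

definition p_tr :: "nat \<Rightarrow> real \<Rightarrow> ereal" where
  "p_tr N m = (if N = 1 \<and> m = 0 then \<infinity>
     else ereal (1 + 2 / ((m + 1) * (real N - 1) - m)))"

definition q_C :: "nat \<Rightarrow> real \<Rightarrow> ereal" where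
  "q_C N m = (if N = 1 \<and> m = 0 then \<infinity>
     else ereal (GREATEST q. ((m + 1) * real N - 1) * q\<^sup>2
            - ((m + 1) * real N + 1 - 2 * m) * q - 2 * (m + 1) = 0))"

definition Lambda_exp :: "real \<Rightarrow> real \<Rightarrow> nat \<Rightarrow> real \<Rightarrow> real" where
  "Lambda_exp p q N m = (q - 1) * ((m + 1) * (real N - 1) * p - m * (p - 2) - 2)"

end

theory Submission
  imports Defs "HOL-Probability.Distributions"
begin

text \<open>Testing the equation with \<open>exp (a \<bullet> x)\<close>, \<open>|a| = 1\<close>, shows that \<open>U = \<integral> u exp (a \<bullet> x)\<close> satisfies
  \<open>U'' \<ge> t\<^sup>2\<^sup>m U\<close>, so that \<open>U' = \<integral> u\<^sub>t exp (a \<bullet> x)\<close> is at least of order \<open>\<epsilon> t powr (m/2) exp (\<xi> m t)\<close>,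
  uniformly in \<open>a\<close>.  Averaging over the directions \<open>a\<close> replaces the plane waves by a weight of size
  \<open>exp |x| (1 + |x|) powr (- (N - 1)/2)\<close>, and Hoelder's inequality on the ball of radius \<open>\<xi> m t + R\<close>
  bounds \<open>\<integral> |u\<^sub>t|\<^sup>p\<close> below by \<open>\<epsilon>\<^sup>p\<close> times a power of \<open>t\<close>.  Testing with \<open>a = 0\<close>, the mean \<open>F = \<integral> u\<close>
  has \<open>F'' = \<integral> |u\<^sub>t|\<^sup>p + |u|\<^sup>q\<close>.  If the solution lives up to time \<open>b\<close>, the first term makes \<open>F\<close>
  large at time \<open>b/2\<close>, and the second, bounded below by a multiple of \<open>b powr (- (m+1) N (q-1)) F\<^sup>q\<close>, would
  make \<open>F\<close> blow up before \<open>b\<close> unless \<open>b\<close> obeys the claimed bound.\<close>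

section \<open>Smooth functions and cutoffs\<close>

text \<open>Averaging is what makes the exponent sharp enough. Over a large ball of radius \<rho>,
  the s-th power of one plane wave integrates to order
  \<open>exp (s * \<rho>) * \<rho> powr ((N - 1) / 2)\<close>, that of the average to at most order
  \<open>exp (s * \<rho>) * \<rho> powr ((N - 1) * (1 - s / 2))\<close>. With s = p / (p - 1),
  raising to the power 1 - p turns the difference into a gain of
  \<open>\<rho> powr ((N - 1) / 2)\<close>. The lower bound for the p-th power is then of order
  \<open>\<epsilon> powr p * t powr \<tau>\<close>. Two integrations over times comparable to b make
  F of order \<open>\<epsilon> powr p * b powr (\<tau> + 2)\<close>, and the blow-up step bounds
  \<open>\<epsilon> powr (p * (q - 1)) * b powr e\<close> with e = (4 - \<Lambda>) / 2. The
  condition \<Lambda> < 4 is the positivity of e. Low regularity shapes the rest: U' is known only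
  through an identity integrated in time, the nonlinear term is integrable only against compactly
  supported functions and at almost every time, and the support condition is an essential one in
  space-time. Hence the comparison arguments use integral inequalities, and the supports of both u
  and its time derivative are first determined at every single time.\<close>

lemma Ck_SucI:
  assumes "\<And>x. (f has_derivative f' x) (at x)" "\<And>v. Ck k (\<lambda>x. f' x v)"
  shows "Ck (Suc k) f"
proof -
  have "frechet_derivative f (at x) = f' x" for x
    using frechet_derivative_at[OF assms(1)] by simp
  then show ?thesis using assms by (auto simp: differentiable_def)
qed

lemma Ck_SucD:
  assumes "Ck (Suc k) f"
  shows "(f has_derivative frechet_derivative f (at x)) (at x)"
    "Ck k (\<lambda>x. frechet_derivative f (at x) v)"
  using assms frechet_derivative_works[of f "at x"] by simp_all

lemma Ck_Suc_imp_Ck: "Ck (Suc k) f \<Longrightarrow> Ck k f"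
proof (induction k arbitrary: f)
  case 0
  then show ?case
    by (auto simp: continuous_on_eq_continuous_at intro: differentiable_imp_continuous_within)
next
  case (Suc k)
  show ?case
    using Suc.prems Suc.IH by (subst Ck.simps(2)) (auto simp del: Ck.simps(2) dest: Ck.simps(2)[THEN iffD1])
qed

lemma Ck_const: "Ck k (\<lambda>x. c)"
proof (induction k arbitrary: c)
  case (Suc k)
  show ?case by (rule Ck_SucI[where f'="\<lambda>_ _. 0"]) (auto simp: Suc)
qed simp

lemma Ck_bounded_linear: "bounded_linear f \<Longrightarrow> Ck k f"
proof (cases k)
  case 0 then show "bounded_linear f \<Longrightarrow> Ck k f" by (simp add: linear_continuous_on)
next
  case (Suc k') assume "bounded_linear f"
  then show "Ck k f" unfolding Suc
    by (intro Ck_SucI[where f'="\<lambda>_. f"] bounded_linear_imp_has_derivative Ck_const)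
qed

lemma Ck_add: "Ck k f \<Longrightarrow> Ck k g \<Longrightarrow> Ck k (\<lambda>x. f x + g x)"
proof (induction k arbitrary: f g)
  case 0 then show ?case by (auto intro: continuous_intros)
next
  case (Suc k)
  show ?case
    by (rule Ck_SucI, rule has_derivative_add[OF Ck_SucD(1)[OF Suc.prems(1)] Ck_SucD(1)[OF Suc.prems(2)]])
      (intro Suc.IH Ck_SucD(2) Suc.prems)
qed

lemma Ck_mult: "Ck k f \<Longrightarrow> Ck k g \<Longrightarrow> Ck k (\<lambda>x. f x * g x)"
proof (induction k arbitrary: f g)
  case 0 then show ?case by (auto intro: continuous_intros)
next
  case (Suc k)
  show ?case
    by (rule Ck_SucI, rule has_derivative_mult[OF Ck_SucD(1)[OF Suc.prems(1)] Ck_SucD(1)[OF Suc.prems(2)]])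
      (intro Ck_add Suc.IH Ck_SucD(2)[OF Suc.prems(1)] Ck_SucD(2)[OF Suc.prems(2)] Suc.prems[THEN Ck_Suc_imp_Ck])
qed

lemma Ck_inverse:
  assumes "\<And>x. f x \<noteq> 0"
  shows "Ck k f \<Longrightarrow> Ck k (\<lambda>x. inverse (f x))"
proof (induction k)
  case 0 then show ?case using assms by (auto intro!: continuous_intros)
next
  case (Suc k)
  have C: "Ck k (\<lambda>x. inverse (f x))" using Suc Ck_Suc_imp_Ck by blast
  have "Ck k (\<lambda>x. (-1) * (inverse (f x) * frechet_derivative f (at x) v * inverse (f x)))" for v
    by (intro Ck_mult Ck_const C Ck_SucD(2)[OF Suc.prems])
  then show ?case
    by (intro Ck_SucI[OF Deriv.has_derivative_inverse[OF assms Ck_SucD(1)[OF Suc.prems]]]) simp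
qed

text \<open>The chain rule turns \<open>g n\<close> composed with f into \<open>g (Suc n)\<close>
  composed with f times a derivative of f. All derivatives of g are therefore supplied at once, and
  the induction on k runs over all n simultaneously.\<close>

lemma Ck_compose_real:
  assumes g: "\<And>n x. ((g n :: real \<Rightarrow> real) has_real_derivative g (Suc n) x) (at x)"
  shows "Ck k f \<Longrightarrow> Ck k (\<lambda>x. g n (f x))"
proof (induction k arbitrary: n)
  case 0
  have "continuous_on UNIV (g n)"
    using g by (auto simp: continuous_on_eq_continuous_at intro: DERIV_isCont)
  with 0 show ?case using continuous_on_compose2[of UNIV "g n" UNIV f] by auto
next
  case (Suc k)
  have C: "Ck k f" using Suc.prems by (rule Ck_Suc_imp_Ck)
  have d: "((\<lambda>x. g n (f x)) has_derivative (\<lambda>v. g (Suc n) (f x) * frechet_derivative f (at x) v)) (at x)" for x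
    using has_derivative_compose[OF Ck_SucD(1)[OF Suc.prems] g[unfolded has_field_derivative_def]] .
  show ?case by (rule Ck_SucI[OF d]) (intro Ck_mult Suc.IH[OF C] Ck_SucD(2)[OF Suc.prems])
qed

lemma Ck_compose_linear:
  assumes "bounded_linear L"
  shows "Ck k f \<Longrightarrow> Ck k (\<lambda>x. f (L x))"
proof (induction k arbitrary: f)
  case 0
  then show ?case using continuous_on_compose2[of UNIV f UNIV L] linear_continuous_on[OF assms] by auto
next
  case (Suc k)
  have d: "((\<lambda>x. f (L x)) has_derivative (\<lambda>v. frechet_derivative f (at (L x)) (L v))) (at x)" for x
    by (rule has_derivative_compose[OF bounded_linear_imp_has_derivative[OF assms] Ck_SucD(1)[OF Suc.prems]])
  show ?case by (rule Ck_SucI[OF d], rule Suc.IH, rule Ck_SucD(2)[OF Suc.prems])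
qed

lemma Ck_inner_self: "Ck k (\<lambda>x::'a::real_inner. x \<bullet> x)"
proof (cases k)
  case 0 then show ?thesis by (auto intro: continuous_intros)
next
  case (Suc k')
  have "((\<lambda>x::'a. x \<bullet> x) has_derivative (\<lambda>v. x \<bullet> v + v \<bullet> x)) (at x)" for x
    by (auto intro!: derivative_eq_intros)
  moreover have "Ck k' (\<lambda>x::'a. x \<bullet> v + v \<bullet> x)" for v
    by (intro Ck_add Ck_bounded_linear bounded_linear_inner_left bounded_linear_inner_right)
  ultimately show ?thesis unfolding Suc by (rule Ck_SucI)
qed

section \<open>Closure properties of smooth functions\<close>

lemma smoothD: "smooth f \<Longrightarrow> Ck k f"
  by (simp add: smooth_def)

lemma smoothI: "(\<And>k. Ck k f) \<Longrightarrow> smooth f"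
  by (simp add: smooth_def)

lemma smooth_mult: "smooth f \<Longrightarrow> smooth g \<Longrightarrow> smooth (\<lambda>x. f x * g x)"
  by (auto simp: smooth_def intro: Ck_mult)

lemma smooth_add: "smooth f \<Longrightarrow> smooth g \<Longrightarrow> smooth (\<lambda>x. f x + g x)"
  by (auto simp: smooth_def intro: Ck_add)

lemma smooth_inverse: "(\<And>x. f x \<noteq> 0) \<Longrightarrow> smooth f \<Longrightarrow> smooth (\<lambda>x. inverse (f x))"
  by (rule smoothI, rule Ck_inverse, assumption, rule smoothD)

lemma smooth_compose_linear: "bounded_linear L \<Longrightarrow> smooth f \<Longrightarrow> smooth (\<lambda>x. f (L x))"
  by (rule smoothI, rule Ck_compose_linear, assumption, rule smoothD)

lemma smooth_const: "smooth (\<lambda>x. c)"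
  by (intro smoothI Ck_const)

lemma smooth_bounded_linear: "bounded_linear f \<Longrightarrow> smooth f"
  by (intro smoothI Ck_bounded_linear)

text \<open>The iterates of \<open>deriv\<close> form the sequence that
  \<open>Ck_compose_real\<close> asks for. On the line a Frechet derivative is multiplication by its
  value at 1, so each iterate is again a Frechet derivative in a fixed direction and inherits
  smoothness.\<close>

lemma smooth_compose_real:
  assumes "smooth (g :: real \<Rightarrow> real)" "smooth f"
  shows "smooth (\<lambda>x. g (f x))"
proof -
  have Ck: "Ck k ((deriv ^^ n) g)" for n k
  proof (induction n arbitrary: k)
    case 0 then show ?case using assms by (simp add: smooth_def)
  next
    case (Suc n)
    have "((deriv ^^ n) g has_real_derivative frechet_derivative ((deriv ^^ n) g) (at x) 1) (at x)" for x
    proof -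
      have D: "((deriv ^^ n) g has_derivative frechet_derivative ((deriv ^^ n) g) (at x)) (at x)"
        using Ck_SucD(1)[OF Suc] .
      have "frechet_derivative ((deriv ^^ n) g) (at x) = (*) (frechet_derivative ((deriv ^^ n) g) (at x) 1)"
      proof
        show "frechet_derivative ((deriv ^^ n) g) (at x) h = frechet_derivative ((deriv ^^ n) g) (at x) 1 * h" for h
          using linear_scale[OF has_derivative_linear[OF D], of h 1] by (metis mult.commute mult_1_right real_scaleR_def)
      qed
      then show ?thesis using D unfolding has_field_derivative_def by metis
    qed
    then have "(deriv ^^ Suc n) g = (\<lambda>x. frechet_derivative ((deriv ^^ n) g) (at x) 1)"
      by (auto simp: fun_eq_iff intro: DERIV_imp_deriv)
    then show ?case using Ck_SucD(2)[OF Suc] by simp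
  qed
  have "((deriv ^^ n) g has_real_derivative (deriv ^^ Suc n) g x) (at x)" for n x
  proof -
    have "(deriv ^^ n) g differentiable (at x)" using Ck[of "Suc 0" n] by simp
    then show ?thesis
      by (metis DERIV_deriv_iff_real_differentiable comp_apply funpow.simps(2))
  qed
  from Ck_compose_real[where g="\<lambda>n. (deriv ^^ n) g", OF this, of _ f 0] assms show ?thesis
    by (simp add: smooth_def)
qed

lemma smooth_imp_continuous_on: "smooth f \<Longrightarrow> continuous_on UNIV f"
  using smoothD[of f 0] by simp

lemma smooth_frechet_derivative: "smooth f \<Longrightarrow> smooth (\<lambda>x. frechet_derivative f (at x) v)"
  by (rule smoothI, rule Ck_SucD(2), rule smoothD)

text \<open>The family \<open>P (1/x) exp (- 1/x)\<close> is closed under differentiation.\<close>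

definition flat :: "real poly \<Rightarrow> real \<Rightarrow> real" where
  "flat P x = (if x \<le> 0 then 0 else poly P (1 / x) * exp (- (1 / x)))"

lemma poly_mult_exp_minus_tendsto_0: "((\<lambda>y. poly P y * exp (- y)) \<longlongrightarrow> (0::real)) at_top"
proof -
  have "((\<lambda>y. \<Sum>i\<le>degree P. coeff P i * (y ^ i / exp y)) \<longlongrightarrow> (\<Sum>i\<le>degree P. coeff P i * (0::real))) at_top"
    by (intro tendsto_intros tendsto_power_div_exp_0)
  then show ?thesis by (simp add: poly_altdef sum_distrib_right exp_minus divide_inverse mult.assoc)
qed

text \<open>With y = 1/x one has d/dx = - \<open>y^2\<close> d/dy, which maps P(y) exp(-y) to
  \<open>y^2 * (P - P') * exp (- y)\<close>. At x = 0 the right difference quotient is y P(y)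
  exp(-y) with y tending to infinity, so it vanishes in the limit.\<close>

lemma flat_has_derivative:
  "(flat P has_real_derivative flat ([:0, 0, 1:] * (P - pderiv P)) x) (at x)"
proof -
  consider "x < 0" | "x = 0" | "x > 0" by linarith
  then show ?thesis
  proof cases
    case 1
    have "((\<lambda>_. 0) has_real_derivative 0) (at x)" by simp
    moreover have "eventually (\<lambda>y. flat P y = 0) (nhds x)"
      using eventually_nhds_in_open[of "{..<0}" x] 1 by (auto elim!: eventually_mono simp: flat_def)
    ultimately show ?thesis using 1 by (subst DERIV_cong_ev[OF refl _ refl]) (auto simp: flat_def)
  next
    case 2
    have "((\<lambda>y. y * poly P y * exp (- y)) \<longlongrightarrow> 0) at_top"
      using poly_mult_exp_minus_tendsto_0[of "[:0,1:] * P"] by simp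
    from filterlim_compose[OF this filterlim_inverse_at_top_right]
    have "((\<lambda>h. inverse h * poly P (inverse h) * exp (- inverse h)) \<longlongrightarrow> (0::real)) (at_right 0)" .
    moreover have "eventually (\<lambda>h. inverse h * poly P (inverse h) * exp (- inverse h) = (flat P h) / h) (at_right (0::real))"
      by (auto simp: flat_def divide_inverse intro!: eventually_at_rightI[of 0 1])
    ultimately have "((\<lambda>h. flat P h / h) \<longlongrightarrow> 0) (at_right (0::real))" by (rule Lim_transform_eventually)
    moreover have "((\<lambda>h. flat P h / h) \<longlongrightarrow> 0) (at_left (0::real))"
      by (rule tendsto_eventually) (auto simp: flat_def intro!: eventually_at_leftI[of "-1" 0])
    ultimately have "((\<lambda>h. flat P h / h) \<longlongrightarrow> 0) (at 0)" by (rule filterlim_split_at[rotated])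
    then show ?thesis unfolding 2 DERIV_def by (simp add: flat_def)
  next
    case 3
    have "((\<lambda>x. poly P (1 / x) * exp (- (1 / x))) has_real_derivative flat ([:0, 0, 1:] * (P - pderiv P)) x) (at x)"
      using 3 by (auto intro!: derivative_eq_intros simp: flat_def power2_eq_square field_simps)
    moreover have "eventually (\<lambda>y. flat P y = poly P (1 / y) * exp (- (1 / y))) (nhds x)"
      using eventually_nhds_in_open[of "{0<..}" x] 3 by (auto elim!: eventually_mono simp: flat_def)
    ultimately show ?thesis by (subst DERIV_cong_ev[OF refl _ refl]) auto
  qed
qed

lemma smooth_flat: "smooth (flat P)"
proof -
  define Q where "Q n = ((\<lambda>P. [:0, 0, 1:] * (P - pderiv P)) ^^ n) P" for n
  have "(flat (Q n) has_real_derivative flat (Q (Suc n)) x) (at x)" for n x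
    unfolding Q_def using flat_has_derivative by simp
  from Ck_compose_real[where g="\<lambda>n. flat (Q n)", OF this, of _ "\<lambda>x. x" 0]
  show ?thesis by (simp add: smooth_def Q_def Ck_bounded_linear bounded_linear_ident)
qed

text \<open>The quotient of \<open>flat 1 (b - s)\<close> by
  \<open>flat 1 (b - s) + flat 1 (s - a)\<close>. The denominator never vanishes, because a < b puts
  every s below b or above a.\<close>

lemma smooth_step:
  fixes a b :: real assumes "a < b"
  obtains \<eta> :: "real \<Rightarrow> real" where "smooth \<eta>" "\<And>s. s \<le> a \<Longrightarrow> \<eta> s = 1" "\<And>s. b \<le> s \<Longrightarrow> \<eta> s = 0" "\<And>s. 0 \<le> \<eta> s"
proof -
  define D where "D s = flat 1 (b + (-1) * s) + flat 1 ((-a) + s)" for s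
  have pos: "D s > 0" for s
    using assms by (cases "s < b") (auto simp: D_def flat_def intro!: add_pos_nonneg)
  have aff: "smooth (\<lambda>s::real. c + d * s)" for c d
    by (intro smooth_add smooth_mult smooth_const smooth_bounded_linear bounded_linear_ident)
  have "smooth D" unfolding D_def
    using smooth_compose_real[OF smooth_flat aff, of 1 b "-1"] smooth_compose_real[OF smooth_flat aff, of 1 "-a" 1]
    by (auto intro!: smooth_add)
  then have "smooth (\<lambda>s. flat 1 (b + (-1) * s) * inverse (D s))"
    using smooth_compose_real[OF smooth_flat aff, of 1 b "-1"] pos
    by (intro smooth_mult smooth_inverse) (auto simp: less_imp_neq[symmetric] dest: less_imp_neq)
  then show ?thesis
  proof (rule that)
    show "flat 1 (b + - 1 * s) * inverse (D s) = 1" if "s \<le> a" for s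
      using pos[of s] that assms by (simp add: D_def flat_def)
    show "0 \<le> flat 1 (b + - 1 * s) * inverse (D s)" for s
      using pos[of s] by (simp add: flat_def)
  qed (simp add: flat_def)
qed

section \<open>Compactly supported cutoffs\<close>

lemma supp_subset: "closed S \<Longrightarrow> (\<And>x. x \<notin> S \<Longrightarrow> f x = 0) \<Longrightarrow> supp f \<subseteq> S"
  unfolding supp_def support_on_def by (rule closure_minimal) auto

lemma Cc_inftyI: "smooth f \<Longrightarrow> compact S \<Longrightarrow> (\<And>x. x \<notin> S \<Longrightarrow> f x = 0) \<Longrightarrow> Cc_infty f"
proof -
  assume f: "smooth f" "compact S" "\<And>x. x \<notin> S \<Longrightarrow> f x = 0"
  then have "supp f \<subseteq> S" by (intro supp_subset compact_imp_closed)
  then have "supp f = S \<inter> supp f" by auto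
  moreover have "compact (S \<inter> supp f)" using f by (intro compact_Int_closed) (auto simp: supp_def)
  ultimately show ?thesis using f by (simp add: Cc_infty_def)
qed

lemma smooth_cutoff:
  fixes M :: real assumes "M \<ge> 0"
  obtains \<zeta> :: "'a::euclidean_space \<Rightarrow> real" where "Cc_infty \<zeta>" "\<And>x. norm x < M \<Longrightarrow> \<zeta> x = 1" "\<And>x. 0 \<le> \<zeta> x"
proof -
  \<comment> \<open>The cutoff is a function of the squared norm, since the norm itself is not
    smooth at 0; this squares both thresholds.\<close>
  obtain \<eta> :: "real \<Rightarrow> real" where \<eta>: "smooth \<eta>" "\<And>s. s \<le> M\<^sup>2 \<Longrightarrow> \<eta> s = 1" "\<And>s. (M+1)\<^sup>2 \<le> s \<Longrightarrow> \<eta> s = 0" "\<And>s. 0 \<le> \<eta> s"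
    using smooth_step[of "M\<^sup>2" "(M+1)\<^sup>2"] assms power_strict_mono[of M "M+1" 2] by auto
  show ?thesis
  proof (rule that[of "\<lambda>x. \<eta> (x \<bullet> x)"])
    show "Cc_infty (\<lambda>x::'a. \<eta> (x \<bullet> x))"
    proof (rule Cc_inftyI[where S="cball 0 (M+1)"])
      show "smooth (\<lambda>x::'a. \<eta> (x \<bullet> x))"
        using smooth_compose_real[OF \<eta>(1), of "\<lambda>x::'a. x \<bullet> x"] Ck_inner_self by (auto simp: smooth_def)
      show "\<eta> (x \<bullet> x) = 0" if "x \<notin> cball 0 (M+1)" for x :: 'a
        using that assms power_mono[of "M+1" "norm x" 2] by (intro \<eta>) (auto simp: power2_norm_eq_inner)
    qed auto
    show "norm x < M \<Longrightarrow> \<eta> (x \<bullet> x) = 1" for x :: 'a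
      using assms power_mono[of "norm x" M 2] by (intro \<eta>) (auto simp: power2_norm_eq_inner)
  qed (use \<eta> in auto)
qed

section \<open>Second-order differential inequalities\<close>

lemma nonneg_derivative_within_imp_le:
  fixes F :: "real \<Rightarrow> real"
  assumes F: "\<And>t. t \<in> {a..b} \<Longrightarrow> (F has_real_derivative F' t) (at t within {a..b})"
    and nn: "\<And>t. s < t \<Longrightarrow> t < r \<Longrightarrow> 0 \<le> F' t"
    and sr: "a \<le> s" "s \<le> r" "r \<le> b"
  shows "F s \<le> F r"
proof (cases "s = r")
  case False
  have "continuous_on {a..b} F" using F by (rule DERIV_continuous_on)
  then have "continuous_on {s..r} F" by (rule continuous_on_subset) (use sr in auto)
  moreover have "\<exists>y. (F has_real_derivative y) (at t) \<and> 0 \<le> y" if "s < t" "t < r" for t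
    using F[of t] nn[of t] at_within_Icc_at[of a t b] that sr by auto
  ultimately show ?thesis
    using DERIV_nonneg_imp_increasing_open[of s r F] sr by auto
qed simp

lemma linear_growth_comparison:
  fixes D E w :: "real \<Rightarrow> real"
  assumes D: "\<And>t. t \<in> {a..b} \<Longrightarrow> (D has_real_derivative E t) (at t within {a..b})"
    and int: "(\<lambda>s. w s * D s) integrable_on {a..b}"
    and E: "\<And>t. t \<in> {a..b} \<Longrightarrow> E a + integral {a..t} (\<lambda>s. w s * D s) \<le> E t"
    and w: "\<And>s. s \<in> {a..b} \<Longrightarrow> 0 \<le> w s"
    and pos: "0 < D a" "0 \<le> E a"
    and t: "t \<in> {a..b}"
  shows "D a \<le> D t" "E a \<le> E t"
proof -
  have ge: "E a \<le> E r" if "r \<in> {a..b}" "\<And>s. a \<le> s \<Longrightarrow> s < r \<Longrightarrow> 0 < D s" for r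
  proof (cases "a = r")
    case False
    have i: "(\<lambda>s. w s * D s) integrable_on {a..r}"
      using int by (rule integrable_subinterval_real) (use that in auto)
    \<comment> \<open>The sign of D is known strictly before r, so the integrand is altered at the
      single point r.\<close>
    have "0 \<le> integral {a..r} (\<lambda>s. if s = r then 0 else w s * D s)"
      using that w by (intro integral_nonneg integrable_spike[OF i, where S="{r}"]) (auto simp: less_imp_le)
    also have "\<dots> = integral {a..r} (\<lambda>s. w s * D s)"
      by (rule integral_spike[where S="{r}"]) auto
    finally show ?thesis using E[OF that(1)] by simp
  qed simp
  have "continuous_on {a..b} D" using D by (rule DERIV_continuous_on)
  have D_pos: "0 < D s" if "s \<in> {a..b}" for s
  proof (rule ccontr)
    assume "\<not> 0 < D s"
    define S where "S = {t \<in> {a..b}. D t \<le> 0}"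
    have "closed S" unfolding S_def
      using continuous_closed_preimage[OF \<open>continuous_on {a..b} D\<close> closed_atLeastAtMost closed_atMost[of 0]]
      by (auto simp: vimage_def Int_def)
    moreover have "S \<noteq> {}" "bdd_below S" using that \<open>\<not> 0 < D s\<close> by (auto simp: S_def bdd_below_def)
    ultimately have "Inf S \<in> S" by (intro closed_contains_Inf)
    have before: "0 < D r" if "a \<le> r" "r < Inf S" for r
    proof (rule ccontr)
      assume "\<not> 0 < D r"
      then have "r \<in> S" using that \<open>Inf S \<in> S\<close> by (auto simp: S_def)
      then show False using cInf_lower[OF _ \<open>bdd_below S\<close>] that by fastforce
    qed
    have "D a \<le> D (Inf S)"
    proof (rule nonneg_derivative_within_imp_le[OF D])
      fix t assume "a < t" "t < Inf S"
      then show "0 \<le> E t" using ge[of t] before pos \<open>Inf S \<in> S\<close> by (force simp: S_def)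
    qed (use \<open>Inf S \<in> S\<close> in \<open>auto simp: S_def\<close>)
    then show False using pos \<open>Inf S \<in> S\<close> by (auto simp: S_def)
  qed
  show "E a \<le> E t" using ge[OF t] D_pos t by auto
  show "D a \<le> D t"
  proof (rule nonneg_derivative_within_imp_le[OF D])
    fix s assume "a < s" "s < t"
    then show "0 \<le> E s" using ge[of s] D_pos t pos(2) by fastforce
  qed (use t in auto)
qed

text \<open>Exponentiating an approximate solution \<open>\<beta>\<close> of the Riccati equation \<open>\<beta>' + \<beta>\<^sup>2 = t\<^sup>2\<^sup>m\<close> gives a
  subsolution of \<open>y'' = t\<^sup>2\<^sup>m y\<close> with the growth \<open>t powr (- m/2) * exp (\<xi> m t)\<close> of the modified Bessel
  functions.\<close>

definition riccati :: "real \<Rightarrow> real \<Rightarrow> real" where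
  "riccati m t = t powr m - m / 2 * t powr (-1) - (m * (m + 2) / 4) * t powr (- m - 2)"

text \<open>The exponent is an antiderivative of \<open>riccati m\<close>. Thus y' = \<beta> y and
  y'' = (\<beta>' + \<open>\<beta>\<^sup>2\<close>) y.\<close>

definition subsol :: "real \<Rightarrow> real \<Rightarrow> real" where
  "subsol m t = exp (\<xi> m t - m / 2 * ln t + m * (m + 2) / 4 * t powr (- m - 1) / (m + 1))"

text \<open>With Y = \<open>t powr (- m - 1)\<close>, which is at most 1/t, every t beyond this
  value satisfies (m (m + 2) + 2 m + 3) Y \<le> 1. Together with \<open>Y^2\<close> \<le> Y this
  makes the correction terms of \<open>riccati\<close> harmless in both places where they
  occur.\<close>

definition onset :: "real \<Rightarrow> real" where
  "onset m = m * (m + 2) + 2 * m + 3"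

section \<open>The subsolution and its growth\<close>

lemma subsol_pos: "0 < subsol m t"
  by (simp add: subsol_def)

lemma subsol_derivative:
  assumes "0 \<le> m" "0 < t"
  shows "(subsol m has_real_derivative riccati m t * subsol m t) (at t)"
proof -
  have "((\<lambda>t. t powr (m + 1) / (m + 1)) has_real_derivative (m + 1) * t powr (m + 1 - 1) / (m + 1)) (at t)"
    using assms by (intro DERIV_cdivide has_real_derivative_powr)
  moreover have "((\<lambda>t. m / 2 * ln t) has_real_derivative m / 2 * inverse t) (at t)"
    using assms by (intro DERIV_cmult DERIV_ln)
  moreover have "((\<lambda>t. m * (m + 2) / 4 * t powr (- m - 1) / (m + 1)) has_real_derivative
      m * (m + 2) / 4 * ((- m - 1) * t powr (- m - 1 - 1)) / (m + 1)) (at t)"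
    using assms by (intro DERIV_cdivide DERIV_cmult has_real_derivative_powr)
  ultimately have "((\<lambda>t. t powr (m + 1) / (m + 1) - m / 2 * ln t + m * (m + 2) / 4 * t powr (- m - 1) / (m + 1))
      has_real_derivative (m + 1) * t powr (m + 1 - 1) / (m + 1) - m / 2 * inverse t
        + m * (m + 2) / 4 * ((- m - 1) * t powr (- m - 1 - 1)) / (m + 1)) (at t)"
    by (intro DERIV_add DERIV_diff)
  moreover have "(- m - 1) * c / (m + 1) = - c" for c
  proof -
    have "(- m - 1) * c / (m + 1) = - ((m + 1) * c) / (m + 1)" by (simp add: algebra_simps)
    then show ?thesis using assms by simp
  qed
  from this[of "m * (m + 2) / 4 * t powr (- m - 2)"]
  have "m * (m + 2) / 4 * ((- m - 1) * t powr (- m - 1 - 1)) / (m + 1) = - (m * (m + 2) / 4 * t powr (- m - 2))"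
    by (simp add: mult.left_commute diff_diff_eq)
  ultimately have "((\<lambda>t. t powr (m + 1) / (m + 1) - m / 2 * ln t + m * (m + 2) / 4 * t powr (- m - 1) / (m + 1))
      has_real_derivative riccati m t) (at t)"
    using assms by (simp add: riccati_def powr_minus)
  then show ?thesis
    unfolding subsol_def \<xi>_def by (subst mult.commute) (rule DERIV_fun_exp)
qed

lemma onset_bounds:
  assumes "0 \<le> m" "onset m \<le> t"
  shows "1 \<le> t" "(2 * m + 2) * t powr (- m - 1) + (m * (m + 2) / 4) * (t powr (- m - 1))\<^sup>2 \<le> 1"
    "m / 2 * t powr (- m - 1) + m * (m + 2) / 4 * (t powr (- m - 1))\<^sup>2 \<le> 1 / 2"
proof -
  have mm: "0 \<le> m * (m + 2)" using assms by simp
  show t: "1 \<le> t" using assms mm unfolding onset_def by linarith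
  define Y where "Y = t powr (- m - 1)"
  have "Y \<le> t powr (-1)" unfolding Y_def using t assms by (intro powr_mono) auto
  then have "Y * t \<le> 1" using t by (simp add: powr_minus field_simps)
  have Y: "0 < Y" using t by (simp add: Y_def)
  have "Y \<le> Y * t" using Y t by simp
  then have "Y \<le> 1" using \<open>Y * t \<le> 1\<close> by linarith
  then have "Y\<^sup>2 \<le> Y" using Y by (simp add: power2_eq_square)
  have "Y * onset m \<le> 1" using \<open>Y * t \<le> 1\<close> assms Y mult_left_mono[of "onset m" t Y] by linarith
  then have *: "(m * (m + 2)) * Y + 2 * (m * Y) + 3 * Y \<le> 1" by (simp add: onset_def algebra_simps)
  have **: "(m * (m + 2)) * Y\<^sup>2 \<le> (m * (m + 2)) * Y" "0 \<le> (m * (m + 2)) * Y" "0 \<le> m * Y"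
    using mm \<open>Y\<^sup>2 \<le> Y\<close> Y assms by (intro mult_left_mono mult_nonneg_nonneg; simp)+
  have "(2 * m + 2) * Y + (m * (m + 2) / 4) * Y\<^sup>2 = 2 * (m * Y) + 2 * Y + (m * (m + 2) * Y\<^sup>2) / 4"
    by (simp add: algebra_simps)
  then show "(2 * m + 2) * Y + (m * (m + 2) / 4) * Y\<^sup>2 \<le> 1" using * ** Y by linarith
  have "m / 2 * Y + m * (m + 2) / 4 * Y\<^sup>2 = (m * Y) / 2 + (m * (m + 2) * Y\<^sup>2) / 4" by simp
  then show "m / 2 * Y + m * (m + 2) / 4 * Y\<^sup>2 \<le> 1 / 2" using * ** Y by linarith
qed

text \<open>Put c = m (m + 2) / 4. The first two terms of \<open>riccati\<close> alone leave the
  error c \<open>t powr (- 2)\<close>, which has the wrong sign. The third term contributes -2c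
  \<open>t powr (- 2)\<close>, twice what would cancel it; the surplus -c
  \<open>t powr (- 2)\<close> absorbs the remaining terms of lower order once t is beyond the
  onset.\<close>

lemma riccati_derivative:
  assumes "0 \<le> m" "onset m \<le> t"
  obtains r where "(riccati m has_real_derivative r) (at t)" "r + (riccati m t)\<^sup>2 \<le> t powr (2 * m)"
proof -
  note b = onset_bounds[OF assms]
  define X P c where "X = t powr (-1)" and "P = t powr m" and "c = m * (m + 2) / 4"
  have pos: "0 < X" "0 < P" "0 \<le> c" using b(1) assms by (auto simp: X_def P_def c_def)
  have e: "t powr (m - 1) = P * X" "t powr (- 2) = X\<^sup>2" "t powr (- m - 2) = X\<^sup>2 / P"
    "t powr (- m - 3) = X ^ 3 / P" "t powr (- m - 1) = X / P" "t powr (2 * m) = P\<^sup>2"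
  proof -
    have "t powr (- m - 2) = t powr (- 1 + - 1 - m)" "t powr (- m - 3) = t powr (- 1 + - 1 + - 1 - m)"
      "t powr (- m - 1) = t powr (- 1 - m)" "t powr (2 * m) = t powr (m + m)"
      "t powr (m - 1) = t powr (m + - 1)" "t powr (- 2) = t powr (- 1 + - 1)"
      by (rule arg_cong[where f="(powr) t"]; simp)+
    then show "t powr (- m - 2) = X\<^sup>2 / P" "t powr (- m - 3) = X ^ 3 / P"
      "t powr (- m - 1) = X / P" "t powr (2 * m) = P\<^sup>2" "t powr (m - 1) = P * X" "t powr (- 2) = X\<^sup>2"
      by (simp_all only: powr_add powr_diff X_def P_def power2_eq_square power3_eq_cube)
  qed
  show ?thesis
  proof (rule that)
    show "(riccati m has_real_derivative m * (P * X) + m / 2 * X\<^sup>2 + c * (m + 2) * (X ^ 3 / P)) (at t)"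
    proof -
      have "(riccati m has_real_derivative m * t powr (m - 1) - m / 2 * ((- 1) * t powr (- 1 - 1))
          - c * ((- m - 2) * t powr (- m - 2 - 1))) (at t)"
        unfolding riccati_def c_def using b(1) by (intro DERIV_diff DERIV_cmult has_real_derivative_powr) auto
      moreover have "- 1 - 1 = (- 2 :: real)" "- m - 2 - 1 = - m - 3" by simp_all
      ultimately have "(riccati m has_real_derivative m * (P * X) - m / 2 * ((- 1) * X\<^sup>2)
          - c * ((- m - 2) * (X ^ 3 / P))) (at t)" by (simp only: e)
      moreover have "m * (P * X) - m / 2 * ((- 1) * X\<^sup>2) - c * ((- m - 2) * (X ^ 3 / P))
          = m * (P * X) + m / 2 * X\<^sup>2 + c * (m + 2) * (X ^ 3 / P)"
        using pos by (simp add: field_simps)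
      ultimately show ?thesis by (simp only:)
    qed
    have "m * (P * X) + m / 2 * X\<^sup>2 + c * (m + 2) * (X ^ 3 / P) + (riccati m t)\<^sup>2
        = P\<^sup>2 + X\<^sup>2 * (m\<^sup>2 / 4 + m / 2 - 2 * c + c * ((2 * m + 2) * (X / P) + c * (X / P)\<^sup>2))"
      unfolding riccati_def e X_def[symmetric] P_def[symmetric] c_def[symmetric]
      using pos by (simp add: field_simps power2_eq_square power3_eq_cube)
    also have "\<dots> = P\<^sup>2 + X\<^sup>2 * (c * ((2 * m + 2) * (X / P) + c * (X / P)\<^sup>2 - 1))"
      by (simp add: c_def algebra_simps power2_eq_square)
    also have "\<dots> \<le> P\<^sup>2 + 0"
      using b(2) pos unfolding e c_def[symmetric]
      by (intro add_left_mono mult_nonneg_nonpos) auto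
    finally show "m * (P * X) + m / 2 * X\<^sup>2 + c * (m + 2) * (X ^ 3 / P) + (riccati m t)\<^sup>2 \<le> t powr (2 * m)"
      by (simp add: e)
  qed
qed

lemma riccati_ge:
  assumes "0 \<le> m" "onset m \<le> t"
  shows "t powr m / 2 \<le> riccati m t"
proof -
  note b = onset_bounds[OF assms]
  have "riccati m t = t powr m * (1 - (m / 2 * t powr (- m - 1) + m * (m + 2) / 4 * (t powr (- m - 1))\<^sup>2))"
    using b(1) by (simp add: riccati_def algebra_simps power2_eq_square powr_add[symmetric])
  also have "\<dots> \<ge> t powr m * (1 - 1 / 2)"
    using b by (intro mult_left_mono) auto
  finally show ?thesis by simp
qed

lemma subsol_ge:
  assumes "0 \<le> m" "0 < t"
  shows "t powr (- (m / 2)) * exp (\<xi> m t) \<le> subsol m t"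
proof -
  have "t powr (- (m / 2)) * exp (\<xi> m t) = exp (\<xi> m t - m / 2 * ln t)"
    using assms by (simp add: powr_def exp_add[symmetric] algebra_simps)
  also have "\<dots> \<le> subsol m t" using assms by (simp add: subsol_def)
  finally show ?thesis .
qed

text \<open>Without the last factor 1/2 this is the multiple k of the subsolution for which k h < 1
  and k \<beta> h \<le> 1 at the onset, where h is \<open>subsol\<close> and \<beta> is
  \<open>riccati\<close>. The last factor comes from \<open>riccati\<close> being at least half of
  \<open>t powr m\<close>.\<close>

definition growth_constant :: "real \<Rightarrow> real" where
  "growth_constant m = 1 / (2 * (1 + riccati m (onset m)) * subsol m (onset m)) / 2"

lemma riccati_onset_nonneg: "0 \<le> m \<Longrightarrow> 0 \<le> riccati m (onset m)"
  using riccati_ge[of m "onset m"] by (rule order.trans[rotated]) simp_all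

lemma growth_constant_pos: "0 \<le> m \<Longrightarrow> 0 < growth_constant m"
  using riccati_onset_nonneg[of m] subsol_pos[of m "onset m"] by (simp add: growth_constant_def)

text \<open>The comparison lemma is used twice. From time 0 to the onset it carries the bounds U
  \<ge> \<alpha> and V \<ge> \<alpha>. From the onset on it is applied to the differences of U and V
  with the multiple k \<alpha> of the subsolution and of its derivative. The factors
  \<open>t powr m\<close> and \<open>t powr (- (m / 2))\<close> of the two lower bounds combine to
  \<open>t powr (m / 2)\<close>.\<close>

lemma growth_lower_bound:
  assumes m: "0 \<le> (m::real)" and \<alpha>: "0 < \<alpha>" "\<alpha> \<le> U 0" "\<alpha> \<le> V 0"
    and U: "\<And>t. t \<in> {0..b} \<Longrightarrow> (U has_real_derivative V t) (at t within {0..b})"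
    and int: "(\<lambda>s. s powr (2 * m) * U s) integrable_on {0..b}"
    and V: "\<And>s t. 0 \<le> s \<Longrightarrow> s \<le> t \<Longrightarrow> t \<le> b \<Longrightarrow> V s + integral {s..t} (\<lambda>s. s powr (2 * m) * U s) \<le> V t"
    and t: "onset m \<le> t" "t \<le> b"
  shows "growth_constant m * \<alpha> * t powr (m / 2) * exp (\<xi> m t) \<le> V t"
proof -
  let ?w = "\<lambda>s. s powr (2 * m)" and ?h = "subsol m" and ?a = "onset m"
  define k where "k = 1 / (2 * (1 + riccati m ?a) * ?h ?a)"
  have c: "growth_constant m = k / 2" by (simp add: growth_constant_def k_def)
  have r0: "0 \<le> riccati m ?a" using riccati_onset_nonneg[OF m] .
  have h0: "0 < ?h ?a" by (rule subsol_pos)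
  have k: "k > 0" using r0 h0 by (simp add: k_def)
  have k1: "k * ?h ?a < 1" "k * (riccati m ?a * ?h ?a) \<le> 1"
  proof -
    have "k * ?h ?a = 1 / (2 * (1 + riccati m ?a))" using h0 by (simp add: k_def)
    moreover have "1 / (2 * (1 + riccati m ?a)) < 1" "riccati m ?a * (1 / (2 * (1 + riccati m ?a))) \<le> 1"
      using r0 by simp_all
    ultimately show "k * ?h ?a < 1" "k * (riccati m ?a * ?h ?a) \<le> 1"
      by (metis, metis mult.left_commute)
  qed
  show ?thesis
  proof -
    have a: "1 \<le> ?a" using onset_bounds(1)[OF m order.refl] .
    have UV: "\<alpha> \<le> U s" "\<alpha> \<le> V s" if "s \<in> {0..b}" for s
      using linear_growth_comparison[OF U int, where t=s] V[of 0] \<alpha> that by force+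
    define \<delta> where "\<delta> = k * \<alpha>"
    have \<delta>: "\<delta> > 0" using k \<alpha> by (simp add: \<delta>_def)
    define D where "D s = U s - \<delta> * ?h s" for s
    define E where "E s = V s - \<delta> * (riccati m s * ?h s)" for s
    have "\<exists>r. (riccati m has_real_derivative r) (at s) \<and> r + (riccati m s)\<^sup>2 \<le> ?w s" if "?a \<le> s" for s
      using riccati_derivative[OF m that] by blast
    then obtain r where r: "\<And>s. ?a \<le> s \<Longrightarrow> (riccati m has_real_derivative r s) (at s)"
      "\<And>s. ?a \<le> s \<Longrightarrow> r s + (riccati m s)\<^sup>2 \<le> ?w s"
      by metis
    have hc: "continuous_on {?a..b} ?h"
      by (rule DERIV_continuous_on, rule DERIV_subset[OF subsol_derivative[OF m]]) (use a in auto)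
    have wh: "(\<lambda>s. ?w s * ?h s) integrable_on {?a..b}"
      using a by (intro integrable_continuous_interval continuous_intros hc) auto
    have wU: "(\<lambda>s. ?w s * U s) integrable_on {?a..b}"
      using int by (rule integrable_subinterval_real) (use a in auto)
    have "E ?a \<le> E t"
    proof (rule linear_growth_comparison(2)[where D=D and E=E and w="?w" and b=b])
      show "(D has_real_derivative E s) (at s within {?a..b})" if "s \<in> {?a..b}" for s
        unfolding D_def E_def
      proof (intro DERIV_diff DERIV_cmult)
        show "(U has_real_derivative V s) (at s within {onset m..b})"
          by (rule DERIV_subset[OF U]) (use that a in auto)
        show "(?h has_real_derivative riccati m s * ?h s) (at s within {onset m..b})"
          by (rule DERIV_subset[OF subsol_derivative[OF m]]) (use that a in auto)
      qed
      have eq: "(\<lambda>s. ?w s * D s) = (\<lambda>s. ?w s * U s - \<delta> * (?w s * ?h s))"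
        by (auto simp: D_def algebra_simps)
      show "(\<lambda>s. ?w s * D s) integrable_on {?a..b}"
        unfolding eq by (intro integrable_diff integrable_on_mult_right wU wh)
      show "E ?a + integral {?a..s} (\<lambda>s. ?w s * D s) \<le> E s" if "s \<in> {?a..b}" for s
      proof -
        have sub: "{?a..s} \<subseteq> {?a..b}" using that by auto
        have i: "(\<lambda>s. ?w s * U s) integrable_on {?a..s}" "(\<lambda>s. ?w s * ?h s) integrable_on {?a..s}"
          using integrable_subinterval_real[OF wU sub] integrable_subinterval_real[OF wh sub] .
        \<comment> \<open>The integrand is the second derivative of the subsolution, so its integral
          is the increment of the first derivative; the Riccati inequality compares it with the
          weighted integral of the subsolution.\<close>
        have "((\<lambda>s. (r s + (riccati m s)\<^sup>2) * ?h s) has_integral riccati m s * ?h s - riccati m ?a * ?h ?a) {?a..s}"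
        proof (rule fundamental_theorem_of_calculus)
          fix x assume x: "x \<in> {?a..s}"
          have "((\<lambda>s. riccati m s * ?h s) has_real_derivative (r x + (riccati m x)\<^sup>2) * ?h x) (at x)"
            using x a by (auto intro!: derivative_eq_intros r subsol_derivative[OF m] simp: algebra_simps power2_eq_square)
          then show "((\<lambda>s. riccati m s * ?h s) has_vector_derivative (r x + (riccati m x)\<^sup>2) * ?h x) (at x within {?a..s})"
            by (metis has_real_derivative_iff_has_vector_derivative DERIV_subset subset_UNIV)
        qed (use that in auto)
        then have "riccati m s * ?h s - riccati m ?a * ?h ?a \<le> integral {?a..s} (\<lambda>s. ?w s * ?h s)"
          by (rule has_integral_le[OF _ integrable_integral[OF i(2)]])
            (use r(2) subsol_pos in \<open>auto intro!: mult_right_mono simp: less_imp_le\<close>)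
        then have "\<delta> * (riccati m s * ?h s - riccati m ?a * ?h ?a) \<le> \<delta> * integral {?a..s} (\<lambda>s. ?w s * ?h s)"
          using \<delta> by simp
        moreover have "integral {?a..s} (\<lambda>s. ?w s * D s)
            = integral {?a..s} (\<lambda>s. ?w s * U s) - \<delta> * integral {?a..s} (\<lambda>s. ?w s * ?h s)"
          unfolding eq using i by (simp add: integral_diff integrable_on_mult_right)
        ultimately show ?thesis using V[of ?a s] that a by (simp add: E_def algebra_simps)
      qed
      have "\<alpha> * (k * ?h ?a) < \<alpha> * 1" "\<alpha> * (k * (riccati m ?a * ?h ?a)) \<le> \<alpha> * 1"
        using k1 \<alpha> by (intro mult_strict_left_mono mult_left_mono; simp)+
      then show "0 < D ?a" "0 \<le> E ?a"
        using UV[of ?a] a t by (auto simp: D_def E_def \<delta>_def algebra_simps)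
    qed (use t in auto)
    moreover have "0 \<le> E ?a"
    proof -
      have "\<alpha> * (k * (riccati m ?a * ?h ?a)) \<le> \<alpha> * 1"
        using k1 \<alpha> by (intro mult_left_mono; simp)
      then show ?thesis using UV[of ?a] a t by (auto simp: E_def \<delta>_def algebra_simps)
    qed
    ultimately have "\<delta> * (riccati m t * ?h t) \<le> V t" by (simp add: E_def)
    moreover have "(t powr m / 2) * (t powr (- (m / 2)) * exp (\<xi> m t)) \<le> riccati m t * ?h t"
      using riccati_ge[OF m t(1)] subsol_ge[OF m, of t] t a
      by (intro mult_mono order.trans[OF _ riccati_ge[OF m t(1)]]) simp_all
    then have "\<delta> * ((t powr m / 2) * (t powr (- (m / 2)) * exp (\<xi> m t))) \<le> \<delta> * (riccati m t * ?h t)"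
      using \<delta> by simp
    moreover have "t powr m * t powr (- (m / 2)) = t powr (m / 2)"
      by (simp add: powr_add[symmetric])
    then have "\<delta> * ((t powr m / 2) * (t powr (- (m / 2)) * exp (\<xi> m t))) = growth_constant m * \<alpha> * t powr (m / 2) * exp (\<xi> m t)"
      by (simp add: c \<delta>_def mult_ac)
    ultimately show ?thesis by linarith
  qed
qed

text \<open>The value \<open>F\<close> doubles in successive time steps whose lengths form a geometric series, so a
  longer interval would force \<open>F\<close> to be unbounded.\<close>

lemma second_order_blow_up:
  fixes F F' :: "real \<Rightarrow> real"
  assumes F: "\<And>t. t \<in> {a..b} \<Longrightarrow> (F has_real_derivative F' t) (at t within {a..b})"
    and nn: "\<And>t. t \<in> {a..b} \<Longrightarrow> 0 \<le> F' t"
    and superlinear: "\<And>s t B. \<lbrakk>a \<le> s; s \<le> t; t \<le> b; 0 < B; \<And>r. r \<in> {s..t} \<Longrightarrow> B \<le> F r\<rbrakk>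
      \<Longrightarrow> F' s + K * B powr q * (t - s) \<le> F' t"
    and q: "1 < q" and K: "0 < K" and A: "0 < A" "A \<le> F a" and ab: "a \<le> b"
  shows "K * A powr (q - 1) * (b - a)\<^sup>2 \<le> 2 / (1 - 2 powr (- (q - 1) / 2))\<^sup>2"
proof -
  have mono: "F s \<le> F t" if "a \<le> s" "s \<le> t" "t \<le> b" for s t
    by (rule nonneg_derivative_within_imp_le[OF F]) (use nn that in auto)
  have step: "B + K * B powr q * (t - s)\<^sup>2 / 2 \<le> F t"
    if st: "a \<le> s" "s \<le> t" "t \<le> b" and B: "0 < B" "B \<le> F s" for s t B
  proof -
    define G where "G r = F r - K * B powr q * (r - s)\<^sup>2 / 2" for r
    have "G s \<le> G t"
    proof (rule nonneg_derivative_within_imp_le[where F=G and a=a and b=b and F'="\<lambda>r. F' r - K * B powr q * (r - s)"])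
      show "(G has_real_derivative F' r - K * B powr q * (r - s)) (at r within {a..b})" if "r \<in> {a..b}" for r
        unfolding G_def using that by (auto intro!: derivative_eq_intros F)
      show "0 \<le> F' r - K * B powr q * (r - s)" if "s < r" "r < t" for r
        using superlinear[of s r B] nn[of s] mono[of s] B st that by force
    qed (use st in auto)
    then show ?thesis using B by (simp add: G_def)
  qed
  \<comment> \<open>The steps have length \<open>\<delta> * \<beta> ^ k\<close>. For B =
    \<open>2 ^ k * A\<close> the choices of \<beta> and \<delta> make
    \<open>K * B powr q * (\<delta> * \<beta> ^ k)\<^sup>2 / 2\<close> equal to B, so each step is
    just long enough for F to double. The steps add up to \<delta> / (1 - \<beta>), whose square
    gives the bound.\<close>
  define \<beta> where "\<beta> = 2 powr (- (q - 1) / 2)"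
  have \<beta>: "0 < \<beta>" "\<beta> < 1" using q by (auto simp: \<beta>_def powr_less_one)
  define \<delta> where "\<delta> = sqrt (2 / (K * A powr (q - 1)))"
  have \<delta>2: "\<delta>\<^sup>2 = 2 / (K * A powr (q - 1))" and \<delta>: "0 < \<delta>" using K A by (auto simp: \<delta>_def)
  have "b - a \<le> \<delta> / (1 - \<beta>)"
  proof (rule ccontr)
    assume long: "\<not> b - a \<le> \<delta> / (1 - \<beta>)"
    define \<tau> where "\<tau> k = a + \<delta> * (\<Sum>j<k. \<beta> ^ j)" for k
    have "(\<Sum>j<k. \<beta> ^ j) \<le> 1 / (1 - \<beta>)" for k
    proof -
      have "(\<Sum>j<k. \<beta> ^ j) \<le> (\<Sum>j. \<beta> ^ j)"
        using \<beta> by (intro sum_le_suminf) (auto simp: summable_geometric)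
      also have "\<dots> = 1 / (1 - \<beta>)" using \<beta> by (intro suminf_geometric) auto
      finally show ?thesis .
    qed
    then have "\<delta> * (\<Sum>j<k. \<beta> ^ j) \<le> \<delta> * (1 / (1 - \<beta>))" for k
      by (rule mult_left_mono) (use \<delta> in auto)
    then have \<tau>b: "\<tau> k \<le> b" for k
      using long unfolding \<tau>_def by (simp add: not_le) (smt (verit, best))
    have \<tau>a: "a \<le> \<tau> k" for k
      using \<delta> \<beta> by (auto simp: \<tau>_def intro!: sum_nonneg mult_nonneg_nonneg)
    have \<tau>S: "\<tau> (Suc k) - \<tau> k = \<delta> * \<beta> ^ k" for k by (simp add: \<tau>_def algebra_simps)
    have "2 ^ k * A \<le> F (\<tau> k)" for k
    proof (induction k)
      case 0 then show ?case using A by (simp add: \<tau>_def)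
    next
      case (Suc k)
      let ?B = "2 ^ k * A"
      have B: "0 < ?B" using A by simp
      have "(\<beta> ^ k)\<^sup>2 = (2 ^ k) powr (- (q - 1))"
      proof -
        have "\<beta>\<^sup>2 = 2 powr (- (q - 1))" by (simp add: \<beta>_def power2_eq_square powr_add[symmetric])
        then have "(\<beta>\<^sup>2) ^ k = (2 powr real k) powr (- (q - 1))"
          by (simp add: powr_power powr_powr mult.commute)
        then show ?thesis by (simp add: powr_realpow power_mult[symmetric] mult.commute)
      qed
      then have "K * ?B powr q * (\<delta> * \<beta> ^ k)\<^sup>2 / 2
          = ?B powr q * (A powr (- (q - 1)) * (2 ^ k) powr (- (q - 1)))"
        using K A powr_minus[of A "q - 1"] by (simp add: power_mult_distrib \<delta>2 field_simps)
      also have "\<dots> = ?B powr q * ?B powr (- (q - 1))"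
        using A by (simp add: powr_mult)
      also have "\<dots> = ?B" using B by (simp add: powr_add[symmetric])
      finally have "K * ?B powr q * (\<delta> * \<beta> ^ k)\<^sup>2 / 2 = ?B" .
      moreover have "?B + K * ?B powr q * (\<tau> (Suc k) - \<tau> k)\<^sup>2 / 2 \<le> F (\<tau> (Suc k))"
      proof (rule step[OF \<tau>a _ \<tau>b B Suc.IH])
        have "0 \<le> \<delta> * \<beta> ^ k" using \<delta> \<beta> by simp
        then show "\<tau> k \<le> \<tau> (Suc k)" using \<tau>S[of k] by linarith
      qed
      ultimately show ?case by (simp add: \<tau>S mult_ac)
    qed
    then have "2 ^ k * A \<le> F b" for k
      using mono[OF \<tau>a \<tau>b order.refl, of k] order.trans by blast
    then have "2 ^ k \<le> F b / A" for k using A by (simp add: field_simps)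
    then show False using real_arch_pow[of 2 "F b / A"] by (meson not_le one_less_numeral_iff semiring_norm(76))
  qed
  then have "(b - a)\<^sup>2 \<le> (\<delta> / (1 - \<beta>))\<^sup>2" using ab by (intro power_mono) auto
  then have "(b - a)\<^sup>2 * (K * A powr (q - 1)) \<le> 2 / (1 - \<beta>)\<^sup>2"
    using K A \<beta> by (simp add: power_divide \<delta>2 field_simps)
  then show ?thesis by (simp add: \<beta>_def mult_ac)
qed

section \<open>Averages of plane waves\<close>

text \<open>Integrating a function of \<open>sgn y\<close> over the unit ball stands in for the surface integral over the
  sphere.\<close>

definition wave_average :: "'a::euclidean_space \<Rightarrow> real" where
  "wave_average x = (\<integral>y. indicator (ball 0 1) y * exp (x \<bullet> sgn y) \<partial>lborel)"

section \<open>Size of the averaged plane wave\<close>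

lemma nn_integral_gaussian:
  fixes z :: "'a::euclidean_space"
  assumes r: "0 < r"
  shows "(\<integral>\<^sup>+y. ennreal (exp (- r * (norm (y - z))\<^sup>2 / 4)) \<partial>lborel) = ennreal (sqrt (4 * pi / r) ^ DIM('a))"
proof -
  have one: "(\<integral>\<^sup>+s. ennreal (exp (- r * (s - c)\<^sup>2 / 4)) \<partial>lborel) = ennreal (sqrt (4 * pi / r))" for c :: real
  proof -
    have "exp (- r * (s - c)\<^sup>2 / 4) = sqrt (4 * pi / r) * normal_density c (sqrt (2 / r)) s" for s
      using r by (simp add: normal_density_def real_sqrt_divide field_simps)
    then have "(\<integral>\<^sup>+s. ennreal (exp (- r * (s - c)\<^sup>2 / 4)) \<partial>lborel)
        = (\<integral>\<^sup>+s. ennreal (sqrt (4 * pi / r)) * ennreal (normal_density c (sqrt (2 / r)) s) \<partial>lborel)"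
      using r by (simp add: ennreal_mult)
    also have "\<dots> = ennreal (sqrt (4 * pi / r)) * (\<integral>\<^sup>+s. ennreal (normal_density c (sqrt (2 / r)) s) \<partial>lborel)"
      by (rule nn_integral_cmult) measurable
    also have "(\<integral>\<^sup>+s. ennreal (normal_density c (sqrt (2 / r)) s) \<partial>lborel) = 1"
      using r by (subst nn_integral_eq_integral) auto
    finally show ?thesis by simp
  qed
  have "(\<integral>\<^sup>+y. ennreal (exp (- r * (norm (y - z))\<^sup>2 / 4)) \<partial>lborel)
      = (\<integral>\<^sup>+y. (\<Prod>b\<in>Basis. ennreal (exp (- r * (y \<bullet> b - z \<bullet> b)\<^sup>2 / 4))) \<partial>lborel)"
  proof (rule nn_integral_cong)
    fix y :: 'a
    have "(norm (y - z))\<^sup>2 = (\<Sum>b\<in>Basis. (y \<bullet> b - z \<bullet> b)\<^sup>2)"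
      unfolding power2_norm_eq_inner by (subst euclidean_inner) (simp add: power2_eq_square inner_diff_left)
    then have "exp (- r * (norm (y - z))\<^sup>2 / 4) = (\<Prod>b\<in>Basis. exp (- r * (y \<bullet> b - z \<bullet> b)\<^sup>2 / 4))"
      by (simp add: exp_sum[symmetric] sum_negf sum_distrib_left sum_divide_distrib)
    then show "ennreal (exp (- r * (norm (y - z))\<^sup>2 / 4)) = (\<Prod>b\<in>Basis. ennreal (exp (- r * (y \<bullet> b - z \<bullet> b)\<^sup>2 / 4)))"
      by (simp add: prod_ennreal)
  qed
  also have "\<dots> = (\<Prod>b\<in>(Basis::'a set). (\<integral>\<^sup>+s. ennreal (exp (- r * (s - z \<bullet> b)\<^sup>2 / 4)) \<partial>lborel))"
    by (rule nn_integral_lborel_prod) auto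
  also have "\<dots> = ennreal (sqrt (4 * pi / r)) ^ DIM('a)"
    by (simp only: one prod_constant)
  also have "\<dots> = ennreal (sqrt (4 * pi / r) ^ DIM('a))"
    using r by (intro ennreal_power) simp
  finally show ?thesis .
qed

lemma sgn_measurable [measurable]: "(sgn :: 'a::euclidean_space \<Rightarrow> 'a) \<in> borel_measurable borel"
  unfolding sgn_div_norm by measurable

lemma norm_sgn_le: "norm (sgn x) \<le> 1"
  by (simp add: norm_sgn)

lemma inner_sgn_le: "x \<bullet> sgn y \<le> norm x"
  using norm_cauchy_schwarz[of x "sgn y"] mult_left_mono[OF norm_sgn_le[of y] norm_ge_zero[of x]] by linarith

text \<open>The main contribution to the average comes from the directions within distance of order
  \<open>1 / sqrt (norm x)\<close> of \<open>x\<close>.  A point \<open>y\<close> of the unit ball is about as far from the line through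
  \<open>x\<close> as \<open>sgn y\<close> is from \<open>sgn x\<close>, so the integrand is dominated by Gaussians centred on that line.\<close>

lemma plane_wave_le_gaussians:
  fixes x y :: "'a::euclidean_space"
  assumes x: "1 \<le> norm x" and y: "norm y < 1" "y \<noteq> 0"
  shows "ennreal (exp (x \<bullet> sgn y)) \<le> ennreal (exp (norm x + 1 / 2) * sqrt (norm x)) *
    (\<integral>\<^sup>+\<tau>. indicator {-1..2::real} \<tau> * ennreal (exp (- norm x * (norm (y - \<tau> *\<^sub>R sgn x))\<^sup>2 / 4)) \<partial>lborel)"
proof -
  define r e a where "r = norm x" and "e = sgn x" and "a = norm (sgn y - e)"
  have r: "1 \<le> r" and e: "norm e = 1" using x by (auto simp: r_def e_def norm_sgn)
  have "x \<noteq> 0" using x by auto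
  then have xe: "x = r *\<^sub>R e" by (simp add: r_def e_def sgn_div_norm)
  have s: "norm (sgn y) = 1" using y by (simp add: norm_sgn)
  have "a\<^sup>2 = 2 - 2 * (e \<bullet> sgn y)"
    using e s by (simp add: a_def power2_norm_eq_inner inner_diff inner_commute norm_eq_1)
  then have "e \<bullet> sgn y = 1 - a\<^sup>2 / 2" by linarith
  then have xy: "x \<bullet> sgn y = r - r * a\<^sup>2 / 2" by (simp add: xe right_diff_distrib)
  \<comment> \<open>Shifting the centre by at most \<delta> along the line costs the bounded factor
    exp(1/2), since r \<open>\<delta>\<^sup>2\<close> = 1; integrating over a segment of length
    \<delta> costs 1/\<delta> = sqrt r. As norm y < 1 and \<delta> \<le> 1, all these segments lie
    in the fixed range of \<tau>.\<close>
  define \<delta> where "\<delta> = 1 / sqrt r"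
  have \<delta>: "0 < \<delta>" "\<delta> \<le> 1" "r * \<delta>\<^sup>2 = 1" using r by (auto simp: \<delta>_def power_divide)
  have gauss: "exp (- r * a\<^sup>2 / 2 - 1 / 2) \<le> exp (- r * (norm (y - \<tau> *\<^sub>R e))\<^sup>2 / 4)"
    if \<tau>: "\<tau> \<in> {norm y..norm y + \<delta>}" for \<tau>
  proof -
    have "y - \<tau> *\<^sub>R e = norm y *\<^sub>R (sgn y - e) + (norm y - \<tau>) *\<^sub>R e"
      using y by (simp add: sgn_div_norm algebra_simps)
    then have "norm (y - \<tau> *\<^sub>R e) \<le> norm y * a + \<bar>norm y - \<tau>\<bar>"
      using norm_triangle_ineq[of "norm y *\<^sub>R (sgn y - e)" "(norm y - \<tau>) *\<^sub>R e"] e by (simp add: a_def)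
    also have "\<dots> \<le> a + \<delta>"
      using \<tau> y mult_right_mono[of "norm y" 1 a] by (auto simp: a_def)
    finally have "(norm (y - \<tau> *\<^sub>R e))\<^sup>2 \<le> (a + \<delta>)\<^sup>2" by (intro power_mono) auto
    also have "\<dots> \<le> 2 * a\<^sup>2 + 2 * \<delta>\<^sup>2" using sum_squares_bound[of a \<delta>] by (simp add: power2_sum)
    finally have "r * (norm (y - \<tau> *\<^sub>R e))\<^sup>2 \<le> r * (2 * a\<^sup>2 + 2 * \<delta>\<^sup>2)"
      using r by (intro mult_left_mono) auto
    then show ?thesis using \<delta>(3) by (simp add: algebra_simps)
  qed
  have "ennreal (exp (x \<bullet> sgn y)) = ennreal (exp (r + 1 / 2) * sqrt r) * (ennreal (exp (- r * a\<^sup>2 / 2 - 1 / 2)) * ennreal \<delta>)"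
  proof -
    have "exp (x \<bullet> sgn y) = exp (r + 1 / 2) * exp (- r * a\<^sup>2 / 2 - 1 / 2)"
      by (simp add: xy exp_add[symmetric])
    moreover have "sqrt r * \<delta> = 1" using r by (simp add: \<delta>_def)
    ultimately have "exp (x \<bullet> sgn y) = (exp (r + 1 / 2) * sqrt r) * (exp (- r * a\<^sup>2 / 2 - 1 / 2) * \<delta>)"
      by (simp add: mult_ac)
    then show ?thesis using r \<delta> by (simp add: ennreal_mult[symmetric])
  qed
  also have "ennreal (exp (- r * a\<^sup>2 / 2 - 1 / 2)) * ennreal \<delta>
      = (\<integral>\<^sup>+\<tau>. ennreal (exp (- r * a\<^sup>2 / 2 - 1 / 2)) * indicator {norm y..norm y + \<delta>} \<tau> \<partial>lborel)"
    using \<delta> by (simp add: nn_integral_cmult)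
  also have "\<dots> \<le> (\<integral>\<^sup>+\<tau>. indicator {-1..2} \<tau> * ennreal (exp (- r * (norm (y - \<tau> *\<^sub>R e))\<^sup>2 / 4)) \<partial>lborel)"
  proof (rule nn_integral_mono)
    fix \<tau> :: real
    have "\<tau> \<in> {-1..2}" if "\<tau> \<in> {norm y..norm y + \<delta>}" using that y \<delta>
      by (smt (verit) atLeastAtMost_iff norm_ge_zero)
    then show "ennreal (exp (- r * a\<^sup>2 / 2 - 1 / 2)) * indicator {norm y..norm y + \<delta>} \<tau>
        \<le> indicator {-1..2} \<tau> * ennreal (exp (- r * (norm (y - \<tau> *\<^sub>R e))\<^sup>2 / 4))"
      using gauss[of \<tau>] by (auto simp: indicator_def intro!: ennreal_leI split: if_splits)
  qed
  finally show ?thesis by (simp add: r_def e_def mult_left_mono)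
qed

lemma wave_average_nn:
  fixes x :: "'a::euclidean_space"
  shows "integrable lborel (\<lambda>y. indicator (ball 0 1) y * exp (x \<bullet> sgn y))"
    and "ennreal (wave_average x) = (\<integral>\<^sup>+y. indicator (ball 0 1) y * ennreal (exp (x \<bullet> sgn y)) \<partial>lborel)"
proof -
  have [measurable]: "(\<lambda>y. exp (x \<bullet> sgn y)) \<in> borel_measurable borel" by measurable
  have [measurable]: "ball (0::'a) 1 \<in> sets borel" by simp
  show int: "integrable lborel (\<lambda>y. indicator (ball 0 1) y * exp (x \<bullet> sgn y))"
  proof (rule Bochner_Integration.integrable_bound)
    show "integrable lborel (\<lambda>y. indicator (ball (0::'a) 1) y * exp (norm x))"
      by (intro integrable_mult_left integrable_real_indicator emeasure_lborel_ball_finite) simp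
    show "AE y in lborel. norm (indicator (ball 0 1) y * exp (x \<bullet> sgn y)) \<le> norm (indicator (ball 0 1) y * exp (norm x))"
      by (auto simp: indicator_def intro!: inner_sgn_le)
  qed measurable
  show "ennreal (wave_average x) = (\<integral>\<^sup>+y. indicator (ball 0 1) y * ennreal (exp (x \<bullet> sgn y)) \<partial>lborel)"
    unfolding wave_average_def using int
    by (subst nn_integral_eq_integral[symmetric]) (auto intro!: nn_integral_cong simp: indicator_def)
qed

lemma wave_average_nonneg: "0 \<le> wave_average x"
  unfolding wave_average_def by (intro integral_nonneg_AE) (auto simp: indicator_def)

text \<open>For norm x = r \<ge> 1 each dominating Gaussian has total mass
  \<open>sqrt (4 * pi / r) ^ DIM('a)\<close>, the centres range over an interval of length 3, and
  the prefactor contributes sqrt r: altogether \<open>exp r * r powr (- (DIM('a) - 1) / 2)\<close>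
  up to a constant. This is the decay factor of the spherical average of plane waves known from the
  asymptotics of modified Bessel functions. For r < 1 the volume of the unit ball suffices.\<close>

lemma wave_average_le:
  obtains C where "C > 0" "\<And>x::'a::euclidean_space. wave_average x \<le> C * exp (norm x) * (1 + norm x) powr (- ((real DIM('a) - 1) / 2))"
proof -
  let ?D = "DIM('a)"
  define \<kappa> where "\<kappa> = (real ?D - 1) / 2"
  have D: "1 \<le> real ?D" using DIM_positive[where 'a='a] by (simp add: Suc_leI)
  then have \<kappa>: "0 \<le> \<kappa>" by (simp add: \<kappa>_def)
  define \<omega> where "\<omega> = measure lborel (ball (0::'a) 1)"
  define C1 where "C1 = 3 * exp (1 / 2) * sqrt (4 * pi) ^ ?D"
  define C where "C = (C1 + \<omega> + 1) * 2 powr \<kappa>"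
  have C1: "0 \<le> C1" "0 \<le> \<omega>" by (auto simp: C1_def \<omega>_def)
  have "wave_average x \<le> C * exp (norm x) * (1 + norm x) powr (- \<kappa>)" for x :: 'a
  proof (cases "1 \<le> norm x")
    case True
    let ?r = "norm x"
    have "ennreal (wave_average x) \<le> (\<integral>\<^sup>+y. ennreal (exp (?r + 1 / 2) * sqrt ?r) *
      (\<integral>\<^sup>+\<tau>. indicator {-1..2::real} \<tau> * ennreal (exp (- ?r * (norm (y - \<tau> *\<^sub>R sgn x))\<^sup>2 / 4)) \<partial>lborel) \<partial>lborel)"
      unfolding wave_average_nn
    proof (rule nn_integral_mono_AE)
      show "AE y in lborel. indicator (ball 0 1) y * ennreal (exp (x \<bullet> sgn y)) \<le> ennreal (exp (?r + 1 / 2) * sqrt ?r) *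
        (\<integral>\<^sup>+\<tau>. indicator {-1..2::real} \<tau> * ennreal (exp (- ?r * (norm (y - \<tau> *\<^sub>R sgn x))\<^sup>2 / 4)) \<partial>lborel)"
        using AE_lborel_singleton[of 0]
        by (rule AE_mp) (use plane_wave_le_gaussians[OF True] in \<open>auto simp: indicator_def\<close>)
    qed
    also have "\<dots> = ennreal (exp (?r + 1 / 2) * sqrt ?r) * (\<integral>\<^sup>+y. (\<integral>\<^sup>+\<tau>. indicator {-1..2::real} \<tau> *
        ennreal (exp (- ?r * (norm (y - \<tau> *\<^sub>R sgn x))\<^sup>2 / 4)) \<partial>lborel) \<partial>lborel)"
      by (rule nn_integral_cmult) measurable
    also have "(\<integral>\<^sup>+y. (\<integral>\<^sup>+\<tau>. indicator {-1..2::real} \<tau> *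
        ennreal (exp (- ?r * (norm (y - \<tau> *\<^sub>R sgn x))\<^sup>2 / 4)) \<partial>lborel) \<partial>lborel)
      = (\<integral>\<^sup>+\<tau>. (\<integral>\<^sup>+y. indicator {-1..2::real} \<tau> *
        ennreal (exp (- ?r * (norm (y - \<tau> *\<^sub>R sgn x))\<^sup>2 / 4)) \<partial>lborel) \<partial>lborel)"
      by (rule lborel_pair.Fubini') measurable
    also have "\<dots> = (\<integral>\<^sup>+\<tau>. indicator {-1..2::real} \<tau> * ennreal (sqrt (4 * pi / ?r) ^ ?D) \<partial>lborel)"
    proof (rule nn_integral_cong)
      fix \<tau> :: real
      have "(\<integral>\<^sup>+y. indicator {-1..2::real} \<tau> * ennreal (exp (- ?r * (norm (y - \<tau> *\<^sub>R sgn x))\<^sup>2 / 4)) \<partial>lborel)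
        = indicator {-1..2::real} \<tau> * (\<integral>\<^sup>+y. ennreal (exp (- ?r * (norm (y - \<tau> *\<^sub>R sgn x))\<^sup>2 / 4)) \<partial>lborel)"
        by (rule nn_integral_cmult) measurable
      also have "(\<integral>\<^sup>+y. ennreal (exp (- ?r * (norm (y - \<tau> *\<^sub>R sgn x))\<^sup>2 / 4)) \<partial>lborel)
        = ennreal (sqrt (4 * pi / ?r) ^ ?D)"
        by (rule nn_integral_gaussian) (use True in linarith)
      finally show "(\<integral>\<^sup>+y. indicator {-1..2::real} \<tau> * ennreal (exp (- ?r * (norm (y - \<tau> *\<^sub>R sgn x))\<^sup>2 / 4)) \<partial>lborel)
        = indicator {-1..2::real} \<tau> * ennreal (sqrt (4 * pi / ?r) ^ ?D)" .
    qed
    also have "\<dots> = ennreal 3 * ennreal (sqrt (4 * pi / ?r) ^ ?D)"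
      by (subst nn_integral_multc) auto
    also have "ennreal (exp (?r + 1 / 2) * sqrt ?r) * (ennreal 3 * ennreal (sqrt (4 * pi / ?r) ^ ?D))
      = ennreal ((exp (?r + 1 / 2) * sqrt ?r) * (3 * sqrt (4 * pi / ?r) ^ ?D))"
      using True by (simp only: ennreal_mult'' ennreal_mult' mult_nonneg_nonneg zero_le_numeral zero_le_power real_sqrt_ge_zero)
        (simp add: ennreal_mult'' ennreal_mult')
    finally have "wave_average x \<le> (exp (?r + 1 / 2) * sqrt ?r) * (3 * sqrt (4 * pi / ?r) ^ ?D)"
      using True by (subst (asm) ennreal_le_iff) auto
    also have "\<dots> = C1 * exp ?r * ?r powr (- \<kappa>)"
    proof -
      have r0: "0 < ?r" using True by linarith
      have "sqrt (4 * pi / ?r) ^ ?D = sqrt (4 * pi) ^ ?D * ?r powr (- (real ?D / 2))"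
      proof -
        have "sqrt ?r ^ ?D = ?r powr (real ?D / 2)"
          using r0 by (simp add: powr_half_sqrt[symmetric] powr_power)
        then have "?r powr (- (real ?D / 2)) = 1 / sqrt ?r ^ ?D"
          by (simp add: powr_minus inverse_eq_divide)
        then show ?thesis by (simp add: real_sqrt_divide power_divide)
      qed
      moreover have "sqrt ?r * ?r powr (- (real ?D / 2)) = ?r powr (- \<kappa>)"
      proof -
        have "sqrt ?r * ?r powr (- (real ?D / 2)) = ?r powr (1 / 2 + - (real ?D / 2))"
          unfolding powr_add using r0 by (simp add: powr_half_sqrt)
        also have "1 / 2 + - (real ?D / 2) = - \<kappa>" by (simp add: \<kappa>_def field_simps)
        finally show ?thesis .
      qed
      ultimately show ?thesis by (simp add: C1_def exp_add mult_ac)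
    qed
    also have "\<dots> \<le> C1 * exp ?r * (2 powr \<kappa> * (1 + ?r) powr (- \<kappa>))"
    proof (intro mult_left_mono)
      have "?r powr (- \<kappa>) = 2 powr \<kappa> * (2 * ?r) powr (- \<kappa>)"
        using True by (simp add: powr_mult powr_minus)
      also have "\<dots> \<le> 2 powr \<kappa> * (1 + ?r) powr (- \<kappa>)"
        using True \<kappa> by (intro mult_left_mono powr_mono2') auto
      finally show "?r powr (- \<kappa>) \<le> 2 powr \<kappa> * (1 + ?r) powr (- \<kappa>)" .
    qed (use C1 in auto)
    also have "\<dots> = C1 * (2 powr \<kappa> * exp ?r * (1 + ?r) powr (- \<kappa>))" by simp
    also have "\<dots> \<le> (C1 + \<omega> + 1) * (2 powr \<kappa> * exp ?r * (1 + ?r) powr (- \<kappa>))"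
      using C1 by (intro mult_right_mono) auto
    also have "\<dots> = C * exp ?r * (1 + ?r) powr (- \<kappa>)" by (simp add: C_def)
    finally show ?thesis .
  next
    case False
    let ?r = "norm x"
    have "wave_average x \<le> (\<integral>y. indicator (ball 0 1) y * exp ?r \<partial>(lborel :: 'a measure))"
      unfolding wave_average_def
    proof (intro integral_mono wave_average_nn)
      show "integrable lborel (\<lambda>y. indicator (ball (0::'a) 1) y * exp ?r)"
        by (intro integrable_mult_left integrable_real_indicator emeasure_lborel_ball_finite) simp
    qed (auto simp: indicator_def intro!: inner_sgn_le)
    also have "\<dots> = \<omega> * exp ?r" by (simp add: \<omega>_def)
    also have "\<dots> \<le> \<omega> * exp ?r * (2 powr \<kappa> * (1 + ?r) powr (- \<kappa>))"
    proof -
      have "2 powr (- \<kappa>) \<le> (1 + ?r) powr (- \<kappa>)"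
        using False \<kappa> by (intro powr_mono2') (auto simp: add_pos_nonneg)
      then have "2 powr \<kappa> * 2 powr (- \<kappa>) \<le> 2 powr \<kappa> * (1 + ?r) powr (- \<kappa>)"
        by (intro mult_left_mono) auto
      then have "1 \<le> 2 powr \<kappa> * (1 + ?r) powr (- \<kappa>)" by (simp add: powr_minus)
      then show ?thesis using C1 mult_left_mono[of 1 "2 powr \<kappa> * (1 + ?r) powr (- \<kappa>)" "\<omega> * exp ?r"] by simp
    qed
    also have "\<dots> = \<omega> * (2 powr \<kappa> * exp ?r * (1 + ?r) powr (- \<kappa>))" by simp
    also have "\<dots> \<le> (C1 + \<omega> + 1) * (2 powr \<kappa> * exp ?r * (1 + ?r) powr (- \<kappa>))"
      using C1 by (intro mult_right_mono) auto
    also have "\<dots> = C * exp ?r * (1 + ?r) powr (- \<kappa>)" by (simp add: C_def)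
    finally show ?thesis .
  qed
  moreover have "C > 0" using C1 by (simp add: C_def)
  ultimately show ?thesis using that[of C] by (simp add: \<kappa>_def)
qed

section \<open>Concentration of the integrals near the boundary sphere\<close>

lemma power_diff_le:
  fixes \<rho> :: real assumes "1 \<le> \<rho>" "n \<ge> 1"
  shows "\<rho> ^ n - (\<rho> - 1) ^ n \<le> real n * \<rho> ^ (n - 1)"
proof -
  have "1 + real n * (- 1 / \<rho>) \<le> (1 + (- 1 / \<rho>)) ^ n"
    using assms by (intro Bernoulli_inequality) (simp add: field_simps)
  then have "\<rho> ^ n * (1 + real n * (- 1 / \<rho>)) \<le> \<rho> ^ n * (1 + (- 1 / \<rho>)) ^ n"
    using assms by (intro mult_left_mono) auto
  also have "\<dots> = (\<rho> - 1) ^ n"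
    using assms by (simp add: power_mult_distrib[symmetric] algebra_simps)
  also have "\<rho> ^ n * (1 + real n * (- 1 / \<rho>)) = \<rho> ^ n - real n * \<rho> ^ (n - 1)"
    using assms by (cases n) (auto simp: field_simps)
  finally show ?thesis by simp
qed

text \<open>Induction over unit shells: the integral over a ball is that over the outer shell, of volume
  \<open>O(\<rho> ^ (n - 1))\<close>, plus \<open>exp (- c)\<close> times the integral for the radius \<open>\<rho> - 1\<close>.\<close>

lemma nn_integral_boundary_layer:
  assumes c: "0 < (c::real)"
  obtains C where "0 < C" "\<And>\<rho>. 0 \<le> \<rho> \<Longrightarrow>
    (\<integral>\<^sup>+x. indicator (cball (0::'a::euclidean_space) \<rho>) x * ennreal (exp (- c * (\<rho> - norm x))) \<partial>lborel)
      \<le> ennreal (C * (1 + \<rho>) ^ (DIM('a) - 1))"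
proof -
  let ?D = "DIM('a)"
  define K where "K \<rho> = (\<integral>\<^sup>+x. indicator (cball (0::'a) \<rho>) x * ennreal (exp (- c * (\<rho> - norm x))) \<partial>lborel)" for \<rho>
  define \<omega> where "\<omega> = unit_ball_vol (real ?D)"
  have \<omega>: "0 < \<omega>" by (simp add: \<omega>_def)
  have D: "?D \<ge> 1" using DIM_positive[where 'a='a] by (simp add: Suc_leI)
  have vol: "emeasure lborel (cball (0::'a) \<rho>) = ennreal (\<omega> * \<rho> ^ ?D)" if "0 \<le> \<rho>" for \<rho>
    using that by (simp add: emeasure_cball \<omega>_def)
  \<comment> \<open>C solves C = C exp(-c) + \<omega> DIM, the recursion that passes from radius
    \<rho> - 1 to \<rho>. The induction is on an integer that exceeds the radius.\<close>
  define C where "C = \<omega> * real ?D / (1 - exp (- c))"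
  have e1: "0 < 1 - exp (- c)" using c by simp
  have C: "0 < C" using \<omega> D e1 by (simp add: C_def)
  have C_eq: "C * exp (- c) + \<omega> * real ?D = C" using e1 by (simp add: C_def field_simps)
  have "K \<rho> \<le> ennreal (C * (1 + \<rho>) ^ (?D - 1))" if "0 \<le> \<rho>" "\<rho> < real n" for \<rho> n
    using that
  proof (induction n arbitrary: \<rho>)
    case (Suc n)
    show ?case
    proof (cases "1 \<le> \<rho>")
      case False
      have "K \<rho> \<le> (\<integral>\<^sup>+x. indicator (cball (0::'a) \<rho>) x \<partial>lborel)"
        unfolding K_def using c by (intro nn_integral_mono) (auto simp: indicator_def)
      also have "\<dots> = ennreal (\<omega> * \<rho> ^ ?D)" using vol[of \<rho>] Suc.prems by simp
      also have "\<dots> \<le> ennreal (C * (1 + \<rho>) ^ (?D - 1))"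
      proof (intro ennreal_leI mult_mono)
        have "\<omega> * (1 - exp (- c)) \<le> \<omega> * real ?D" using \<omega> D by (intro mult_left_mono) (auto intro: order.trans[of _ 1])
        then show "\<omega> \<le> C" using e1 by (simp add: C_def field_simps)
        show "\<rho> ^ ?D \<le> (1 + \<rho>) ^ (?D - 1)"
        proof (rule order.trans)
          show "\<rho> ^ ?D \<le> 1" using False Suc.prems by (intro power_le_one) auto
          show "1 \<le> (1 + \<rho>) ^ (?D - 1)" using Suc.prems by (intro one_le_power) auto
        qed
      qed (use C Suc.prems in auto)
      finally show ?thesis .
    next
      case True
      have "K \<rho> \<le> (\<integral>\<^sup>+x. ennreal (exp (- c)) * (indicator (cball (0::'a) (\<rho> - 1)) x * ennreal (exp (- c * (\<rho> - 1 - norm x))))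
          + indicator (cball 0 \<rho> - cball 0 (\<rho> - 1)) x \<partial>lborel)"
        unfolding K_def
      proof (rule nn_integral_mono)
        fix x :: 'a
        have "exp (- c * (\<rho> - norm x)) = exp (- c) * exp (- c * (\<rho> - 1 - norm x))"
          by (simp add: exp_add[symmetric] algebra_simps)
        moreover have "exp (- c * (\<rho> - norm x)) \<le> 1" if "norm x \<le> \<rho>" using c that by simp
        ultimately show "indicator (cball 0 \<rho>) x * ennreal (exp (- c * (\<rho> - norm x)))
          \<le> ennreal (exp (- c)) * (indicator (cball 0 (\<rho> - 1)) x * ennreal (exp (- c * (\<rho> - 1 - norm x))))
            + indicator (cball 0 \<rho> - cball 0 (\<rho> - 1)) x"
          by (auto simp: indicator_def ennreal_mult[symmetric])
      qed
      also have "\<dots> = ennreal (exp (- c)) * K (\<rho> - 1) + emeasure lborel (cball (0::'a) \<rho> - cball 0 (\<rho> - 1))"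
      proof -
        have [measurable]: "cball (0::'a) r \<in> sets borel" for r by simp
        let ?f = "\<lambda>x::'a. indicator (cball 0 (\<rho> - 1)) x * ennreal (exp (- c * (\<rho> - 1 - norm x)))"
        have "(\<integral>\<^sup>+x. ennreal (exp (- c)) * ?f x + indicator (cball 0 \<rho> - cball 0 (\<rho> - 1)) x \<partial>lborel)
          = (\<integral>\<^sup>+x. ennreal (exp (- c)) * ?f x \<partial>lborel) + (\<integral>\<^sup>+x. indicator (cball (0::'a) \<rho> - cball 0 (\<rho> - 1)) x \<partial>lborel)"
          by (rule nn_integral_add) measurable
        also have "(\<integral>\<^sup>+x. ennreal (exp (- c)) * ?f x \<partial>lborel) = ennreal (exp (- c)) * (\<integral>\<^sup>+x. ?f x \<partial>lborel)"
          by (rule nn_integral_cmult) measurable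
        also have "(\<integral>\<^sup>+x. indicator (cball (0::'a) \<rho> - cball 0 (\<rho> - 1)) x \<partial>lborel)
          = emeasure lborel (cball (0::'a) \<rho> - cball 0 (\<rho> - 1))"
          by (rule nn_integral_indicator) measurable
        finally show ?thesis by (simp only: K_def)
      qed
      also have "emeasure lborel (cball (0::'a) \<rho> - cball 0 (\<rho> - 1)) = ennreal (\<omega> * \<rho> ^ ?D - \<omega> * (\<rho> - 1) ^ ?D)"
        using True \<omega> by (subst emeasure_Diff) (auto simp: vol ennreal_minus)
      also have "ennreal (exp (- c)) * K (\<rho> - 1) + ennreal (\<omega> * \<rho> ^ ?D - \<omega> * (\<rho> - 1) ^ ?D)
        \<le> ennreal (exp (- c)) * ennreal (C * (1 + (\<rho> - 1)) ^ (?D - 1)) + ennreal (\<omega> * (real ?D * \<rho> ^ (?D - 1)))"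
      proof (intro add_mono mult_left_mono ennreal_leI)
        show "K (\<rho> - 1) \<le> ennreal (C * (1 + (\<rho> - 1)) ^ (?D - 1))" using Suc.prems True by (intro Suc.IH) auto
        show "\<omega> * \<rho> ^ ?D - \<omega> * (\<rho> - 1) ^ ?D \<le> \<omega> * (real ?D * \<rho> ^ (?D - 1))"
          using power_diff_le[OF True D] \<omega> unfolding right_diff_distrib[symmetric] by (intro mult_left_mono) auto
      qed auto
      also have "\<dots> = ennreal (exp (- c) * (C * \<rho> ^ (?D - 1)) + \<omega> * (real ?D * \<rho> ^ (?D - 1)))"
        using C \<omega> True by (simp add: ennreal_mult[symmetric] ennreal_plus[symmetric] del: ennreal_plus)
      also have "\<dots> = ennreal ((C * exp (- c) + \<omega> * real ?D) * \<rho> ^ (?D - 1))" by (simp add: algebra_simps)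
      also have "\<dots> \<le> ennreal (C * (1 + \<rho>) ^ (?D - 1))"
        unfolding C_eq using C True by (intro ennreal_leI mult_left_mono power_mono) auto
      finally show ?thesis .
    qed
  qed simp
  then have "K \<rho> \<le> ennreal (C * (1 + \<rho>) ^ (?D - 1))" if "0 \<le> \<rho>" for \<rho>
    using that reals_Archimedean2 by blast
  then show ?thesis using that[of C] C by (simp add: K_def)
qed

text \<open>Applied with z the distance to the boundary sphere: a polynomial loss in z is paid for
  with half of an exponential. The scale 2 \<kappa> + 1 is chosen so that raising to the power
  \<kappa> leaves an exponent of at most z / 2.\<close>

lemma power_le_exp_half:
  fixes \<kappa> z :: real
  assumes "0 \<le> \<kappa>" "0 \<le> z"
  shows "(1 + z) powr \<kappa> \<le> (2 * \<kappa> + 1) powr \<kappa> * exp (z / 2)"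
proof -
  have "1 + z \<le> (2 * \<kappa> + 1) * exp (z / (2 * \<kappa> + 1))"
  proof -
    have "(2 * \<kappa> + 1) * (1 + z / (2 * \<kappa> + 1)) \<le> (2 * \<kappa> + 1) * exp (z / (2 * \<kappa> + 1))"
      using assms exp_ge_add_one_self[of "z / (2 * \<kappa> + 1)"] by (intro mult_left_mono) auto
    moreover have "(2 * \<kappa> + 1) * (1 + z / (2 * \<kappa> + 1)) = 2 * \<kappa> + 1 + z" using assms by (simp add: field_simps)
    ultimately show ?thesis using assms by linarith
  qed
  then have "(1 + z) powr \<kappa> \<le> ((2 * \<kappa> + 1) * exp (z / (2 * \<kappa> + 1))) powr \<kappa>"
    using assms by (intro powr_mono2) auto
  also have "\<dots> = (2 * \<kappa> + 1) powr \<kappa> * exp (z / (2 * \<kappa> + 1) * \<kappa>)"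
    using assms by (simp add: powr_mult exp_powr_real)
  also have "\<dots> \<le> (2 * \<kappa> + 1) powr \<kappa> * exp (z / 2)"
  proof -
    have "z * (2 * \<kappa>) \<le> z * (2 * \<kappa> + 1)" using assms by (intro mult_left_mono) auto
    then have "z / (2 * \<kappa> + 1) * \<kappa> \<le> z / 2" using assms by (simp add: field_simps)
    then show ?thesis by (intro mult_left_mono) auto
  qed
  finally show ?thesis .
qed

lemma measurable_wave_average [measurable]: "wave_average \<in> borel_measurable borel"
proof -
  have [measurable]: "ball (0::'a) 1 \<in> sets borel" by simp
  have "(\<lambda>x::'a. \<integral>y. indicator (ball 0 1) y * exp (x \<bullet> sgn y) \<partial>lborel) \<in> borel_measurable borel"
    by measurable
  then show ?thesis by (simp add: wave_average_def[abs_def])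
qed

text \<open>From 1 + \<rho> \<le> (1 + r) (1 + (\<rho> - r)) the weight
  \<open>(1 + r) powr (- \<kappa>)\<close> can be replaced by its value at r = \<rho> at the cost of
  exp((\<rho> - r) / 2). The s-th power then still decays like exp(- s (\<rho> - r) / 2) away from
  the sphere, so the boundary layer contributes DIM - 1 powers of 1 + \<rho>. The exponent is DIM -
  1 - \<kappa> s with \<kappa> = (DIM - 1) / 2.\<close>

lemma wave_average_power_integral:
  assumes s: "1 < (s::real)"
  obtains C where "0 < C"
    "\<And>\<rho>. 0 \<le> \<rho> \<Longrightarrow> integrable lborel (\<lambda>x::'a::euclidean_space. (indicator (cball 0 \<rho>) x * wave_average x) powr s)"
    "\<And>\<rho>. 0 \<le> \<rho> \<Longrightarrow> (\<integral>x. (indicator (cball (0::'a) \<rho>) x * wave_average x) powr s \<partial>lborel)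
      \<le> C * exp (s * \<rho>) * (1 + \<rho>) powr ((real DIM('a) - 1) * (1 - s / 2))"
proof -
  let ?D = "DIM('a)"
  define \<kappa> where "\<kappa> = (real ?D - 1) / 2"
  have D: "?D \<ge> 1" using DIM_positive[where 'a='a] by (simp add: Suc_leI)
  then have \<kappa>: "0 \<le> \<kappa>" by (simp add: \<kappa>_def)
  obtain C1 where C1: "C1 > 0" "\<And>x::'a. wave_average x \<le> C1 * exp (norm x) * (1 + norm x) powr (- \<kappa>)"
    using wave_average_le[where 'a='a] unfolding \<kappa>_def by metis
  obtain C2 where C2: "0 < C2" "\<And>\<rho>. 0 \<le> \<rho> \<Longrightarrow>
    (\<integral>\<^sup>+x. indicator (cball (0::'a) \<rho>) x * ennreal (exp (- (s / 2) * (\<rho> - norm x))) \<partial>lborel)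
      \<le> ennreal (C2 * (1 + \<rho>) ^ (?D - 1))"
    using nn_integral_boundary_layer[of "s / 2"] s by auto
  define C3 where "C3 = (C1 * (2 * \<kappa> + 1) powr \<kappa>) powr s"
  have C3: "0 < C3" using C1 \<kappa> by (simp add: C3_def)
  have pw: "wave_average x powr s \<le> C3 * exp (s * \<rho>) * (1 + \<rho>) powr (- (\<kappa> * s)) * exp (- (s / 2) * (\<rho> - norm x))"
    if x: "norm x \<le> \<rho>" for x :: 'a and \<rho>
  proof -
    let ?r = "norm x"
    have \<rho>: "0 \<le> \<rho>" using x norm_ge_zero order.trans by blast
    have "1 + \<rho> \<le> (1 + ?r) * (1 + (\<rho> - ?r))"
      using x mult_nonneg_nonneg[of ?r "\<rho> - ?r"] by (simp add: algebra_simps)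
    then have "(1 + \<rho>) powr \<kappa> \<le> ((1 + ?r) * (1 + (\<rho> - ?r))) powr \<kappa>"
      using \<kappa> \<rho> by (intro powr_mono2) auto
    also have "\<dots> = (1 + ?r) powr \<kappa> * (1 + (\<rho> - ?r)) powr \<kappa>"
      using x by (simp add: powr_mult)
    also have "\<dots> \<le> (1 + ?r) powr \<kappa> * ((2 * \<kappa> + 1) powr \<kappa> * exp ((\<rho> - ?r) / 2))"
      using x by (intro mult_left_mono power_le_exp_half \<kappa>) auto
    finally have "(1 + \<rho>) powr \<kappa> \<le> (1 + ?r) powr \<kappa> * ((2 * \<kappa> + 1) powr \<kappa> * exp ((\<rho> - ?r) / 2))" .
    moreover have "0 < 1 + ?r" "0 < 1 + \<rho>" using \<rho> by (auto simp: add_pos_nonneg)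
    ultimately have "(1 + ?r) powr (- \<kappa>) \<le> (2 * \<kappa> + 1) powr \<kappa> * exp ((\<rho> - ?r) / 2) * (1 + \<rho>) powr (- \<kappa>)"
      by (simp add: powr_minus field_simps)
    then have "C1 * exp ?r * (1 + ?r) powr (- \<kappa>) \<le> C1 * exp ?r * ((2 * \<kappa> + 1) powr \<kappa> * exp ((\<rho> - ?r) / 2) * (1 + \<rho>) powr (- \<kappa>))"
      using C1 by (intro mult_left_mono) auto
    then have "wave_average x powr s \<le> (C1 * exp ?r * ((2 * \<kappa> + 1) powr \<kappa> * exp ((\<rho> - ?r) / 2) * (1 + \<rho>) powr (- \<kappa>))) powr s"
      using C1(2)[of x] wave_average_nonneg[of x] s by (intro powr_mono2) auto
    also have "\<dots> = C3 * (exp ?r * exp ((\<rho> - ?r) / 2)) powr s * ((1 + \<rho>) powr (- \<kappa>)) powr s"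
      using C1 by (simp add: C3_def powr_mult mult_ac)
    also have "((1 + \<rho>) powr (- \<kappa>)) powr s = (1 + \<rho>) powr (- (\<kappa> * s))" by (simp add: powr_powr)
    also have "(exp ?r * exp ((\<rho> - ?r) / 2)) powr s = exp (s * \<rho>) * exp (- (s / 2) * (\<rho> - ?r))"
      by (simp add: exp_add[symmetric] exp_powr_real algebra_simps)
    finally show ?thesis by (simp add: mult_ac)
  qed
  have nn: "(\<integral>\<^sup>+x. ennreal ((indicator (cball (0::'a) \<rho>) x * wave_average x) powr s) \<partial>lborel)
      \<le> ennreal (C3 * C2 * exp (s * \<rho>) * (1 + \<rho>) powr ((real ?D - 1) * (1 - s / 2)))"
    if \<rho>: "0 \<le> \<rho>" for \<rho>
  proof -
    let ?k = "C3 * exp (s * \<rho>) * (1 + \<rho>) powr (- (\<kappa> * s))"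
    have [measurable]: "cball (0::'a) \<rho> \<in> sets borel" by simp
    have "(\<integral>\<^sup>+x. ennreal ((indicator (cball (0::'a) \<rho>) x * wave_average x) powr s) \<partial>lborel)
      \<le> (\<integral>\<^sup>+x. ennreal ?k * (indicator (cball (0::'a) \<rho>) x * ennreal (exp (- (s / 2) * (\<rho> - norm x)))) \<partial>lborel)"
    proof (rule nn_integral_mono)
      fix x :: 'a
      show "ennreal ((indicator (cball 0 \<rho>) x * wave_average x) powr s)
        \<le> ennreal ?k * (indicator (cball 0 \<rho>) x * ennreal (exp (- (s / 2) * (\<rho> - norm x))))"
        using pw[of x \<rho>] C3 by (auto simp: indicator_def ennreal_mult[symmetric] intro!: ennreal_leI)
    qed
    also have "\<dots> = ennreal ?k * (\<integral>\<^sup>+x. (indicator (cball (0::'a) \<rho>) x * ennreal (exp (- (s / 2) * (\<rho> - norm x)))) \<partial>lborel)"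
      by (rule nn_integral_cmult) measurable
    also have "\<dots> \<le> ennreal ?k * ennreal (C2 * (1 + \<rho>) ^ (?D - 1))"
      by (intro mult_left_mono C2 \<rho>) auto
    also have "\<dots> = ennreal (?k * (C2 * (1 + \<rho>) ^ (?D - 1)))"
      using C2 C3 \<rho> by (intro ennreal_mult[symmetric]) auto
    also have "?k * (C2 * (1 + \<rho>) ^ (?D - 1)) = C3 * C2 * exp (s * \<rho>) * (1 + \<rho>) powr ((real ?D - 1) * (1 - s / 2))"
    proof -
      have "(1 + \<rho>) ^ (?D - 1) = (1 + \<rho>) powr (real ?D - 1)"
        using \<rho> D by (simp add: powr_realpow[symmetric] of_nat_diff)
      moreover have "(1 + \<rho>) powr (- (\<kappa> * s)) * (1 + \<rho>) powr (real ?D - 1) = (1 + \<rho>) powr ((real ?D - 1) * (1 - s / 2))"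
        unfolding powr_add[symmetric] by (rule arg_cong[where f="(powr) (1 + \<rho>)"]) (simp add: \<kappa>_def field_simps)
      ultimately show ?thesis by (simp add: mult_ac)
    qed
    finally show ?thesis .
  qed
  have int: "integrable lborel (\<lambda>x::'a. (indicator (cball 0 \<rho>) x * wave_average x) powr s)" if "0 \<le> \<rho>" for \<rho>
  proof (rule integrableI_nonneg)
    show "(\<integral>\<^sup>+x. ennreal ((indicator (cball (0::'a) \<rho>) x * wave_average x) powr s) \<partial>lborel) < \<infinity>"
      using nn[OF that] by (rule order.strict_trans1) simp
    have [measurable]: "cball (0::'a) \<rho> \<in> sets borel" by simp
    show "(\<lambda>x::'a. (indicator (cball 0 \<rho>) x * wave_average x) powr s) \<in> borel_measurable lborel" by measurable
  qed simp
  show ?thesis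
  proof (rule that[of "C3 * C2"])
    show "(\<integral>x. (indicator (cball (0::'a) \<rho>) x * wave_average x) powr s \<partial>lborel)
      \<le> C3 * C2 * exp (s * \<rho>) * (1 + \<rho>) powr ((real ?D - 1) * (1 - s / 2))" if "0 \<le> \<rho>" for \<rho>
      using nn[OF that] C2 C3 by (subst (asm) nn_integral_eq_integral[OF int[OF that]]) (auto simp: ennreal_le_iff)
  qed (use C2 C3 int in auto)
qed

text \<open>Young's inequality for |w| and \<open>\<kappa> powr (p - 1) * h\<close> is integrated
  with the optimal scale \<kappa> = A / B, for which \<open>p * \<kappa> powr (p - 1) * A - (p - 1)
  * \<kappa> powr p * B\<close> equals the left-hand side. In this form an upper bound for the dual
  integral is enough.\<close>

lemma Hoelder_lower_bound:
  fixes w h :: "'a \<Rightarrow> real"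
  assumes p: "1 < p" and A: "0 \<le> A" "A \<le> (\<integral>x. \<bar>w x\<bar> * h x \<partial>M)"
    and B: "0 < B" "(\<integral>x. h x powr (p / (p - 1)) \<partial>M) \<le> B"
    and h: "\<And>x. 0 \<le> h x"
    and int: "integrable M (\<lambda>x. \<bar>w x\<bar> powr p)" "integrable M (\<lambda>x. \<bar>w x\<bar> * h x)"
      "integrable M (\<lambda>x. h x powr (p / (p - 1)))"
  shows "A powr p * B powr (1 - p) \<le> (\<integral>x. \<bar>w x\<bar> powr p \<partial>M)"
proof (cases "A = 0")
  case True then show ?thesis by (simp add: integral_nonneg_AE)
next
  case False
  define \<kappa> where "\<kappa> = A / B"
  have \<kappa>: "0 < \<kappa>" using A B False by (simp add: \<kappa>_def)
  have pp: "1 / p + 1 / (p / (p - 1)) = 1" "p / (p - 1) > 1" using p by (auto simp: field_simps)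
  have "p * \<kappa> powr (p - 1) * (\<bar>w x\<bar> * h x) \<le> \<bar>w x\<bar> powr p + (p - 1) * \<kappa> powr p * h x powr (p / (p - 1))" for x
  proof -
    have "\<bar>w x\<bar> * (\<kappa> powr (p - 1) * h x)
        \<le> \<bar>w x\<bar> powr p / p + (\<kappa> powr (p - 1) * h x) powr (p / (p - 1)) / (p / (p - 1))"
      using h by (intro Youngs_inequality p pp) auto
    also have "(\<kappa> powr (p - 1) * h x) powr (p / (p - 1)) = \<kappa> powr p * h x powr (p / (p - 1))"
      using h[of x] p by (simp add: powr_mult powr_powr)
    finally have "p * (\<bar>w x\<bar> * (\<kappa> powr (p - 1) * h x))
        \<le> p * (\<bar>w x\<bar> powr p / p + \<kappa> powr p * h x powr (p / (p - 1)) / (p / (p - 1)))"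
      using p by (intro mult_left_mono) auto
    also have "\<dots> = \<bar>w x\<bar> powr p + (p - 1) * \<kappa> powr p * h x powr (p / (p - 1))"
      using p by (simp add: field_simps)
    finally show ?thesis by (simp add: mult_ac)
  qed
  then have "(\<integral>x. p * \<kappa> powr (p - 1) * (\<bar>w x\<bar> * h x) \<partial>M)
      \<le> (\<integral>x. \<bar>w x\<bar> powr p + (p - 1) * \<kappa> powr p * h x powr (p / (p - 1)) \<partial>M)"
    using int by (intro integral_mono) auto
  then have "p * \<kappa> powr (p - 1) * (\<integral>x. \<bar>w x\<bar> * h x \<partial>M)
      \<le> (\<integral>x. \<bar>w x\<bar> powr p \<partial>M) + (p - 1) * \<kappa> powr p * (\<integral>x. h x powr (p / (p - 1)) \<partial>M)"
    using int by simp
  moreover have "p * \<kappa> powr (p - 1) * A \<le> p * \<kappa> powr (p - 1) * (\<integral>x. \<bar>w x\<bar> * h x \<partial>M)"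
    using A p by (intro mult_left_mono) auto
  moreover have "(p - 1) * \<kappa> powr p * (\<integral>x. h x powr (p / (p - 1)) \<partial>M) \<le> (p - 1) * \<kappa> powr p * B"
    using B p by (intro mult_left_mono) auto
  moreover have "p * \<kappa> powr (p - 1) * A = p * (A powr p * B powr (1 - p))"
    "(p - 1) * \<kappa> powr p * B = p * (A powr p * B powr (1 - p)) - A powr p * B powr (1 - p)"
  proof -
    have "\<kappa> powr p * B = A powr p * B powr (1 - p)" "\<kappa> powr (p - 1) * A = A powr p * B powr (1 - p)"
      using A B False by (simp_all add: \<kappa>_def powr_divide powr_diff field_simps)
    then show "p * \<kappa> powr (p - 1) * A = p * (A powr p * B powr (1 - p))"
      "(p - 1) * \<kappa> powr p * B = p * (A powr p * B powr (1 - p)) - A powr p * B powr (1 - p)"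
      by (simp_all add: mult.assoc left_diff_distrib)
  qed
  ultimately show ?thesis by linarith
qed

text \<open>The hypothesis for a = sgn y is integrated over y in the unit ball and the integrals are
  exchanged; y = 0, where sgn y is not a unit vector, is a null set. Since w vanishes outside a
  ball, exp \<rho> times |w| times the indicator of the unit ball dominates the integrand.\<close>

lemma plane_waves_average:
  fixes w :: "'a::euclidean_space \<Rightarrow> real"
  assumes w: "integrable lborel w" "\<And>x. x \<notin> cball 0 \<rho> \<Longrightarrow> w x = 0"
    and L: "\<And>a. norm a = 1 \<Longrightarrow> L \<le> (\<integral>x. w x * exp (a \<bullet> x) \<partial>lborel)"
  shows "measure lborel (ball (0::'a) 1) * L \<le> (\<integral>x. w x * wave_average x \<partial>lborel)"
    "integrable lborel (\<lambda>x. w x * wave_average x)"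
proof -
  have [measurable]: "w \<in> borel_measurable borel" using w(1) by simp
  have [measurable]: "ball (0::'a) 1 \<in> sets borel" by simp
  define k where "k x y = indicator (ball 0 1) y * (w x * exp (y \<bullet> x))" for x y :: 'a
  define f where "f x y = indicator (ball 0 1) y * (w x * exp (x \<bullet> sgn y))" for x y :: 'a
  have f_le: "\<bar>f x y\<bar> \<le> exp \<rho> * \<bar>w x\<bar> * indicator (ball 0 1) y" for x y
  proof (cases "x \<in> cball 0 \<rho>")
    case True
    then have "exp (x \<bullet> sgn y) \<le> exp \<rho>" using inner_sgn_le[of x y] by simp
    then have "\<bar>w x\<bar> * exp (x \<bullet> sgn y) \<le> \<bar>w x\<bar> * exp \<rho>" by (rule mult_left_mono) simp
    then show ?thesis by (auto simp: f_def indicator_def abs_mult mult.commute)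
  qed (simp add: f_def w)
  have b: "integrable lborel (\<lambda>y. c * indicator (ball (0::'a) 1) y)" for c :: real
    by (intro integrable_mult_right integrable_real_indicator emeasure_lborel_ball_finite) simp
  have fy: "integrable lborel (\<lambda>y. f x y)" for x
    by (rule Bochner_Integration.integrable_bound[OF b[of "exp \<rho> * \<bar>w x\<bar>"]])
      (use f_le in \<open>auto simp: f_def\<close>)
  have fm: "case_prod f \<in> borel_measurable (lborel \<Otimes>\<^sub>M lborel)" unfolding f_def by measurable
  have wave: "(\<integral>y. f x y \<partial>lborel) = w x * wave_average x" for x
  proof -
    have "(\<integral>y. f x y \<partial>lborel) = (\<integral>y. w x * (indicator (ball 0 1) y * exp (x \<bullet> sgn y)) \<partial>lborel)"
      by (simp add: f_def mult_ac)
    then show ?thesis by (simp add: wave_average_def)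
  qed
  have ff: "integrable (lborel \<Otimes>\<^sub>M lborel) (case_prod f)"
  proof (rule lborel_pair.Fubini_integrable[OF fm])
    show "integrable lborel (\<lambda>x. \<integral>y. norm (case (x, y) of (x, y) \<Rightarrow> f x y) \<partial>lborel)"
    proof (rule Bochner_Integration.integrable_bound)
      show "integrable lborel (\<lambda>x. exp \<rho> * \<bar>w x\<bar> * measure lborel (ball (0::'a) 1))"
        using w by simp
      show "AE x in lborel. norm (\<integral>y. norm (case (x, y) of (x, y) \<Rightarrow> f x y) \<partial>lborel)
          \<le> norm (exp \<rho> * \<bar>w x\<bar> * measure lborel (ball (0::'a) 1))"
      proof (intro AE_I2)
        fix x
        have "(\<integral>y. norm (f x y) \<partial>lborel) \<le> (\<integral>y. exp \<rho> * \<bar>w x\<bar> * indicator (ball (0::'a) 1) y \<partial>lborel)"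
          using f_le by (intro integral_mono integrable_norm fy b) auto
        then show "norm (\<integral>y. norm (case (x, y) of (x, y) \<Rightarrow> f x y) \<partial>lborel)
          \<le> norm (exp \<rho> * \<bar>w x\<bar> * measure lborel (ball (0::'a) 1))"
          by (simp add: integral_nonneg_AE)
      qed
      show "(\<lambda>x. \<integral>y. norm (case (x, y) of (x, y) \<Rightarrow> f x y) \<partial>lborel) \<in> borel_measurable lborel"
        using fm by measurable
    qed
    show "AE x in lborel. integrable lborel (\<lambda>y. case (x, y) of (x, y) \<Rightarrow> f x y)" using fy by simp
  qed
  show "integrable lborel (\<lambda>x. w x * wave_average x)"
    using lborel_pair.integrable_fst[OF ff] by (simp add: wave)
  have "measure lborel (ball (0::'a) 1) * L = (\<integral>y. L * indicator (ball (0::'a) 1) y \<partial>lborel)" by simp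
  also have "\<dots> \<le> (\<integral>y. (\<integral>x. f x y \<partial>lborel) \<partial>lborel)"
  proof (rule integral_mono_AE[OF b])
    show "integrable lborel (\<lambda>y. \<integral>x. f x y \<partial>lborel)"
      using lborel_pair.integrable_snd[OF ff] by simp
    have "L * indicator (ball (0::'a) 1) y \<le> (\<integral>x. f x y \<partial>lborel)" if "y \<noteq> 0" for y
      using L[of "sgn y"] that by (auto simp: f_def indicator_def norm_sgn inner_commute)
    then show "AE y in lborel. L * indicator (ball (0::'a) 1) y \<le> (\<integral>x. f x y \<partial>lborel)"
      using AE_lborel_singleton[of "0::'a"] by (auto elim: AE_mp)
  qed
  also have "\<dots> = (\<integral>x. (\<integral>y. f x y \<partial>lborel) \<partial>lborel)"
    by (rule lborel_pair.Fubini_integral[OF ff])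
  finally show "measure lborel (ball (0::'a) 1) * L \<le> (\<integral>x. w x * wave_average x \<partial>lborel)"
    by (simp add: wave)
qed

section \<open>Square-integrable functions and time slices\<close>

text \<open>Lebesgue measure on the product is the completion of the product measure. The
  exceptional set is therefore enlarged to a Borel null set before Fubini is applied, and the
  quantifiers are exchanged because the slices are taken in the second coordinate.\<close>

lemma AE_slices:
  assumes "AE z in (lebesgue :: ('a::euclidean_space \<times> 'b::euclidean_space) measure). P z"
  shows "AE t in lborel. AE x in lborel. P (x, t)"
proof -
  have "AE z in (lborel :: ('a \<times> 'b) measure). P z" using assms by (simp add: AE_completion_iff)
  then obtain N where N: "{z \<in> space lborel. \<not> P z} \<subseteq> N" "emeasure lborel N = 0" "N \<in> sets lborel"
    by (rule AE_E)
  have "AE z in lborel \<Otimes>\<^sub>M lborel. z \<notin> N"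
    unfolding lborel_prod using N by (intro AE_not_in) auto
  then have "AE x in lborel. AE t in lborel. (x, t) \<notin> N" by (rule lborel_pair.AE_pair)
  moreover have "{z \<in> space (lborel \<Otimes>\<^sub>M lborel). (fst z, snd z) \<notin> N} \<in> sets (lborel \<Otimes>\<^sub>M lborel)"
    using N(3) unfolding lborel_prod by (simp add: Collect_mem_eq sets.compl_sets Collect_neg_eq)
  ultimately have "AE t in lborel. AE x in lborel. (x, t) \<notin> N" by (subst (asm) lborel_pair.AE_commute)
  then show ?thesis
    by (rule eventually_mono) (use N(1) in \<open>auto elim!: eventually_mono\<close>)
qed

lemma integrable_lebesgue_imp_borel:
  fixes h :: "'a::euclidean_space \<Rightarrow> real"
  assumes "integrable lebesgue h"
  obtains h' where "integrable lborel h'" "AE x in lborel. h x = h' x"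
    "(\<integral>x. h x \<partial>lebesgue) = (\<integral>x. h' x \<partial>lborel)"
proof -
  obtain h' where h': "h' \<in> borel_measurable lborel" "AE x in lborel. h x = h' x"
    using completion_ex_borel_measurable_real[of h lborel] assms by auto
  have ae: "AE x in lebesgue. h x = h' x" using h'(2) by (rule AE_completion)
  have m: "h' \<in> borel_measurable lebesgue" using h'(1) by (rule measurable_completion)
  have "integrable lebesgue h'"
    using integrable_cong_AE_imp[OF assms m] ae by (auto elim: eventually_mono)
  then have "integrable lborel h'" using h'(1) integrable_completion by blast
  moreover have "(\<integral>x. h x \<partial>lebesgue) = (\<integral>x. h' x \<partial>lebesgue)"
    using assms m ae by (intro integral_cong_AE) auto
  moreover have "(\<integral>x. h' x \<partial>lebesgue) = (\<integral>x. h' x \<partial>lborel)" using h'(1) by (rule integral_completion)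
  ultimately show ?thesis using that[of h'] h'(2) by simp
qed


lemma lebesgue_measurable_slice_cong:
  fixes f g :: "'a::euclidean_space \<Rightarrow> real"
  assumes "AE x in lborel. f x = g x" "g \<in> borel_measurable lborel"
  shows "f \<in> borel_measurable lebesgue" "AE x in lebesgue. f x = g x"
proof -
  show ae: "AE x in lebesgue. f x = g x" using assms(1) by (rule AE_completion)
  have "g \<in> borel_measurable lebesgue" using assms(2) by (rule measurable_completion)
  then show "f \<in> borel_measurable lebesgue"
    by (rule borel_measurable_AE) (use ae in \<open>eventually_elim, simp\<close>)
qed

text \<open>Fubini for a Lebesgue integrable function through a Borel representative. The
  representative agrees almost everywhere with the function on almost every slice only, so the
  conclusion about single slices holds for almost every t.\<close>

lemma integrable_slices:
  fixes h :: "'a::euclidean_space \<times> 'b::euclidean_space \<Rightarrow> real"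
  assumes h: "integrable lebesgue h"
  shows "AE t in lebesgue. integrable lebesgue (\<lambda>x. h (x, t))"
    "integrable lebesgue (\<lambda>t. \<integral>x. h (x, t) \<partial>lebesgue)"
proof -
  obtain h' where h': "integrable lborel h'" "AE z in lborel. h z = h' z"
    using integrable_lebesgue_imp_borel[OF h] by metis
  have h'2: "integrable (lborel \<Otimes>\<^sub>M lborel) (\<lambda>(x, t). h' (x, t))"
    using h'(1) by (simp add: lborel_prod)
  have [measurable]: "h' \<in> borel_measurable (borel \<Otimes>\<^sub>M borel)"
    using h'(1) by (simp add: borel_prod)
  have ae: "AE t in lborel. AE x in lborel. h (x, t) = h' (x, t)"
    by (rule AE_slices) (use h'(2) in \<open>rule AE_completion\<close>)
  have int: "AE t in lborel. integrable lborel (\<lambda>x. h' (x, t))"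
    using lborel_pair.AE_integrable_snd[OF h'2] .
  have slice: "integrable lebesgue (\<lambda>x. h (x, t)) \<and> (\<integral>x. h (x, t) \<partial>lebesgue) = (\<integral>x. h' (x, t) \<partial>lborel)"
    if "AE x in lborel. h (x, t) = h' (x, t)" "integrable lborel (\<lambda>x. h' (x, t))" for t
  proof -
    have m: "(\<lambda>x. h' (x, t)) \<in> borel_measurable lborel" using that(2) by simp
    note c = lebesgue_measurable_slice_cong[OF that(1) m]
    have "integrable lebesgue (\<lambda>x. h' (x, t))" using that(2) integrable_completion[OF m] by blast
    then have "integrable lebesgue (\<lambda>x. h (x, t))"
      by (rule integrable_cong_AE_imp) (use c in \<open>auto elim: eventually_mono\<close>)
    moreover have "(\<integral>x. h (x, t) \<partial>lebesgue) = (\<integral>x. h' (x, t) \<partial>lebesgue)"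
      using c m by (intro integral_cong_AE) (auto intro: measurable_completion)
    ultimately show ?thesis using integral_completion[OF m] by simp
  qed
  have "AE t in lborel. integrable lebesgue (\<lambda>x. h (x, t)) \<and> (\<integral>x. h (x, t) \<partial>lebesgue) = (\<integral>x. h' (x, t) \<partial>lborel)"
    using ae int by eventually_elim (rule slice)
  then have s: "AE t in lborel. integrable lebesgue (\<lambda>x. h (x, t))"
    "AE t in lborel. (\<integral>x. h (x, t) \<partial>lebesgue) = (\<integral>x. h' (x, t) \<partial>lborel)"
    by (auto elim: eventually_mono)
  show "AE t in lebesgue. integrable lebesgue (\<lambda>x. h (x, t))" using s(1) by (rule AE_completion)
  have i: "integrable lborel (\<lambda>t. \<integral>x. h' (x, t) \<partial>lborel)" using lborel_pair.integrable_snd[OF h'2] .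
  then have m: "(\<lambda>t. \<integral>x. h' (x, t) \<partial>lborel) \<in> borel_measurable lborel" by simp
  note c = lebesgue_measurable_slice_cong[OF s(2) m]
  have "integrable lebesgue (\<lambda>t. \<integral>x. h' (x, t) \<partial>lborel)" using i integrable_completion[OF m] by blast
  then show "integrable lebesgue (\<lambda>t. \<integral>x. h (x, t) \<partial>lebesgue)"
    by (rule integrable_cong_AE_imp) (use c in \<open>auto elim: eventually_mono\<close>)
qed

lemma AE_lborel_ex_in_interval:
  assumes "AE s in lborel. P s" "a < (b::real)"
  obtains s where "a < s" "s < b" "P s"
proof -
  have "\<not> (\<forall>s\<in>{a<..<b}. \<not> P s)"
  proof
    assume *: "\<forall>s\<in>{a<..<b}. \<not> P s"
    from assms(1) obtain N where N: "{s \<in> space lborel. \<not> P s} \<subseteq> N" "emeasure lborel N = 0" "N \<in> sets lborel"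
      by (rule AE_E)
    have "emeasure lborel {a<..<b} \<le> emeasure lborel N"
      using * N by (intro emeasure_mono) auto
    then show False using N(2) assms(2) by simp
  qed
  then show ?thesis using that by auto
qed

section \<open>Elementary \<open>L^2\<close> theory\<close>

lemma square_integrable_mult:
  fixes f g :: "'a::euclidean_space \<Rightarrow> real"
  assumes "square_integrable f" "square_integrable g"
  shows "integrable lebesgue (\<lambda>x. f x * g x)"
proof (rule Bochner_Integration.integrable_bound)
  show "integrable lebesgue (\<lambda>x. (f x)\<^sup>2 + (g x)\<^sup>2)" using assms by (simp add: square_integrable_def)
  have "\<bar>a * b\<bar> \<le> a\<^sup>2 + b\<^sup>2" for a b :: real
  proof -
    have "2 * (\<bar>a\<bar> * \<bar>b\<bar>) \<le> a\<^sup>2 + b\<^sup>2" using sum_squares_bound[of "\<bar>a\<bar>" "\<bar>b\<bar>"] by simp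
    moreover have "0 \<le> \<bar>a\<bar> * \<bar>b\<bar>" by simp
    ultimately show ?thesis unfolding abs_mult by linarith
  qed
  then show "AE x in lebesgue. norm (f x * g x) \<le> norm ((f x)\<^sup>2 + (g x)\<^sup>2)" by auto
qed (use assms in \<open>auto simp: square_integrable_def\<close>)

lemma square_integrable_diff:
  fixes f g :: "'a::euclidean_space \<Rightarrow> real"
  assumes f: "square_integrable f" and g: "square_integrable g"
  shows "square_integrable (\<lambda>x. f x - g x)"
proof -
  have "(norm (f x - g x))\<^sup>2 = (norm (f x))\<^sup>2 + (norm (g x))\<^sup>2 - 2 * (f x * g x)" for x
    by (simp add: power2_diff)
  then show ?thesis
    using f g square_integrable_mult[OF f g] unfolding square_integrable_def
    by (auto intro: borel_measurable_diff)
qed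

lemma square_integrable_cmult:
  fixes f :: "'a::euclidean_space \<Rightarrow> real"
  shows "square_integrable f \<Longrightarrow> square_integrable (\<lambda>x. f x * c)"
  unfolding square_integrable_def by (simp add: power_mult_distrib abs_mult borel_measurable_times)

lemma L2_Cauchy_Schwarz:
  fixes f g :: "'a::euclidean_space \<Rightarrow> real"
  assumes f: "square_integrable f" and g: "square_integrable g"
  shows "\<bar>\<integral>x. f x * g x \<partial>lebesgue\<bar> \<le> L2_norm f * L2_norm g"
proof -
  define a b c where "a = (\<integral>x. (f x)\<^sup>2 \<partial>lebesgue)" and "b = (\<integral>x. (g x)\<^sup>2 \<partial>lebesgue)"
    and "c = (\<integral>x. f x * g x \<partial>lebesgue)"
  have int: "integrable lebesgue (\<lambda>x. (f x)\<^sup>2)" "integrable lebesgue (\<lambda>x. (g x)\<^sup>2)"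
    using f g by (auto simp: square_integrable_def)
  have quad: "0 \<le> l\<^sup>2 * a - 2 * l * c + b" for l :: real
  proof -
    have "0 \<le> (\<integral>x. (l * f x - g x)\<^sup>2 \<partial>lebesgue)" by simp
    also have "\<dots> = (\<integral>x. l\<^sup>2 * (f x)\<^sup>2 - 2 * l * (f x * g x) + (g x)\<^sup>2 \<partial>lebesgue)"
      by (rule Bochner_Integration.integral_cong) (auto simp: power2_eq_square algebra_simps)
    also have "\<dots> = l\<^sup>2 * a - 2 * l * c + b"
      using int square_integrable_mult[OF f g] by (simp add: a_def b_def c_def)
    finally show ?thesis .
  qed
  have ab: "0 \<le> a" "0 \<le> b" by (auto simp: a_def b_def)
  have "c\<^sup>2 \<le> a * b"
  proof (cases "a = 0")
    case True
    have "c = 0"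
    proof (rule ccontr)
      assume "c \<noteq> 0"
      then show False using quad[of "(b + 1) / (2 * c)"] True by simp
    qed
    then show ?thesis using ab by simp
  next
    case False
    then show ?thesis using quad[of "c / a"] ab by (simp add: field_simps power2_eq_square)
  qed
  then have "\<bar>c\<bar> \<le> sqrt (a * b)" by (rule real_le_rsqrt[of "\<bar>c\<bar>", simplified])
  then show ?thesis by (simp add: L2_norm_def a_def b_def c_def real_sqrt_mult)
qed

text \<open>If g vanishes on E, the integral of \<open>h\<^sup>2\<close> over E is at most the
  squared distance from g to h. This later carries support information from almost every time to
  every time, and from u to its time derivative.\<close>

lemma L2_limit_vanishes:
  fixes h :: "'a::euclidean_space \<Rightarrow> real"
  assumes h: "square_integrable h" and E: "E \<in> sets borel"
    and approx: "\<And>\<epsilon>. 0 < \<epsilon> \<Longrightarrow> \<exists>g. square_integrable g \<and> L2_norm (\<lambda>x. g x - h x) < \<epsilon> \<and>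
      (AE x in lebesgue. x \<in> E \<longrightarrow> g x = 0)"
  shows "AE x in lebesgue. x \<in> E \<longrightarrow> h x = 0"
proof -
  let ?k = "\<lambda>x. indicator E x * (h x)\<^sup>2"
  have hm: "integrable lebesgue (\<lambda>x. (h x)\<^sup>2)" using h by (simp add: square_integrable_def)
  have El: "E \<in> sets lebesgue" using E by simp
  have k: "integrable lebesgue ?k" using integrable_real_mult_indicator[OF El hm] by (simp add: mult.commute)
  have "(\<integral>x. ?k x \<partial>lebesgue) \<le> \<epsilon>\<^sup>2" if pos: "0 < \<epsilon>" for \<epsilon>
  proof -
    obtain g where g: "square_integrable g" "L2_norm (\<lambda>x. g x - h x) < \<epsilon>" "AE x in lebesgue. x \<in> E \<longrightarrow> g x = 0"
      using approx[OF pos] by blast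
    have d: "integrable lebesgue (\<lambda>x. (g x - h x)\<^sup>2)"
      using square_integrable_diff[OF g(1) h] by (simp add: square_integrable_def)
    have "(\<integral>x. ?k x \<partial>lebesgue) \<le> (\<integral>x. (g x - h x)\<^sup>2 \<partial>lebesgue)"
      using g(3) by (intro integral_mono_AE k d) (auto elim!: eventually_mono simp: indicator_def)
    also have "\<dots> = (L2_norm (\<lambda>x. g x - h x))\<^sup>2" by (simp add: L2_norm_def)
    also have "\<dots> \<le> \<epsilon>\<^sup>2" using g(2) by (intro power_mono) (auto simp: L2_norm_def)
    finally show ?thesis .
  qed
  from this[of "sqrt _"] have "(\<integral>x. ?k x \<partial>lebesgue) \<le> e" if "0 < e" for e using that by simp
  then have "(\<integral>x. ?k x \<partial>lebesgue) \<le> 0" by (meson dense_ge)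
  moreover have "0 \<le> (\<integral>x. ?k x \<partial>lebesgue)" by (intro integral_nonneg_AE) auto
  ultimately have "AE x in lebesgue. ?k x = 0"
    using integral_nonneg_eq_0_iff_AE[OF k] by auto
  then show ?thesis by (auto elim!: eventually_mono simp: indicator_def)
qed

lemma Cc_infty_square_integrable:
  assumes "Cc_infty (\<phi> :: 'a::euclidean_space \<Rightarrow> real)"
  shows "square_integrable \<phi>"
proof -
  have c: "continuous_on UNIV \<phi>" using assms by (simp add: Cc_infty_def smooth_imp_continuous_on)
  then have m: "\<phi> \<in> borel_measurable borel" by (rule borel_measurable_continuous_onI)
  have K: "compact (supp \<phi>)" using assms by (simp add: Cc_infty_def)
  have "set_integrable lborel (supp \<phi>) (\<lambda>x. (\<phi> x)\<^sup>2)"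
    unfolding set_integrable_def
    by (rule borel_integrable_compact[OF K]) (intro continuous_intros continuous_on_subset[OF c], simp)
  moreover have "\<phi> x = 0" if "x \<notin> supp \<phi>" for x
    using that closure_subset[of "support_on UNIV \<phi>"] by (auto simp: supp_def support_on_def)
  then have "(\<lambda>x. indicator (supp \<phi>) x *\<^sub>R (\<phi> x)\<^sup>2) = (\<lambda>x. (\<phi> x)\<^sup>2)" by (auto simp: indicator_def fun_eq_iff)
  ultimately have "integrable lborel (\<lambda>x. (\<phi> x)\<^sup>2)" by (simp add: set_integrable_def)
  then show ?thesis
    using m by (auto simp: square_integrable_def intro: integrable_completion[THEN iffD2] measurable_completion)
qed

section \<open>Weak solutions tested with plane waves\<close>

lemma supp_eq_0: "x \<notin> supp f \<Longrightarrow> f x = 0"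
  using closure_subset[of "support_on UNIV f"] by (auto simp: supp_def support_on_def)

lemma frechet_derivative_locally_0:
  assumes "open S" "x \<in> S" "\<And>y. y \<in> S \<Longrightarrow> f y = 0"
  shows "frechet_derivative f (at x) v = 0"
proof -
  have "(f has_derivative (\<lambda>_. 0)) (at x)"
    by (rule has_derivative_transform_within_open[OF has_derivative_const[of 0] assms(1,2)]) (use assms(3) in simp)
  from frechet_derivative_at[OF this] show ?thesis by (metis)
qed

lemma Cc_infty_frechet_derivative:
  assumes "Cc_infty f" shows "Cc_infty (\<lambda>x. frechet_derivative f (at x) v)"
proof (rule Cc_inftyI)
  show "smooth (\<lambda>x. frechet_derivative f (at x) v)"
    using assms by (intro smooth_frechet_derivative) (simp add: Cc_infty_def)
  show c: "compact (supp f)" using assms by (simp add: Cc_infty_def)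
  show "frechet_derivative f (at x) v = 0" if "x \<notin> supp f" for x
    by (rule frechet_derivative_locally_0[of "- supp f"]) (use that c in \<open>auto simp: supp_eq_0 compact_imp_closed open_Compl\<close>)
qed

definition laplacian :: "(real^'n \<Rightarrow> real) \<Rightarrow> real^'n \<Rightarrow> real" where
  "laplacian w x = (\<Sum>i\<in>UNIV. grad (\<lambda>y. grad w y $ i) x $ i)"

lemma Cc_infty_grad: "Cc_infty w \<Longrightarrow> Cc_infty (\<lambda>y. grad w y $ i)"
  unfolding grad_def by (simp add: Cc_infty_frechet_derivative)

lemma square_integrable_component:
  fixes G :: "'a::euclidean_space \<Rightarrow> real^'n"
  assumes "square_integrable G" shows "square_integrable (\<lambda>x. G x $ i)"
proof -
  have [measurable]: "G \<in> borel_measurable lebesgue" using assms by (simp add: square_integrable_def)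
  have eq: "(\<lambda>x. G x $ i) = (\<lambda>x. G x \<bullet> axis i 1)" by (simp add: inner_axis)
  have m: "(\<lambda>x. G x $ i) \<in> borel_measurable lebesgue" unfolding eq by measurable
  have "integrable lebesgue (\<lambda>x. (norm (G x $ i))\<^sup>2)"
  proof (rule Bochner_Integration.integrable_bound)
    show "integrable lebesgue (\<lambda>x. (norm (G x))\<^sup>2)" using assms by (simp add: square_integrable_def)
    have "(norm (G x $ i))\<^sup>2 \<le> (norm (G x))\<^sup>2" for x
      by (rule power_mono) (use component_le_norm_cart[of "G x" i] in auto)
    then show "AE x in lebesgue. norm ((norm (G x $ i))\<^sup>2) \<le> norm ((norm (G x))\<^sup>2)" by auto
    show "(\<lambda>x. (norm (G x $ i))\<^sup>2) \<in> borel_measurable lebesgue" using m by measurable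
  qed
  then show ?thesis using m by (simp add: square_integrable_def)
qed

text \<open>The defining identity of the weak gradient is used with the test functions \<partial>_i
  w, which again have compact support. Moving both derivatives to w matters because plane waves are
  eigenfunctions of the Laplacian.\<close>

lemma weak_grad_pairing:
  assumes h: "H1 h" and w: "Cc_infty w"
  shows "(\<integral>x. weak_grad h x \<bullet> grad w x \<partial>lebesgue) = - (\<integral>x. h x * laplacian w x \<partial>lebesgue)"
proof -
  let ?G = "weak_grad h"
  have G: "square_integrable ?G" "is_weak_gradient h ?G"
    using someI_ex[of "\<lambda>G. square_integrable G \<and> is_weak_gradient h G"] h by (auto simp: H1_def weak_grad_def)
  have hs: "square_integrable h" using h by (simp add: H1_def)
  have i1: "integrable lebesgue (\<lambda>x. ?G x $ i * grad w x $ i)" for i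
    by (intro square_integrable_mult square_integrable_component G Cc_infty_square_integrable Cc_infty_grad w)
  have i2: "integrable lebesgue (\<lambda>x. h x * grad (\<lambda>y. grad w y $ i) x $ i)" for i
    by (intro square_integrable_mult hs Cc_infty_square_integrable Cc_infty_grad w)
  have "(\<integral>x. ?G x \<bullet> grad w x \<partial>lebesgue) = (\<integral>x. (\<Sum>i\<in>UNIV. ?G x $ i * grad w x $ i) \<partial>lebesgue)"
    by (simp add: inner_vec_def)
  also have "\<dots> = (\<Sum>i\<in>UNIV. \<integral>x. ?G x $ i * grad w x $ i \<partial>lebesgue)"
    using i1 by (intro Bochner_Integration.integral_sum)
  also have "\<dots> = (\<Sum>i\<in>UNIV. - (\<integral>x. h x * grad (\<lambda>y. grad w y $ i) x $ i \<partial>lebesgue))"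
  proof (rule sum.cong[OF refl])
    fix i
    show "(\<integral>x. ?G x $ i * grad w x $ i \<partial>lebesgue) = - (\<integral>x. h x * grad (\<lambda>y. grad w y $ i) x $ i \<partial>lebesgue)"
      using G(2)[unfolded is_weak_gradient_def, rule_format, OF Cc_infty_grad[OF w, of i], of i] by simp
  qed
  also have "\<dots> = - (\<integral>x. (\<Sum>i\<in>UNIV. h x * grad (\<lambda>y. grad w y $ i) x $ i) \<partial>lebesgue)"
    using i2 by (simp add: Bochner_Integration.integral_sum sum_negf)
  also have "\<dots> = - (\<integral>x. h x * laplacian w x \<partial>lebesgue)"
    by (simp add: laplacian_def sum_distrib_left)
  finally show ?thesis .
qed

lemma frechet_derivative_exp_locally:
  fixes a :: "'a::euclidean_space"
  assumes "open S" "x \<in> S" "\<And>y. y \<in> S \<Longrightarrow> f y = c * exp (a \<bullet> y)"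
  shows "frechet_derivative f (at x) v = c * (a \<bullet> v) * exp (a \<bullet> x)"
proof -
  have "((\<lambda>y. c * exp (a \<bullet> y)) has_derivative (\<lambda>v. c * (a \<bullet> v) * exp (a \<bullet> x))) (at x)"
    by (auto intro!: derivative_eq_intros)
  then have "(f has_derivative (\<lambda>v. c * (a \<bullet> v) * exp (a \<bullet> x))) (at x)"
    by (rule has_derivative_transform_within_open[OF _ assms(1,2)]) (use assms(3) in simp)
  from frechet_derivative_at[OF this] show ?thesis by metis
qed

lemma laplacian_plane_wave:
  fixes a :: "real^'n"
  assumes w: "\<And>y. norm y < M \<Longrightarrow> w y = exp (a \<bullet> y)" and x: "norm x < M"
  shows "laplacian w x = (a \<bullet> a) * exp (a \<bullet> x)"
proof -
  have 1: "grad w y $ i = a $ i * exp (a \<bullet> y)" if "y \<in> ball 0 M" for y i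
    unfolding grad_def using frechet_derivative_exp_locally[of "ball 0 M" y w 1 a "axis i 1"] that w
    by (simp add: inner_axis)
  have "grad (\<lambda>y. grad w y $ i) x $ i = a $ i * a $ i * exp (a \<bullet> x)" for i
    using frechet_derivative_exp_locally[of "ball 0 M" x "\<lambda>y. grad w y $ i" "a $ i" a "axis i 1"] x 1
    by (simp add: grad_def[of "\<lambda>y. grad w y $ i"] inner_axis)
  then show ?thesis by (simp add: laplacian_def inner_vec_def sum_distrib_right)
qed

lemma smooth_exp_inner: "smooth (\<lambda>x::'a::euclidean_space. exp (a \<bullet> x))"
proof (rule smoothI)
  fix k
  show "Ck k (\<lambda>x. exp (a \<bullet> x))"
    by (rule Ck_compose_real[where g="\<lambda>_. exp" and f="\<lambda>x. a \<bullet> x"])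
      (auto intro: DERIV_exp Ck_bounded_linear bounded_linear_inner_right)
qed

lemma plane_wave_cutoff:
  fixes a :: "'a::euclidean_space" assumes "0 \<le> M"
  obtains w where "Cc_infty w" "\<And>y. norm y < M \<Longrightarrow> w y = exp (a \<bullet> y)" "\<And>y. 0 \<le> w y"
proof -
  obtain \<zeta> :: "'a \<Rightarrow> real" where \<zeta>: "Cc_infty \<zeta>" "\<And>x. norm x < M \<Longrightarrow> \<zeta> x = 1" "\<And>x. 0 \<le> \<zeta> x"
    using smooth_cutoff[OF assms] by metis
  show ?thesis
  proof (rule that[of "\<lambda>x. \<zeta> x * exp (a \<bullet> x)"])
    show "Cc_infty (\<lambda>x. \<zeta> x * exp (a \<bullet> x))"
      using \<zeta>(1) by (intro Cc_inftyI[of _ "supp \<zeta>"] smooth_mult smooth_exp_inner) (auto simp: Cc_infty_def supp_eq_0)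
  qed (use \<zeta> in auto)
qed

text \<open>A step and a reflected step are multiplied. \<theta> equals 1 on an interval that
  contains [0, t] in its interior, so its time derivative vanishes at the end points 0 and t as
  well, and its support stays below T.\<close>

lemma time_cutoff:
  assumes "0 \<le> t" "ereal t < T"
  obtains \<theta> :: "real \<Rightarrow> real" and b where "smooth \<theta>" "ereal b < T" "\<And>s. s \<notin> {-2..b} \<Longrightarrow> \<theta> s = 0"
    "t < b" "\<And>s. s \<in> {-1..(t + b) / 2} \<Longrightarrow> \<theta> s = 1"
proof -
  obtain b where b: "t < b" "ereal b < T" using ereal_dense2[OF assms(2)] by auto
  obtain \<eta>1 :: "real \<Rightarrow> real" where \<eta>1: "smooth \<eta>1" "\<And>s. s \<le> (t + b) / 2 \<Longrightarrow> \<eta>1 s = 1" "\<And>s. b \<le> s \<Longrightarrow> \<eta>1 s = 0"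
  proof -
    have "(t + b) / 2 < b" using b by simp
    from smooth_step[OF this] show ?thesis using that by metis
  qed
  obtain \<eta>2 :: "real \<Rightarrow> real" where \<eta>2: "smooth \<eta>2" "\<And>s. s \<le> 1 \<Longrightarrow> \<eta>2 s = 1" "\<And>s. 2 \<le> s \<Longrightarrow> \<eta>2 s = 0"
    using smooth_step[of 1 2] by (metis one_less_numeral_iff semiring_norm(76))
  have "smooth (\<lambda>s. \<eta>2 (- s))"
    by (rule smooth_compose_linear[OF _ \<eta>2(1)]) (rule bounded_linear_minus[OF bounded_linear_ident])
  then have "smooth (\<lambda>s. \<eta>1 s * \<eta>2 (- s))" using \<eta>1(1) by (rule smooth_mult[rotated])
  then show ?thesis
    by (rule that[OF _ b(2) _ b(1)]) (use \<eta>1 \<eta>2 in \<open>auto simp: not_le\<close>)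
qed

text \<open>One solution together with its time derivative v. The initial data and \<epsilon> are
  not parameters, so a constant chosen outside serves all solutions alike.\<close>

locale tricomi_solution =
  fixes m p q R :: real and T :: ereal and u v :: "(real^'n) \<times> real \<Rightarrow> real"
  assumes m: "0 \<le> m" and R: "0 < R" and p: "1 < p" and q: "1 < q"
    and H1: "C0_H1 (time_interval T) u"
    and C1: "C1_L2 (time_interval T) u v"
    and weak: "\<And>\<Phi> t. test_function T \<Phi> \<Longrightarrow> t \<in> time_interval T \<Longrightarrow>
        set_integrable lebesgue (UNIV \<times> {0..t})
          (\<lambda>z. (\<bar>v z\<bar> powr p + \<bar>u z\<bar> powr q) * \<Phi> z) \<and>
        (\<integral>x. v (x,t) * \<Phi> (x,t) \<partial>lebesgue)
        - (\<integral>x. v (x,0) * \<Phi> (x,0) \<partial>lebesgue)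
        - (LINT s:{0..t}|lebesgue. \<integral>x. v (x,s) * deriv (\<lambda>\<tau>. \<Phi> (x,\<tau>)) s \<partial>lebesgue)
        + (LINT s:{0..t}|lebesgue. s powr (2 * m) *
             (\<integral>x. weak_grad (\<lambda>y. u (y,s)) x \<bullet> grad (\<lambda>y. \<Phi> (y,s)) x \<partial>lebesgue))
        = (LINT s:{0..t}|lebesgue.
             \<integral>x. (\<bar>v (x,s)\<bar> powr p + \<bar>u (x,s)\<bar> powr q) * \<Phi> (x,s) \<partial>lebesgue)"
    and cone: "ess_supp (UNIV \<times> time_interval T) u \<subseteq> {(x,t). 0 \<le> t \<and> norm x \<le> \<xi> m t + R}"
begin

abbreviation "I \<equiv> time_interval T"

lemma time_interval_mono: "0 \<le> s \<Longrightarrow> s \<le> t \<Longrightarrow> t \<in> I \<Longrightarrow> s \<in> I"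
  using le_less_trans[of "ereal s" "ereal t" T] by (auto simp: time_interval_def)

text \<open>The test functions are \<open>w x * \<theta> t\<close> with \<open>\<theta> = 1\<close> on the time interval under consideration.  A solution
  \<open>\<rho> t * \<phi> x\<close> of the linear equation is not an admissible test function, because \<open>t\<^sup>2\<^sup>m\<close> and hence
  \<open>\<rho>\<close> need not be smooth at \<open>t = 0\<close>; the time dependence is treated by ordinary differential
  inequalities instead.\<close>

lemma weak_identity:
  assumes w: "Cc_infty w" and t: "t \<in> I"
  shows "set_integrable lebesgue (UNIV \<times> {0..t}) (\<lambda>z. (\<bar>v z\<bar> powr p + \<bar>u z\<bar> powr q) * w (fst z))"
    and "(\<integral>x. v (x,t) * w x \<partial>lebesgue) - (\<integral>x. v (x,0) * w x \<partial>lebesgue)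
        - (LINT s:{0..t}|lebesgue. s powr (2 * m) * (\<integral>x. u (x,s) * laplacian w x \<partial>lebesgue))
        = (LINT s:{0..t}|lebesgue. \<integral>x. (\<bar>v (x,s)\<bar> powr p + \<bar>u (x,s)\<bar> powr q) * w x \<partial>lebesgue)"
proof -
  have t': "0 \<le> t" "ereal t < T" using t by (auto simp: time_interval_def)
  obtain \<theta> b where \<theta>: "smooth \<theta>" "ereal b < T" "\<And>s. s \<notin> {-2..b} \<Longrightarrow> \<theta> s = 0"
    "t < b" "\<And>s. s \<in> {-1..(t + b) / 2} \<Longrightarrow> \<theta> s = 1"
    using time_cutoff[OF t'] by metis
  define \<Phi> where "\<Phi> z = w (fst z) * \<theta> (snd z)" for z
  have one: "\<theta> s = 1" if "s \<in> {0..t}" for s using that \<theta>(4) t' by (intro \<theta>) auto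
  have \<Phi>: "\<Phi> (x, s) = w x" if "s \<in> {0..t}" for x s using one[OF that] by (simp add: \<Phi>_def)
  have "test_function T \<Phi>" unfolding test_function_def
  proof
    show "Cc_infty \<Phi>"
    proof (rule Cc_inftyI)
      show "smooth \<Phi>" unfolding \<Phi>_def using w
        by (intro smooth_mult smooth_compose_linear[OF bounded_linear_fst, of w]
            smooth_compose_linear[OF bounded_linear_snd \<theta>(1)]) (simp add: Cc_infty_def)
      show "compact (supp w \<times> {-2..b})" using w by (intro compact_Times) (auto simp: Cc_infty_def)
      show "\<Phi> z = 0" if "z \<notin> supp w \<times> {-2..b}" for z
        using that \<theta>(3)[of "snd z"] supp_eq_0[of "fst z" w] by (cases z) (auto simp: \<Phi>_def)
    qed
    have "supp \<Phi> \<subseteq> UNIV \<times> {..b}"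
    proof (intro supp_subset closed_Times)
      fix z :: "(real^'n) \<times> real" assume "z \<notin> UNIV \<times> {..b}"
      then have "\<theta> (snd z) = 0" by (intro \<theta>(3)) (auto simp: mem_Times_iff)
      then show "\<Phi> z = 0" by (simp add: \<Phi>_def)
    qed auto
    then show "supp \<Phi> \<subseteq> {(x, t). ereal t < T}"
      using \<theta>(2) le_less_trans[of "ereal _" "ereal b" T] by auto
  qed
  note W = weak[OF this t]
  have "(\<lambda>z. indicator (UNIV \<times> {0..t}) z *\<^sub>R ((\<bar>v z\<bar> powr p + \<bar>u z\<bar> powr q) * \<Phi> z) :: real)
      = (\<lambda>z. indicator (UNIV \<times> {0..t}) z *\<^sub>R ((\<bar>v z\<bar> powr p + \<bar>u z\<bar> powr q) * w (fst z)))"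
  proof
    show "indicator (UNIV \<times> {0..t}) z *\<^sub>R ((\<bar>v z\<bar> powr p + \<bar>u z\<bar> powr q) * \<Phi> z) =
        (indicator (UNIV \<times> {0..t}) z *\<^sub>R ((\<bar>v z\<bar> powr p + \<bar>u z\<bar> powr q) * w (fst z)) :: real)" for z
      using \<Phi>[of "snd z" "fst z"] by (auto simp: indicator_def)
  qed
  then show "set_integrable lebesgue (UNIV \<times> {0..t}) (\<lambda>z. (\<bar>v z\<bar> powr p + \<bar>u z\<bar> powr q) * w (fst z))"
    using W unfolding set_integrable_def by metis
  have d: "deriv (\<lambda>\<tau>. \<Phi> (x, \<tau>)) s = 0" if "s \<in> {0..t}" for x s
  proof -
    have "((\<lambda>\<tau>. w x) has_real_derivative 0) (at s)" by simp
    then have "((\<lambda>\<tau>. \<Phi> (x, \<tau>)) has_real_derivative 0) (at s)"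
      by (rule has_field_derivative_transform_within_open[where S="{-1<..<(t + b) / 2}"])
        (use that \<theta>(4,5) in \<open>auto simp: \<Phi>_def\<close>)
    then show ?thesis by (rule DERIV_imp_deriv)
  qed
  have "(LINT s:{0..t}|lebesgue. \<integral>x. v (x,s) * deriv (\<lambda>\<tau>. \<Phi> (x,\<tau>)) s \<partial>lebesgue) = (LINT s:{0..t}|lebesgue. 0)"
    by (rule set_lebesgue_integral_cong) (auto simp: d)
  moreover have "(LINT s:{0..t}|lebesgue. s powr (2 * m) *
             (\<integral>x. weak_grad (\<lambda>y. u (y,s)) x \<bullet> grad (\<lambda>y. \<Phi> (y,s)) x \<partial>lebesgue))
       = (LINT s:{0..t}|lebesgue. - (s powr (2 * m) * (\<integral>x. u (x,s) * laplacian w x \<partial>lebesgue)))"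
  proof (rule set_lebesgue_integral_cong, simp, intro allI impI)
    fix s assume s: "s \<in> {0..t}"
    then have "s \<in> I" using time_interval_mono t by auto
    then have "H1 (\<lambda>y. u (y, s))" using H1 by (simp add: C0_H1_def)
    moreover have "(\<lambda>y. \<Phi> (y, s)) = w" using \<Phi>[OF s] by auto
    ultimately show "s powr (2 * m) * (\<integral>x. weak_grad (\<lambda>y. u (y,s)) x \<bullet> grad (\<lambda>y. \<Phi> (y,s)) x \<partial>lebesgue)
      = - (s powr (2 * m) * (\<integral>x. u (x,s) * laplacian w x \<partial>lebesgue))"
      using weak_grad_pairing[OF _ w] by simp
  qed
  moreover have "(LINT s:{0..t}|lebesgue. \<integral>x. (\<bar>v (x,s)\<bar> powr p + \<bar>u (x,s)\<bar> powr q) * \<Phi> (x,s) \<partial>lebesgue)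
    = (LINT s:{0..t}|lebesgue. \<integral>x. (\<bar>v (x,s)\<bar> powr p + \<bar>u (x,s)\<bar> powr q) * w x \<partial>lebesgue)"
    by (rule set_lebesgue_integral_cong) (auto simp: \<Phi>)
  moreover have "(LINT s:{0..t}|lebesgue. - g s) = - (LINT s:{0..t}|lebesgue. g s)" for g :: "real \<Rightarrow> real"
    by (simp add: set_lebesgue_integral_def)
  ultimately show "(\<integral>x. v (x,t) * w x \<partial>lebesgue) - (\<integral>x. v (x,0) * w x \<partial>lebesgue)
        - (LINT s:{0..t}|lebesgue. s powr (2 * m) * (\<integral>x. u (x,s) * laplacian w x \<partial>lebesgue))
        = (LINT s:{0..t}|lebesgue. \<integral>x. (\<bar>v (x,s)\<bar> powr p + \<bar>u (x,s)\<bar> powr q) * w x \<partial>lebesgue)"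
    using W t' \<Phi>[of t] \<Phi>[of 0] by simp
qed

lemma u_square_integrable: "t \<in> I \<Longrightarrow> square_integrable (\<lambda>x. u (x, t))"
  and v_square_integrable: "t \<in> I \<Longrightarrow> square_integrable (\<lambda>x. v (x, t))"
  using C1 by (auto simp: C1_L2_def C0_L2_def)

text \<open>Cauchy-Schwarz against w turns convergence of the difference quotients in
  \<open>L^2\<close> into convergence of real difference quotients.\<close>

lemma pairing_has_derivative:
  assumes w: "Cc_infty w" and t: "t \<in> I"
  shows "((\<lambda>s. \<integral>x. u (x, s) * w x \<partial>lebesgue) has_real_derivative (\<integral>x. v (x, t) * w x \<partial>lebesgue)) (at t within I)"
proof -
  let ?U = "\<lambda>s. \<integral>x. u (x, s) * w x \<partial>lebesgue" and ?V = "\<integral>x. v (x, t) * w x \<partial>lebesgue"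
  let ?g = "\<lambda>s x. (u (x, s) - u (x, t)) / (s - t) - v (x, t)"
  have w2: "square_integrable w" using w by (rule Cc_infty_square_integrable)
  have lim: "((\<lambda>s. L2_norm (?g s)) \<longlongrightarrow> 0) (at t within I)"
    using C1 t by (simp add: C1_L2_def has_L2_time_derivative_def)
  have bound: "norm ((?U s - ?U t) / (s - t) - ?V) \<le> norm (L2_norm (?g s)) * L2_norm w" if s: "s \<in> I" "s \<noteq> t" for s
  proof -
    have "square_integrable (\<lambda>x. (u (x, s) - u (x, t)) * (1 / (s - t)) - v (x, t))"
      by (intro square_integrable_diff square_integrable_cmult u_square_integrable v_square_integrable s t)
    then have g: "square_integrable (?g s)" by simp
    have i: "integrable lebesgue (\<lambda>x. u (x, r) * w x)" if "r \<in> I" for r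
      by (intro square_integrable_mult u_square_integrable w2 that)
    have "(\<integral>x. ?g s x * w x \<partial>lebesgue) = (\<integral>x. (u (x, s) * w x - u (x, t) * w x) / (s - t) - v (x, t) * w x \<partial>lebesgue)"
      by (simp add: diff_divide_distrib left_diff_distrib)
    also have "\<dots> = (?U s - ?U t) / (s - t) - ?V"
      using i s t square_integrable_mult[OF v_square_integrable[OF t] w2] by simp
    finally have "norm ((?U s - ?U t) / (s - t) - ?V) = \<bar>\<integral>x. ?g s x * w x \<partial>lebesgue\<bar>" by simp
    also have "\<dots> \<le> L2_norm (?g s) * L2_norm w" by (rule L2_Cauchy_Schwarz[OF g w2])
    also have "\<dots> = norm (L2_norm (?g s)) * L2_norm w" by (simp add: L2_norm_def)
    finally show ?thesis .
  qed
  have "((\<lambda>s. (?U s - ?U t) / (s - t) - ?V) \<longlongrightarrow> 0) (at t within I)"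
    by (rule tendsto_0_le[OF lim, where K="L2_norm w"]) (use bound in \<open>auto simp: eventually_at_filter\<close>)
  then show ?thesis unfolding has_field_derivative_iff by (rule Lim_null[THEN iffD2])
qed

end

lemma lebesgue_cong_AE:
  fixes f g :: "'a::euclidean_space \<Rightarrow> real"
  assumes f: "f \<in> borel_measurable lebesgue" and ae: "AE x in lebesgue. f x = g x"
  shows "g \<in> borel_measurable lebesgue" "(\<integral>x. f x \<partial>lebesgue) = (\<integral>x. g x \<partial>lebesgue)"
    "integrable lebesgue f \<longleftrightarrow> integrable lebesgue g"
proof -
  show g: "g \<in> borel_measurable lebesgue" using borel_measurable_AE[OF f ae] .
  show "(\<integral>x. f x \<partial>lebesgue) = (\<integral>x. g x \<partial>lebesgue)" by (rule integral_cong_AE[OF f g ae])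
  show "integrable lebesgue f \<longleftrightarrow> integrable lebesgue g" by (rule integrable_cong_AE[OF f g ae])
qed

lemma xi_mono: "0 \<le> m \<Longrightarrow> 0 \<le> s \<Longrightarrow> s \<le> t \<Longrightarrow> \<xi> m s \<le> \<xi> m t"
  unfolding \<xi>_def by (intro divide_right_mono powr_mono2) auto

lemma xi_nonneg: "0 \<le> m \<Longrightarrow> 0 \<le> \<xi> m t"
  by (simp add: \<xi>_def)

lemma xi_tendsto:
  assumes "0 \<le> m" "S \<subseteq> {0..}"
  shows "(\<xi> m \<longlongrightarrow> \<xi> m t) (at t within S)"
  unfolding \<xi>_def using assms
  by (intro tendsto_divide tendsto_powr' tendsto_ident_at tendsto_const)
    (auto simp: eventually_at_filter intro!: always_eventually)

lemma exp_inner_measurable: "(\<lambda>x::'a::euclidean_space. exp (a \<bullet> x)) \<in> borel_measurable lebesgue"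
  by (intro measurable_completion) simp

section \<open>Support of the time slices\<close>

context tricomi_solution
begin

text \<open>The complement of the essential support is a union of possibly uncountably many open
  sets, on each of which u vanishes almost everywhere. Lindelof reduces it to a countable union, and
  Fubini then gives the statement for almost every time.\<close>

lemma u_vanishes_AE_time:
  "AE s in lborel. s \<in> I \<longrightarrow> (AE x in lborel. \<xi> m s + R < norm x \<longrightarrow> u (x, s) = 0)"
proof -
  define F where "F = {U. open U \<and> (AE w in lebesgue. w \<in> U \<inter> (UNIV \<times> I) \<longrightarrow> u w = 0)}"
  obtain F' where F': "F' \<subseteq> F" "countable F'" "\<Union>F' = \<Union>F"
    using Lindelof[of F] by (auto simp: F_def)
  have ae: "AE w in lebesgue. \<forall>U\<in>F'. w \<in> U \<inter> (UNIV \<times> I) \<longrightarrow> u w = 0"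
    using F' by (subst AE_ball_countable) (auto simp: F_def)
  have mem: "w \<in> \<Union>F'" if w: "w \<in> UNIV \<times> I" "\<not> norm (fst w) \<le> \<xi> m (snd w) + R" for w
  proof -
    have "w \<notin> ess_supp (UNIV \<times> I) u" using cone w by auto
    then obtain X where "open X \<and> w \<in> X \<and> (AE z in lebesgue. z \<in> X \<inter> (UNIV \<times> I) \<longrightarrow> u z = 0)"
      using w(1) by (auto simp: ess_supp_def)
    then have "X \<in> F" "w \<in> X" by (auto simp: F_def)
    then show ?thesis unfolding F'(3) by (rule UnionI)
  qed
  from ae have "AE w in lebesgue. w \<in> UNIV \<times> I \<longrightarrow> \<not> norm (fst w) \<le> \<xi> m (snd w) + R \<longrightarrow> u w = 0"
    by (rule eventually_mono) (use mem in blast)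
  from AE_slices[OF this] show ?thesis
    by (rule eventually_mono) (auto elim!: eventually_mono)
qed

lemma right_neighbourhood:
  assumes t: "t \<in> I" and ev: "eventually P (at t within I)"
  obtains b where "t < b" "b \<in> I" "\<And>s. t < s \<Longrightarrow> s \<le> b \<Longrightarrow> s \<in> I \<and> P s"
proof -
  obtain c where c: "t < c" "ereal c < T" using ereal_dense2[of t T] t by (auto simp: time_interval_def)
  obtain d where d: "0 < d" "\<And>s. s \<in> I \<Longrightarrow> s \<noteq> t \<Longrightarrow> dist s t < d \<Longrightarrow> P s"
    using ev by (auto simp: eventually_at)
  have cI: "c \<in> I" using c t by (auto simp: time_interval_def)
  show ?thesis
  proof (rule that[of "min c (t + d / 2)"])
    show "t < min c (t + d / 2)" using c d by auto
    have sI: "s \<in> I" if "t < s" "s \<le> c" for s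
      using time_interval_mono[of s c] cI t that by (auto simp: time_interval_def)
    show "min c (t + d / 2) \<in> I" using c d by (intro sI) auto
    show "s \<in> I \<and> P s" if "t < s" "s \<le> min c (t + d / 2)" for s
      using that d sI by (auto simp: dist_real_def)
  qed
qed

text \<open>Slices at nearby later times are supported in slightly larger balls, hence the margin
  \<eta>; it is removed along the countable sequence 1/(n + 1).\<close>

lemma AE_beyond_cone:
  assumes "\<And>\<eta>. 0 < \<eta> \<Longrightarrow> AE x in lebesgue. x \<in> {x. c + \<eta> < norm x} \<longrightarrow> P x"
  shows "AE x in lebesgue. c < norm (x :: 'a::euclidean_space) \<longrightarrow> P x"
proof -
  have "AE x in lebesgue. \<forall>n. x \<in> {x. c + inverse (real (Suc n)) < norm x} \<longrightarrow> P x"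
    using assms by (subst AE_all_countable) auto
  then show ?thesis
  proof (rule eventually_mono, intro impI)
    fix x assume *: "\<forall>n. x \<in> {x. c + inverse (real (Suc n)) < norm x} \<longrightarrow> P x" "c < norm x"
    then obtain n where "inverse (real (Suc n)) < norm x - c" using reals_Archimedean[of "norm x - c"] by auto
    then show "P x" using *(1)[rule_format, of n] by simp
  qed
qed

text \<open>In every interval to the right of t there is a time s at which the slice is already
  known to vanish outside its ball, and continuity in \<open>L^2\<close> transfers this to t.
  Approaching from the right also covers t = 0, and the half-open interval always leaves room
  there.\<close>

lemma u_vanishes:
  assumes t: "t \<in> I"
  shows "AE x in lebesgue. \<xi> m t + R < norm x \<longrightarrow> u (x, t) = 0"
proof (rule AE_beyond_cone)
  fix \<eta> :: real assume \<eta>: "0 < \<eta>"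
  show "AE x in lebesgue. x \<in> {x. \<xi> m t + R + \<eta> < norm x} \<longrightarrow> u (x, t) = 0"
  proof (rule L2_limit_vanishes[OF u_square_integrable[OF t]])
    show "{x::real^'n. \<xi> m t + R + \<eta> < norm x} \<in> sets borel" by measurable
    fix \<epsilon> :: real assume "0 < \<epsilon>"
    then have "eventually (\<lambda>s. L2_norm (\<lambda>x. u (x,s) - u (x,t)) < \<epsilon>) (at t within I)"
      using C1 t by (intro order_tendstoD(2)[where y=0]) (auto simp: C1_L2_def C0_L2_def)
    moreover have "eventually (\<lambda>s. \<xi> m s < \<xi> m t + \<eta>) (at t within I)"
      by (rule order_tendstoD(2)[OF xi_tendsto[OF m]]) (use \<eta> in \<open>auto simp: time_interval_def\<close>)
    ultimately have "eventually (\<lambda>s. L2_norm (\<lambda>x. u (x,s) - u (x,t)) < \<epsilon> \<and> \<xi> m s < \<xi> m t + \<eta>) (at t within I)"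
      by eventually_elim simp
    then obtain b where b: "t < b" "\<And>s. t < s \<Longrightarrow> s \<le> b \<Longrightarrow> s \<in> I \<and> L2_norm (\<lambda>x. u (x,s) - u (x,t)) < \<epsilon> \<and> \<xi> m s < \<xi> m t + \<eta>"
      by (rule right_neighbourhood[OF t]) blast
    obtain s where s: "t < s" "s < b" "s \<in> I \<longrightarrow> (AE x in lborel. \<xi> m s + R < norm x \<longrightarrow> u (x, s) = 0)"
      by (rule AE_lborel_ex_in_interval[OF u_vanishes_AE_time b(1)])
    have "AE x in lborel. x \<in> {x. \<xi> m t + R + \<eta> < norm x} \<longrightarrow> u (x, s) = 0"
      using s b(2)[of s] by (auto elim!: eventually_mono)
    then show "\<exists>g. square_integrable g \<and> L2_norm (\<lambda>x. g x - u (x, t)) < \<epsilon> \<and>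
        (AE x in lebesgue. x \<in> {x. \<xi> m t + R + \<eta> < norm x} \<longrightarrow> g x = 0)"
      using s b(2)[of s] u_square_integrable[of s] by (intro exI[of _ "\<lambda>x. u (x, s)"]) (auto intro: AE_completion)
  qed
qed

text \<open>The slice of v is the \<open>L^2\<close> limit of difference quotients of u, each of
  which vanishes outside the larger of two balls.\<close>

lemma v_vanishes:
  assumes t: "t \<in> I"
  shows "AE x in lebesgue. \<xi> m t + R < norm x \<longrightarrow> v (x, t) = 0"
proof (rule AE_beyond_cone)
  fix \<eta> :: real assume \<eta>: "0 < \<eta>"
  show "AE x in lebesgue. x \<in> {x. \<xi> m t + R + \<eta> < norm x} \<longrightarrow> v (x, t) = 0"
  proof (rule L2_limit_vanishes[OF v_square_integrable[OF t]])
    show "{x::real^'n. \<xi> m t + R + \<eta> < norm x} \<in> sets borel" by measurable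
    fix \<epsilon> :: real assume "0 < \<epsilon>"
    then have "eventually (\<lambda>s. L2_norm (\<lambda>x. (u (x,s) - u (x,t)) / (s - t) - v (x,t)) < \<epsilon>) (at t within I)"
      using C1 t by (intro order_tendstoD(2)[where y=0]) (auto simp: C1_L2_def has_L2_time_derivative_def)
    moreover have "eventually (\<lambda>s. \<xi> m s < \<xi> m t + \<eta>) (at t within I)"
      by (rule order_tendstoD(2)[OF xi_tendsto[OF m]]) (use \<eta> in \<open>auto simp: time_interval_def\<close>)
    ultimately have "eventually (\<lambda>s. L2_norm (\<lambda>x. (u (x,s) - u (x,t)) / (s - t) - v (x,t)) < \<epsilon> \<and> \<xi> m s < \<xi> m t + \<eta>) (at t within I)"
      by eventually_elim simp
    then obtain b where b: "t < b" "\<And>s. t < s \<Longrightarrow> s \<le> b \<Longrightarrow> s \<in> I \<and>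
        L2_norm (\<lambda>x. (u (x,s) - u (x,t)) / (s - t) - v (x,t)) < \<epsilon> \<and> \<xi> m s < \<xi> m t + \<eta>"
      by (rule right_neighbourhood[OF t]) blast
    have bI: "b \<in> I" and lt: "\<xi> m b < \<xi> m t + \<eta>" using b by auto
    have "AE x in lebesgue. x \<in> {x. \<xi> m t + R + \<eta> < norm x} \<longrightarrow> (u (x, b) - u (x, t)) * (1 / (b - t)) = 0"
      using u_vanishes[OF t] u_vanishes[OF bI] by eventually_elim (use lt \<eta> in auto)
    moreover have "square_integrable (\<lambda>x. (u (x, b) - u (x, t)) * (1 / (b - t)))"
      by (intro square_integrable_cmult square_integrable_diff u_square_integrable bI t)
    ultimately show "\<exists>g. square_integrable g \<and> L2_norm (\<lambda>x. g x - v (x, t)) < \<epsilon> \<and>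
        (AE x in lebesgue. x \<in> {x. \<xi> m t + R + \<eta> < norm x} \<longrightarrow> g x = 0)"
      using b by (intro exI[of _ "\<lambda>x. (u (x, b) - u (x, t)) * (1 / (b - t))"]) auto
  qed
qed

section \<open>Exponential moments of the solution\<close>

definition U :: "real^'n \<Rightarrow> real \<Rightarrow> real" where
  "U a t = (\<integral>x. u (x, t) * exp (a \<bullet> x) \<partial>lebesgue)"

definition V :: "real^'n \<Rightarrow> real \<Rightarrow> real" where
  "V a t = (\<integral>x. v (x, t) * exp (a \<bullet> x) \<partial>lebesgue)"

lemma u_measurable: "t \<in> I \<Longrightarrow> (\<lambda>x. u (x, t)) \<in> borel_measurable lebesgue"
  and v_measurable: "t \<in> I \<Longrightarrow> (\<lambda>x. v (x, t)) \<in> borel_measurable lebesgue"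
  using u_square_integrable v_square_integrable by (auto simp: square_integrable_def)

text \<open>The factor c lets the same statement serve the truncated plane wave, with c = 1, and its
  Laplacian, with c equal to the inner product of a with itself.\<close>

lemma pairing_cutoff:
  assumes t: "t \<in> I" and M: "\<xi> m t + R < M" and w: "\<And>y. norm y < M \<Longrightarrow> w y = c * exp (a \<bullet> y)"
  shows "(\<integral>x. u (x, t) * w x \<partial>lebesgue) = c * U a t" "(\<integral>x. v (x, t) * w x \<partial>lebesgue) = c * V a t"
proof -
  have *: "(\<integral>x. h x * w x \<partial>lebesgue) = c * (\<integral>x. h x * exp (a \<bullet> x) \<partial>lebesgue)"
    if h: "h \<in> borel_measurable lebesgue" "AE x in lebesgue. \<xi> m t + R < norm x \<longrightarrow> h x = 0" for h :: "real^'n \<Rightarrow> real"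
  proof -
    have "AE x in lebesgue. c * (h x * exp (a \<bullet> x)) = h x * w x"
      using h(2) by eventually_elim (use M w in \<open>force\<close>)
    moreover have "(\<lambda>x. c * (h x * exp (a \<bullet> x))) \<in> borel_measurable lebesgue"
      using h(1) exp_inner_measurable by (intro borel_measurable_times borel_measurable_const)
    ultimately have "(\<integral>x. c * (h x * exp (a \<bullet> x)) \<partial>lebesgue) = (\<integral>x. h x * w x \<partial>lebesgue)"
      by (rule lebesgue_cong_AE(2)[rotated])
    then show ?thesis by simp
  qed
  show "(\<integral>x. u (x, t) * w x \<partial>lebesgue) = c * U a t" "(\<integral>x. v (x, t) * w x \<partial>lebesgue) = c * V a t"
    unfolding U_def V_def using t by (intro *; simp add: u_measurable v_measurable u_vanishes v_vanishes)+
qed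

lemma U_has_derivative:
  assumes b: "b \<in> I" and t: "t \<in> {0..b}"
  shows "(U a has_real_derivative V a t) (at t within {0..b})"
proof -
  define M where "M = \<xi> m b + R + 1"
  have M0: "0 \<le> M" using xi_nonneg[OF m, of b] R by (simp add: M_def)
  obtain w where w: "Cc_infty w" "\<And>y. norm y < M \<Longrightarrow> w y = exp (a \<bullet> y)"
    by (rule plane_wave_cutoff[OF M0, of a], rule that)
  have sI: "s \<in> I" if "s \<in> {0..b}" for s using time_interval_mono b that by auto
  have lt: "\<xi> m s + R < M" if "s \<in> {0..b}" for s using xi_mono[OF m, of s b] that by (simp add: M_def)
  note pc = pairing_cutoff[OF sI lt, where w=w and c=1 and a=a, simplified, OF _ _ w(2)]
  have "((\<lambda>s. \<integral>x. u (x, s) * w x \<partial>lebesgue) has_real_derivative (\<integral>x. v (x, t) * w x \<partial>lebesgue)) (at t within {0..b})"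
    by (rule DERIV_subset[OF pairing_has_derivative[OF w(1) sI[OF t]]]) (use sI in auto)
  then have "((\<lambda>s. \<integral>x. u (x, s) * w x \<partial>lebesgue) has_real_derivative V a t) (at t within {0..b})"
    using pc(2)[of t] t by simp
  then show ?thesis
    by (rule has_field_derivative_transform_within[OF _ zero_less_one t]) (use pc(1) in auto)
qed

lemma U_weighted_integrable:
  assumes b: "b \<in> I"
  shows "set_integrable lebesgue {0..b} (\<lambda>r. r powr (2 * m) * U a r)"
proof -
  have b0: "0 \<le> b" using b by (simp add: time_interval_def)
  have "continuous_on {0..b} (U a)" using U_has_derivative[OF b] by (rule DERIV_continuous_on)
  then have "set_integrable lborel {0..b} (U a)"
    unfolding set_integrable_def by (intro borel_integrable_compact) auto
  then have i: "set_integrable lebesgue {0..b} (U a)"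
    unfolding set_integrable_def by (subst integrable_completion) auto
  then have m1: "(\<lambda>r. indicator {0..b} r *\<^sub>R U a r) \<in> borel_measurable lebesgue" by (auto simp: set_integrable_def)
  have m2: "(\<lambda>r::real. r powr (2 * m)) \<in> borel_measurable lebesgue" by (intro measurable_completion) simp
  show ?thesis
  proof (rule set_integrable_bound)
    show "set_integrable lebesgue {0..b} (\<lambda>r. b powr (2 * m) * U a r)" using i by simp
    have "(\<lambda>r. r powr (2 * m) * (indicator {0..b} r *\<^sub>R U a r)) \<in> borel_measurable lebesgue"
      by (intro borel_measurable_times m1 m2)
    then show "set_borel_measurable lebesgue {0..b} (\<lambda>r. r powr (2 * m) * U a r)"
      by (simp add: set_borel_measurable_def mult_ac)
    show "AE r in lebesgue. r \<in> {0..b} \<longrightarrow> norm (r powr (2 * m) * U a r) \<le> norm (b powr (2 * m) * U a r)"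
      using m by (auto simp: abs_mult intro!: AE_I2 mult_right_mono powr_mono2)
  qed
qed

text \<open>The weak identities at times s and t are subtracted, with one truncation w valid for all
  times up to b. The nonlinear term keeps w because its integrability is given against test
  functions only.\<close>

lemma V_identity:
  assumes b: "b \<in> I" and w: "Cc_infty w" "\<And>y. norm y < \<xi> m b + R + 1 \<Longrightarrow> w y = exp (a \<bullet> y)"
    and st: "0 \<le> s" "s \<le> t" "t \<le> b"
  defines "N r \<equiv> (\<integral>x. (\<bar>v (x,r)\<bar> powr p + \<bar>u (x,r)\<bar> powr q) * w x \<partial>lebesgue)"
  shows "AE r in lebesgue. r \<in> {0..b} \<longrightarrow> integrable lebesgue (\<lambda>x. (\<bar>v (x,r)\<bar> powr p + \<bar>u (x,r)\<bar> powr q) * w x)"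
    and "set_integrable lebesgue {s..t} N"
    and "V a t - V a s = (a \<bullet> a) * integral {s..t} (\<lambda>r. r powr (2 * m) * U a r) + (LINT r:{s..t}|lebesgue. N r)"
proof -
  let ?F = "\<lambda>z. (\<bar>v z\<bar> powr p + \<bar>u z\<bar> powr q) * w (fst z)"
  have sI: "r \<in> I" if "r \<in> {0..b}" for r using time_interval_mono b that by auto
  have lt: "\<xi> m r + R < \<xi> m b + R + 1" if "r \<in> {0..b}" for r using xi_mono[OF m, of r b] that by simp
  note pc = pairing_cutoff[OF sI lt, where w=w and c=1 and a=a, simplified, OF _ _ w(2)]
  have pcl: "(\<integral>x. u (x, r) * laplacian w x \<partial>lebesgue) = (a \<bullet> a) * U a r" if "r \<in> {0..b}" for r
    by (rule pairing_cutoff(1)[OF sI lt]) (use that laplacian_plane_wave[OF w(2)] in auto)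
  have "set_integrable lebesgue (UNIV \<times> {0..b}) ?F" by (rule weak_identity(1)[OF w(1) b])
  then have int: "integrable lebesgue (\<lambda>z. indicator (UNIV \<times> {0..b}) z *\<^sub>R ?F z)" by (simp add: set_integrable_def)
  have ind: "indicator (UNIV \<times> {0..b}) (x, r) = (indicator {0..b} r :: real)" for x :: "real^'n" and r
    by (auto simp: indicator_def)
  show "AE r in lebesgue. r \<in> {0..b} \<longrightarrow> integrable lebesgue (\<lambda>x. (\<bar>v (x,r)\<bar> powr p + \<bar>u (x,r)\<bar> powr q) * w x)"
    using integrable_slices(1)[OF int] by (rule eventually_mono) (auto simp: ind)
  have Nb: "set_integrable lebesgue {0..b} N"
    using integrable_slices(2)[OF int] by (simp add: ind set_integrable_def N_def)
  show Nst: "set_integrable lebesgue {s..t} N"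
    by (rule set_integrable_subset[OF Nb]) (use st in auto)
  have id: "V a r - V a 0 = (a \<bullet> a) * integral {0..r} (\<lambda>r. r powr (2 * m) * U a r) + integral {0..r} N"
    if r: "r \<in> {0..b}" for r
  proof -
    have "(LINT s:{0..r}|lebesgue. s powr (2 * m) * (\<integral>x. u (x,s) * laplacian w x \<partial>lebesgue))
      = (LINT s:{0..r}|lebesgue. (a \<bullet> a) * (s powr (2 * m) * U a s))"
      by (rule set_lebesgue_integral_cong) (use r in \<open>auto simp: pcl\<close>)
    also have "\<dots> = (a \<bullet> a) * (LINT s:{0..r}|lebesgue. s powr (2 * m) * U a s)" by simp
    also have "(LINT s:{0..r}|lebesgue. s powr (2 * m) * U a s) = integral {0..r} (\<lambda>r. r powr (2 * m) * U a r)"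
      by (rule set_lebesgue_integral_eq_integral(2)[OF U_weighted_integrable[OF sI[OF r]]])
    finally have "(LINT s:{0..r}|lebesgue. s powr (2 * m) * (\<integral>x. u (x,s) * laplacian w x \<partial>lebesgue))
      = (a \<bullet> a) * integral {0..r} (\<lambda>r. r powr (2 * m) * U a r)" .
    moreover have "(LINT s:{0..r}|lebesgue. N s) = integral {0..r} N"
      by (rule set_lebesgue_integral_eq_integral(2)[OF set_integrable_subset[OF Nb]]) (use r in auto)
    ultimately show ?thesis
      using weak_identity(2)[OF w(1) sI[OF r]] pc(2)[of r] pc(2)[of 0] r by (simp add: N_def)
  qed
  have c1: "integral {0..s} (\<lambda>r. r powr (2 * m) * U a r) + integral {s..t} (\<lambda>r. r powr (2 * m) * U a r)
      = integral {0..t} (\<lambda>r. r powr (2 * m) * U a r)"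
    by (rule Henstock_Kurzweil_Integration.integral_combine[OF st(1,2)
          set_lebesgue_integral_eq_integral(1)[OF U_weighted_integrable[OF sI]]]) (use st in auto)
  have c2: "integral {0..s} N + integral {s..t} N = integral {0..t} N"
    by (rule Henstock_Kurzweil_Integration.integral_combine[OF st(1,2)
          set_lebesgue_integral_eq_integral(1)[OF set_integrable_subset[OF Nb]]]) (use st in auto)
  have "(LINT r:{s..t}|lebesgue. N r) = integral {s..t} N"
    by (rule set_lebesgue_integral_eq_integral(2)[OF Nst])
  show "V a t - V a s = (a \<bullet> a) * integral {s..t} (\<lambda>r. r powr (2 * m) * U a r) + (LINT r:{s..t}|lebesgue. N r)"
  proof -
    have "(a \<bullet> a) * integral {0..s} (\<lambda>r. r powr (2 * m) * U a r) + (a \<bullet> a) * integral {s..t} (\<lambda>r. r powr (2 * m) * U a r)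
      = (a \<bullet> a) * integral {0..t} (\<lambda>r. r powr (2 * m) * U a r)"
      unfolding c1[symmetric] by (rule distrib_left[symmetric])
    then show ?thesis using id[of t] id[of s] st c2 \<open>(LINT r:{s..t}|lebesgue. N r) = integral {s..t} N\<close> by simp
  qed
qed

lemma V_increment_unit:
  assumes b: "b \<in> I" and st: "0 \<le> s" "s \<le> t" "t \<le> b" and a: "norm a = 1"
  shows "V a s + integral {s..t} (\<lambda>r. r powr (2 * m) * U a r) \<le> V a t"
proof -
  have M0: "0 \<le> \<xi> m b + R + 1" using xi_nonneg[OF m, of b] R by simp
  obtain w where w: "Cc_infty w" "\<And>y. norm y < \<xi> m b + R + 1 \<Longrightarrow> w y = exp (a \<bullet> y)" "\<And>y. 0 \<le> w y"
    by (rule plane_wave_cutoff[OF M0, of a], rule that)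
  have "0 \<le> (LINT r:{s..t}|lebesgue. \<integral>x. (\<bar>v (x,r)\<bar> powr p + \<bar>u (x,r)\<bar> powr q) * w x \<partial>lebesgue)"
    unfolding set_lebesgue_integral_def using w(3)
    by (intro integral_nonneg_AE AE_I2 scaleR_nonneg_nonneg) (auto intro!: integral_nonneg_AE)
  moreover have "a \<bullet> a = 1" using a by (simp add: norm_eq_1)
  ultimately show ?thesis using V_identity(3)[OF b w(1,2) st] by simp
qed

text \<open>For a = 0 the factor of U vanishes, and w = 1 wherever the solution lives. The lower
  bound is asked only at times where both powers are integrable, which is almost every time; for a
  non-integrable power the integral has the default value 0, and no positive bound could be proved
  for it.\<close>

lemma V_increment_zero:
  assumes b: "b \<in> I" and st: "0 \<le> s" "s \<le> t" "t \<le> b"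
    and lower: "\<And>r. r \<in> {s..t} \<Longrightarrow> integrable lebesgue (\<lambda>x. \<bar>v (x, r)\<bar> powr p) \<Longrightarrow>
      integrable lebesgue (\<lambda>x. \<bar>u (x, r)\<bar> powr q) \<Longrightarrow>
      \<kappa> \<le> (\<integral>x. \<bar>v (x, r)\<bar> powr p \<partial>lebesgue) + (\<integral>x. \<bar>u (x, r)\<bar> powr q \<partial>lebesgue)"
  shows "V 0 s + \<kappa> * (t - s) \<le> V 0 t"
proof -
  have M0: "0 \<le> \<xi> m b + R + 1" using xi_nonneg[OF m, of b] R by simp
  obtain w :: "real^'n \<Rightarrow> real" where w: "Cc_infty w" "\<And>y. norm y < \<xi> m b + R + 1 \<Longrightarrow> w y = exp (0 \<bullet> y)" "\<And>y. 0 \<le> w y"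
    by (rule plane_wave_cutoff[OF M0, of 0], rule that)
  define N where "N r = (\<integral>x. (\<bar>v (x,r)\<bar> powr p + \<bar>u (x,r)\<bar> powr q) * w x \<partial>lebesgue)" for r
  note W = V_identity[OF b w(1,2) st, folded N_def]
  have N_ge: "\<kappa> \<le> N r" if r: "r \<in> {s..t}"
    and int: "integrable lebesgue (\<lambda>x. (\<bar>v (x,r)\<bar> powr p + \<bar>u (x,r)\<bar> powr q) * w x)" for r
  proof -
    have rI: "r \<in> I" using time_interval_mono[of r b] b r st by auto
    have le: "\<xi> m r \<le> \<xi> m b" using r st by (intro xi_mono m) auto
    have ae: "AE x in lebesgue. (\<bar>v (x,r)\<bar> powr p + \<bar>u (x,r)\<bar> powr q) * w x = \<bar>v (x,r)\<bar> powr p + \<bar>u (x,r)\<bar> powr q"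
      using u_vanishes[OF rI] v_vanishes[OF rI] by eventually_elim (use w(2) le in force)
    have m: "(\<lambda>x. \<bar>v (x,r)\<bar> powr p) \<in> borel_measurable lebesgue" "(\<lambda>x. \<bar>u (x,r)\<bar> powr q) \<in> borel_measurable lebesgue"
      using u_measurable[OF rI] v_measurable[OF rI] by measurable
    have sum: "integrable lebesgue (\<lambda>x. \<bar>v (x,r)\<bar> powr p + \<bar>u (x,r)\<bar> powr q)"
      "N r = (\<integral>x. \<bar>v (x,r)\<bar> powr p + \<bar>u (x,r)\<bar> powr q \<partial>lebesgue)"
      using lebesgue_cong_AE(2,3)[OF borel_measurable_integrable[OF int] ae] int by (simp_all add: N_def)
    have i: "integrable lebesgue (\<lambda>x. \<bar>v (x,r)\<bar> powr p)" "integrable lebesgue (\<lambda>x. \<bar>u (x,r)\<bar> powr q)"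
      by (rule Bochner_Integration.integrable_bound[OF sum(1)]; use m in simp)+
    then show ?thesis using lower[OF r i] sum(2) by simp
  qed
  have "\<kappa> * (t - s) = (LINT r:{s..t}|lebesgue. \<kappa>)" using st by (simp add: set_integral_const)
  also have "\<dots> \<le> (LINT r:{s..t}|lebesgue. N r)"
  proof (rule set_integral_mono_AE[OF _ W(2)])
    show "set_integrable lebesgue {s..t} (\<lambda>r. \<kappa>)" using st by (simp add: set_integrable_def)
    show "AE r\<in>{s..t} in lebesgue. \<kappa> \<le> N r"
      using W(1) by (rule eventually_mono) (use N_ge st in auto)
  qed
  finally show ?thesis using W(3) by simp
qed

end

section \<open>The lifespan estimate\<close>

text \<open>The exponents \<tau> and n (1 - p / 2) have no fixed sign, so the power may increase or
  decrease; the minimum over both ends covers either case.\<close>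

lemma powr_between:
  fixes y :: real
  assumes "0 < lo" "lo \<le> y" "y \<le> hi"
  shows "min (lo powr e) (hi powr e) \<le> y powr e"
proof (cases "0 \<le> e")
  case True
  then have "lo powr e \<le> y powr e" using assms by (intro powr_mono2) auto
  then show ?thesis by simp
next
  case False
  then have "hi powr e \<le> y powr e" using assms by (intro powr_mono2') auto
  then show ?thesis by simp
qed

lemma cone_radius_bounds:
  assumes "0 \<le> m" "0 < R" "1 \<le> t"
  shows "\<xi> m t + R \<le> (1 / (m + 1) + R) * t powr (m + 1)"
    and "1 / (m + 1) * t powr (m + 1) \<le> 1 + (\<xi> m t + R)"
    and "1 + (\<xi> m t + R) \<le> (1 + 1 / (m + 1) + R) * t powr (m + 1)"
proof -
  have "1 \<le> t powr (m + 1)" using assms by (intro ge_one_powr_ge_zero) auto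
  then have "R * 1 \<le> R * t powr (m + 1)" using assms by (intro mult_left_mono) auto
  then show "\<xi> m t + R \<le> (1 / (m + 1) + R) * t powr (m + 1)" by (simp add: \<xi>_def algebra_simps)
  then show "1 + (\<xi> m t + R) \<le> (1 + 1 / (m + 1) + R) * t powr (m + 1)"
    using \<open>1 \<le> t powr (m + 1)\<close> by (simp add: algebra_simps)
  show "1 / (m + 1) * t powr (m + 1) \<le> 1 + (\<xi> m t + R)" using assms by (simp add: \<xi>_def)
qed

text \<open>The exponentials cancel: the power 1 - p of the dual integral contributes exp(- p (\<xi>
  + R)), which leaves only exp(- p R). The remaining powers agree because n (1 - s / 2) (1 - p) = n
  (1 - p / 2) for s = p / (p - 1), and 1 + \<xi> + R is comparable to \<open>t powr (m + 1)\<close>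
  for t \<ge> 1.\<close>

lemma Hoelder_constant:
  fixes m R p \<omega> \<gamma> C n :: real
  assumes m: "0 \<le> m" and R: "0 < R" and p: "1 < p" and pos: "0 < \<omega>" "0 < \<gamma>" "0 < C"
  obtains c where "0 < c" "\<And>\<epsilon> t. 0 < \<epsilon> \<Longrightarrow> 1 \<le> t \<Longrightarrow>
    c * \<epsilon> powr p * t powr (m * p / 2 + (m + 1) * n * (1 - p / 2))
      \<le> (\<omega> * (\<gamma> * \<epsilon> * t powr (m / 2) * exp (\<xi> m t))) powr p *
        (C * exp (p / (p - 1) * (\<xi> m t + R)) * (1 + (\<xi> m t + R)) powr (n * (1 - p / (p - 1) / 2))) powr (1 - p)"
proof -
  define e where "e = n * (1 - p / 2)"
  define k where "k = min ((1 / (m + 1)) powr e) ((1 + 1 / (m + 1) + R) powr e)"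
  define c where "c = (\<omega> * \<gamma>) powr p * C powr (1 - p) * exp (- (p * R)) * k"
  have "0 < 1 / (m + 1)" "0 < 1 + 1 / (m + 1) + R" using m R by (simp_all add: add_pos_pos)
  then have k: "0 < k" unfolding k_def min_less_iff_conj powr_gt_zero by linarith
  have "c * \<epsilon> powr p * t powr (m * p / 2 + (m + 1) * n * (1 - p / 2))
      \<le> (\<omega> * (\<gamma> * \<epsilon> * t powr (m / 2) * exp (\<xi> m t))) powr p *
        (C * exp (p / (p - 1) * (\<xi> m t + R)) * (1 + (\<xi> m t + R)) powr (n * (1 - p / (p - 1) / 2))) powr (1 - p)"
    if \<epsilon>: "0 < \<epsilon>" and t: "1 \<le> t" for \<epsilon> t
  proof -
    define \<rho> where "\<rho> = 1 + (\<xi> m t + R)"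
    note \<rho>b = cone_radius_bounds(2,3)[OF m R t, folded \<rho>_def]
    have tp: "0 < t powr (m + 1)" using t by simp
    have \<rho>: "0 < \<rho>" using xi_nonneg[OF m, of t] R by (simp add: \<rho>_def)
    have "k \<le> (\<rho> / t powr (m + 1)) powr e"
      unfolding k_def by (rule powr_between) (use \<rho>b tp m in \<open>auto simp: field_simps\<close>)
    then have "k * t powr ((m + 1) * e) \<le> (\<rho> / t powr (m + 1)) powr e * t powr ((m + 1) * e)"
      by (intro mult_right_mono) auto
    also have "\<dots> = \<rho> powr e" using \<rho> t by (simp add: powr_divide powr_powr)
    finally have ke: "k * t powr ((m + 1) * e) \<le> \<rho> powr e" .
    have "(\<omega> * (\<gamma> * \<epsilon> * t powr (m / 2) * exp (\<xi> m t))) powr p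
      = (\<omega> * \<gamma>) powr p * \<epsilon> powr p * t powr (m * p / 2) * exp (p * \<xi> m t)"
      using pos \<epsilon> t by (simp add: powr_mult powr_powr exp_powr_real mult_ac)
    moreover have "(C * exp (p / (p - 1) * (\<xi> m t + R)) * \<rho> powr (n * (1 - p / (p - 1) / 2))) powr (1 - p)
      = C powr (1 - p) * (exp (- (p * R)) * exp (- (p * \<xi> m t))) * \<rho> powr e"
    proof -
      have "p / (p - 1) * (1 - p) = - p" using p by (simp add: field_simps)
      then have "p / (p - 1) * (\<xi> m t + R) * (1 - p) = - (p * R) + - (p * \<xi> m t)"
        by (metis (no_types, opaque_lifting) add.commute distrib_left minus_add_distrib mult.assoc mult.commute mult_minus_left)
      moreover have "n * (1 - p / (p - 1) / 2) * (1 - p) = e" using p by (simp add: e_def field_simps)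
      ultimately show ?thesis
        using pos \<rho> by (simp only: powr_mult powr_powr exp_powr_real exp_add)
    qed
    ultimately have "(\<omega> * (\<gamma> * \<epsilon> * t powr (m / 2) * exp (\<xi> m t))) powr p *
        (C * exp (p / (p - 1) * (\<xi> m t + R)) * \<rho> powr (n * (1 - p / (p - 1) / 2))) powr (1 - p)
      = (\<omega> * \<gamma>) powr p * C powr (1 - p) * exp (- (p * R)) * \<epsilon> powr p * t powr (m * p / 2) * \<rho> powr e
        * (exp (p * \<xi> m t) * exp (- (p * \<xi> m t)))" by (simp only: mult_ac)
    also have "exp (p * \<xi> m t) * exp (- (p * \<xi> m t)) = 1" by (simp add: exp_minus)
    finally have rhs: "(\<omega> * (\<gamma> * \<epsilon> * t powr (m / 2) * exp (\<xi> m t))) powr p *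
        (C * exp (p / (p - 1) * (\<xi> m t + R)) * \<rho> powr (n * (1 - p / (p - 1) / 2))) powr (1 - p)
      = (\<omega> * \<gamma>) powr p * C powr (1 - p) * exp (- (p * R)) * \<epsilon> powr p * t powr (m * p / 2) * \<rho> powr e" by simp
    have "c * \<epsilon> powr p * t powr (m * p / 2 + (m + 1) * n * (1 - p / 2))
      = (\<omega> * \<gamma>) powr p * C powr (1 - p) * exp (- (p * R)) * \<epsilon> powr p * t powr (m * p / 2) * (k * t powr ((m + 1) * e))"
      by (simp add: c_def e_def powr_add mult_ac)
    also have "\<dots> \<le> (\<omega> * \<gamma>) powr p * C powr (1 - p) * exp (- (p * R)) * \<epsilon> powr p * t powr (m * p / 2) * \<rho> powr e"
      by (intro mult_left_mono ke) auto
    finally show ?thesis using rhs by (simp add: \<rho>_def)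
  qed
  moreover have "0 < c" using k pos by (simp add: c_def)
  ultimately show ?thesis using that by blast
qed

lemma indicator_cball_integrable:
  fixes \<rho> :: real
  defines "k \<equiv> indicator (cball (0 :: 'a::euclidean_space) \<rho>) :: 'a \<Rightarrow> real"
  shows "integrable lebesgue k" "square_integrable k"
proof -
  show i: "integrable lebesgue k"
    unfolding k_def using emeasure_lborel_cball_finite[of "0::'a" \<rho>] by (intro integrable_real_indicator) auto
  moreover have "(\<lambda>x. (norm (k x))\<^sup>2) = k" by (auto simp: k_def indicator_def fun_eq_iff)
  ultimately show "square_integrable k" by (auto simp: square_integrable_def)
qed

section \<open>Lower bounds for the two nonlinear terms\<close>

context tricomi_solution
begin

text \<open>The averaging of plane waves needs integrability with respect to \<open>lborel\<close>
  and vanishing at every point outside the ball; the slice of v offers both only up to a null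
  set.\<close>

lemma v_borel:
  assumes t: "t \<in> I"
  obtains h where "integrable lborel h" "\<And>x. x \<notin> cball 0 (\<xi> m t + R) \<Longrightarrow> h x = 0"
    "AE x in lebesgue. v (x, t) = h x"
proof -
  let ?B = "cball (0::real^'n) (\<xi> m t + R)"
  note sq = indicator_cball_integrable(2)[where 'a="real^'n" and \<rho>="\<xi> m t + R"]
  have "integrable lebesgue (\<lambda>x. v (x, t) * indicator ?B x)"
    by (rule square_integrable_mult[OF v_square_integrable[OF t] sq])
  then obtain h where h: "integrable lborel h" "AE x in lborel. v (x, t) * indicator ?B x = h x"
    by (rule integrable_lebesgue_imp_borel)
  show ?thesis
  proof (rule that[of "\<lambda>x. h x * indicator ?B x"])
    show "integrable lborel (\<lambda>x. h x * indicator ?B x)"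
      using h(1) by (intro integrable_real_mult_indicator) auto
    have "AE x in lebesgue. v (x, t) * indicator ?B x = h x" using h(2) by (rule AE_completion)
    then show "AE x in lebesgue. v (x, t) = h x * indicator ?B x"
      using v_vanishes[OF t] by eventually_elim (auto simp: indicator_def split: if_splits)
  qed simp
qed

text \<open>Since L does not depend on the direction, averaging keeps it up to the volume of the
  unit ball, while the weight in Hoelder's inequality becomes the smaller
  \<open>wave_average\<close>, restricted to the ball that carries v.\<close>

lemma v_power_lower_bound:
  assumes t: "t \<in> I" and L: "0 \<le> L" "\<And>a. norm a = 1 \<Longrightarrow> L \<le> V a t"
    and int: "integrable lebesgue (\<lambda>x. \<bar>v (x, t)\<bar> powr p)"
    and h_int: "integrable lborel (\<lambda>x::real^'n. (indicator (cball 0 (\<xi> m t + R)) x * wave_average x) powr (p / (p - 1)))"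
    and B: "0 < B" "(\<integral>x. (indicator (cball (0::real^'n) (\<xi> m t + R)) x * wave_average x) powr (p / (p - 1)) \<partial>lborel) \<le> B"
  shows "(measure lborel (ball (0::real^'n) 1) * L) powr p * B powr (1 - p) \<le> (\<integral>x. \<bar>v (x, t)\<bar> powr p \<partial>lebesgue)"
proof -
  let ?\<rho> = "\<xi> m t + R"
  obtain h where h: "integrable lborel h" "\<And>x. x \<notin> cball 0 ?\<rho> \<Longrightarrow> h x = 0" "AE x in lebesgue. v (x, t) = h x"
    by (rule v_borel[OF t], rule that)
  have hm: "h \<in> borel_measurable borel" using h(1) by simp
  have "V a t = (\<integral>x. h x * exp (a \<bullet> x) \<partial>lborel)" for a
  proof -
    have "V a t = (\<integral>x. h x * exp (a \<bullet> x) \<partial>lebesgue)"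
      unfolding V_def
    proof (rule lebesgue_cong_AE(2))
      show "(\<lambda>x. v (x, t) * exp (a \<bullet> x)) \<in> borel_measurable lebesgue"
        using v_measurable[OF t] exp_inner_measurable by (intro borel_measurable_times)
      show "AE x in lebesgue. v (x, t) * exp (a \<bullet> x) = h x * exp (a \<bullet> x)"
        using h(3) by eventually_elim simp
    qed
    also have "\<dots> = (\<integral>x. h x * exp (a \<bullet> x) \<partial>lborel)" using hm by (intro integral_completion) simp
    finally show ?thesis .
  qed
  then have L': "L \<le> (\<integral>x. h x * exp (a \<bullet> x) \<partial>lborel)" if "norm a = 1" for a using L(2)[OF that] by simp
  note avg = plane_waves_average[OF h(1,2) L']
  have eq: "\<bar>h x\<bar> * (indicator (cball 0 ?\<rho>) x * wave_average x) = \<bar>h x * wave_average x\<bar>" for x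
    using h(2)[of x] wave_average_nonneg[of x] by (cases "x \<in> cball 0 ?\<rho>") (auto simp: abs_mult)
  have ae: "AE x in lebesgue. \<bar>v (x, t)\<bar> powr p = \<bar>h x\<bar> powr p" using h(3) by eventually_elim simp
  have vm: "(\<lambda>x. \<bar>v (x, t)\<bar> powr p) \<in> borel_measurable lebesgue" using int by simp
  have hpm: "(\<lambda>x. \<bar>h x\<bar> powr p) \<in> borel_measurable lborel" using hm by simp
  have hp: "integrable lborel (\<lambda>x. \<bar>h x\<bar> powr p)"
    using lebesgue_cong_AE(3)[OF vm ae] int integrable_completion[OF hpm] by simp
  have "(measure lborel (ball (0::real^'n) 1) * L) powr p * B powr (1 - p) \<le> (\<integral>x. \<bar>h x\<bar> powr p \<partial>lborel)"
  proof (rule Hoelder_lower_bound[OF p _ _ B])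
    show "0 \<le> measure lborel (ball (0::real^'n) 1) * L" using L by simp
    have "measure lborel (ball (0::real^'n) 1) * L \<le> (\<integral>x. h x * wave_average x \<partial>lborel)" by (rule avg(1))
    also have "\<dots> \<le> (\<integral>x. \<bar>h x * wave_average x\<bar> \<partial>lborel)" using avg(2) by (intro integral_mono) auto
    finally show "measure lborel (ball (0::real^'n) 1) * L
        \<le> (\<integral>x. \<bar>h x\<bar> * (indicator (cball 0 ?\<rho>) x * wave_average x) \<partial>lborel)" by (simp add: eq)
    show "integrable lborel (\<lambda>x. \<bar>h x\<bar> * (indicator (cball 0 ?\<rho>) x * wave_average x))" using avg(2) by (simp add: eq)
    show "0 \<le> indicator (cball 0 ?\<rho>) x * wave_average x" for x :: "real^'n"
      by (intro mult_nonneg_nonneg wave_average_nonneg) auto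
  qed (use hp h_int in auto)
  also have "(\<integral>x. \<bar>h x\<bar> powr p \<partial>lborel) = (\<integral>x. \<bar>v (x, t)\<bar> powr p \<partial>lebesgue)"
    using lebesgue_cong_AE(2)[OF vm ae] integral_completion[OF hpm] by simp
  finally show ?thesis .
qed

lemma u_power_lower_bound:
  assumes t: "t \<in> I" and F: "0 \<le> F" "F \<le> U 0 t"
    and int: "integrable lebesgue (\<lambda>x. \<bar>u (x, t)\<bar> powr q)"
    and W: "0 < W" "measure lborel (cball (0::real^'n) (\<xi> m t + R)) \<le> W"
  shows "F powr q * W powr (1 - q) \<le> (\<integral>x. \<bar>u (x, t)\<bar> powr q \<partial>lebesgue)"
proof (rule Hoelder_lower_bound[OF q F(1) _ W(1)])
  let ?B = "cball (0::real^'n) (\<xi> m t + R)"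
  note Bi = indicator_cball_integrable(1)[where 'a="real^'n" and \<rho>="\<xi> m t + R"]
  note sq = indicator_cball_integrable(2)[where 'a="real^'n" and \<rho>="\<xi> m t + R"]
  have pw: "(indicator ?B x :: real) powr (q / (q - 1)) = indicator ?B x" for x by (simp add: indicator_def)
  have uB: "integrable lebesgue (\<lambda>x. u (x, t) * indicator ?B x)"
    by (rule square_integrable_mult[OF u_square_integrable[OF t] sq])
  have abs: "\<bar>u (x, t)\<bar> * indicator ?B x = \<bar>u (x, t) * indicator ?B x\<bar>" for x by (simp add: abs_mult)
  show "integrable lebesgue (\<lambda>x. \<bar>u (x, t)\<bar> * indicator ?B x)" unfolding abs using uB by simp
  have "U 0 t = (\<integral>x. u (x, t) * indicator ?B x \<partial>lebesgue)"
    unfolding U_def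
  proof (rule lebesgue_cong_AE(2))
    show "(\<lambda>x. u (x, t) * exp (0 \<bullet> x)) \<in> borel_measurable lebesgue" using u_measurable[OF t] by simp
    show "AE x in lebesgue. u (x, t) * exp (0 \<bullet> x) = u (x, t) * indicator ?B x"
      using u_vanishes[OF t] by eventually_elim (auto simp: indicator_def)
  qed
  also have "\<dots> \<le> (\<integral>x. \<bar>u (x, t) * indicator ?B x\<bar> \<partial>lebesgue)" using uB by (intro integral_mono) auto
  finally show "F \<le> (\<integral>x. \<bar>u (x, t)\<bar> * indicator ?B x \<partial>lebesgue)" using F by (simp add: abs)
  show "integrable lebesgue (\<lambda>x. (indicator ?B x :: real) powr (q / (q - 1)))" unfolding pw by (rule Bi)
  show "(\<integral>x. (indicator ?B x :: real) powr (q / (q - 1)) \<partial>lebesgue) \<le> W" unfolding pw using W(2) by simp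
qed (use int in auto)

lemma U_zero_mono:
  assumes b: "b \<in> I" and init: "0 \<le> U 0 0" "0 \<le> V 0 0" and st: "0 \<le> s" "s \<le> t" "t \<le> b"
  shows "0 \<le> V 0 t" "U 0 s \<le> U 0 t"
proof -
  have V: "0 \<le> V 0 r" if "r \<in> {0..b}" for r
  proof -
    have "V 0 0 + 0 * (r - 0) \<le> V 0 r"
      by (rule V_increment_zero[OF b]) (use that in \<open>auto intro!: add_nonneg_nonneg integral_nonneg_AE\<close>)
    then show ?thesis using init by simp
  qed
  then show "0 \<le> V 0 t" using st by auto
  show "U 0 s \<le> U 0 t"
    by (rule nonneg_derivative_within_imp_le[OF U_has_derivative[OF b]]) (use st V in auto)
qed

text \<open>The power \<open>|u\<^sub>t|\<^sup>p\<close> makes \<open>\<integral>u\<close> large at time \<open>b / 2\<close>; from then on the power \<open>|u|\<^sup>q\<close> would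
  make it blow up before time \<open>b\<close> unless \<open>b\<close> satisfies the stated inequality.\<close>

lemma lifespan_inequality:
  assumes b: "b \<in> I" "4 * onset m \<le> b" and init: "0 \<le> U 0 0" "0 \<le> V 0 0" and c: "0 < c1" "0 < c2"
    and v_low: "\<And>t. t \<in> I \<Longrightarrow> onset m \<le> t \<Longrightarrow> integrable lebesgue (\<lambda>x. \<bar>v (x, t)\<bar> powr p) \<Longrightarrow>
      c1 * t powr \<tau> \<le> (\<integral>x. \<bar>v (x, t)\<bar> powr p \<partial>lebesgue)"
    and u_low: "\<And>t F. t \<in> I \<Longrightarrow> 1 \<le> t \<Longrightarrow> 0 < F \<Longrightarrow> F \<le> U 0 t \<Longrightarrow> integrable lebesgue (\<lambda>x. \<bar>u (x, t)\<bar> powr q) \<Longrightarrow>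
      c2 * t powr (- \<nu>) * F powr q \<le> (\<integral>x. \<bar>u (x, t)\<bar> powr q \<partial>lebesgue)"
    and \<nu>: "0 \<le> \<nu>"
  shows "c2 * b powr (- \<nu>) * (c1 * min ((1/4) powr \<tau>) ((1/2) powr \<tau>) / 32 * b powr (\<tau> + 2)) powr (q - 1) * (b / 2)\<^sup>2
    \<le> 2 / (1 - 2 powr (- (q - 1) / 2))\<^sup>2"
proof -
  have on: "1 \<le> onset m" using onset_bounds(1)[OF m order.refl] .
  have b0: "4 \<le> b" using b on by linarith
  \<comment> \<open>On [b/4, b/2] the ratio r/b lies between 1/4 and 1/2, so
    \<open>r powr \<tau>\<close> is at least k \<open>b powr \<tau>\<close> whatever the sign of
    \<tau>. Starting at b/4 also puts r beyond the onset.\<close>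
  define k where "k = min ((1/4) powr \<tau>) ((1/2) powr \<tau>)"
  have k: "0 < k" by (simp add: k_def)
  define \<kappa> where "\<kappa> = c1 * k * b powr \<tau>"
  have \<kappa>: "0 < \<kappa>" using c k b0 by (simp add: \<kappa>_def)
  have rI: "r \<in> I" if "0 \<le> r" "r \<le> b" for r using time_interval_mono[OF that b(1)] .
  have V_quarter: "\<kappa> * (t - b / 4) \<le> V 0 t" if t: "b / 4 \<le> t" "t \<le> b / 2" for t
  proof -
    have "V 0 (b / 4) + \<kappa> * (t - b / 4) \<le> V 0 t"
    proof (rule V_increment_zero[OF b(1)])
      fix r assume r: "r \<in> {b / 4..t}" and i: "integrable lebesgue (\<lambda>x. \<bar>v (x, r)\<bar> powr p)"
      have "k \<le> (r / b) powr \<tau>"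
        unfolding k_def by (rule powr_between) (use r t b0 in \<open>auto simp: field_simps\<close>)
      then have "k * b powr \<tau> \<le> (r / b) powr \<tau> * b powr \<tau>" by (intro mult_right_mono) auto
      also have "\<dots> = r powr \<tau>" using r b0 by (simp add: powr_divide)
      finally have "\<kappa> \<le> c1 * r powr \<tau>" using c by (simp add: \<kappa>_def)
      also have "\<dots> \<le> (\<integral>x. \<bar>v (x, r)\<bar> powr p \<partial>lebesgue)"
        using r t b b0 by (intro v_low rI i) auto
      also have "\<dots> \<le> (\<integral>x. \<bar>v (x, r)\<bar> powr p \<partial>lebesgue) + (\<integral>x. \<bar>u (x, r)\<bar> powr q \<partial>lebesgue)"
        by (simp add: integral_nonneg_AE)
      finally show "\<kappa> \<le> (\<integral>x. \<bar>v (x, r)\<bar> powr p \<partial>lebesgue) + (\<integral>x. \<bar>u (x, r)\<bar> powr q \<partial>lebesgue)" .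
    qed (use t b0 in auto)
    moreover have "0 \<le> V 0 (b / 4)" by (rule U_zero_mono(1)[OF b(1) init, of 0]) (use b0 in auto)
    ultimately show ?thesis by linarith
  qed
  \<comment> \<open>The factor 32 comes from integrating \<open>V 0\<close> \<ge> \<kappa> (t - b/4)
    from b/4 to b/2, which gives \<kappa> \<open>(b / 4)\<^sup>2 / 2\<close>.\<close>
  define A where "A = c1 * k / 32 * b powr (\<tau> + 2)"
  have A: "0 < A" using c k b0 by (simp add: A_def)
  have A_le: "A \<le> U 0 (b / 2)"
  proof -
    define G where "G t = U 0 t - \<kappa> * (t - b / 4)\<^sup>2 / 2" for t
    have "G (b / 4) \<le> G (b / 2)"
    proof (rule nonneg_derivative_within_imp_le[where F=G and a=0 and b=b and F'="\<lambda>t. V 0 t - \<kappa> * (t - b / 4)"])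
      show "(G has_real_derivative V 0 t - \<kappa> * (t - b / 4)) (at t within {0..b})" if "t \<in> {0..b}" for t
        unfolding G_def using U_has_derivative[OF b(1) that, of 0] by (auto intro!: derivative_eq_intros)
      show "0 \<le> V 0 t - \<kappa> * (t - b / 4)" if "b / 4 < t" "t < b / 2" for t using V_quarter[of t] that by simp
    qed (use b0 in auto)
    moreover have "0 \<le> U 0 (b / 4)"
      using U_zero_mono(2)[OF b(1) init, of 0 "b / 4"] init b0 by simp
    moreover have "\<kappa> * (b / 2 - b / 4)\<^sup>2 / 2 = A"
    proof -
      have "b powr (\<tau> + 2) = b powr \<tau> * b\<^sup>2" using b0 by (simp add: powr_add)
      then show ?thesis by (simp add: A_def \<kappa>_def power2_eq_square)
    qed
    ultimately show ?thesis by (simp add: G_def)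
  qed
  have "(c2 * b powr (- \<nu>)) * A powr (q - 1) * (b - b / 2)\<^sup>2 \<le> 2 / (1 - 2 powr (- (q - 1) / 2))\<^sup>2"
  proof (rule second_order_blow_up[where F="U 0" and F'="V 0"])
    show "(U 0 has_real_derivative V 0 t) (at t within {b / 2..b})" if "t \<in> {b / 2..b}" for t
      by (rule DERIV_subset[OF U_has_derivative[OF b(1)]]) (use that b0 in auto)
    show "0 \<le> V 0 t" if "t \<in> {b / 2..b}" for t
      by (rule U_zero_mono(1)[OF b(1) init, of 0]) (use that b0 in auto)
    show "V 0 s + c2 * b powr (- \<nu>) * B powr q * (t - s) \<le> V 0 t"
      if st: "b / 2 \<le> s" "s \<le> t" "t \<le> b" and B: "0 < B" "\<And>r. r \<in> {s..t} \<Longrightarrow> B \<le> U 0 r" for s t B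
    proof (rule V_increment_zero[OF b(1)])
      fix r assume r: "r \<in> {s..t}" and i: "integrable lebesgue (\<lambda>x. \<bar>u (x, r)\<bar> powr q)"
      have "b powr (- \<nu>) \<le> r powr (- \<nu>)" using r st b0 \<nu> by (intro powr_mono2') auto
      then have "c2 * b powr (- \<nu>) * B powr q \<le> c2 * r powr (- \<nu>) * B powr q"
        using c by (intro mult_right_mono mult_left_mono) auto
      also have "\<dots> \<le> (\<integral>x. \<bar>u (x, r)\<bar> powr q \<partial>lebesgue)"
        using r st b0 B by (intro u_low rI i) auto
      also have "\<dots> \<le> (\<integral>x. \<bar>v (x, r)\<bar> powr p \<partial>lebesgue) + (\<integral>x. \<bar>u (x, r)\<bar> powr q \<partial>lebesgue)"
        by (simp add: integral_nonneg_AE)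
      finally show "c2 * b powr (- \<nu>) * B powr q
        \<le> (\<integral>x. \<bar>v (x, r)\<bar> powr p \<partial>lebesgue) + (\<integral>x. \<bar>u (x, r)\<bar> powr q \<partial>lebesgue)" .
    qed (use st b0 in auto)
    show "0 < c2 * b powr (- \<nu>)" using c b0 by simp
  qed (use q A A_le b0 in auto)
  then show ?thesis by (simp add: A_def k_def)
qed

end

text \<open>The set where a continuous function is nonzero is open, hence not negligible if
  nonempty. On the support a \<bullet> x \<ge> - R by Cauchy-Schwarz, which makes the second bound
  uniform over the unit vectors a.\<close>

lemma Cc_infty_pairing_exp:
  fixes f :: "real^'n \<Rightarrow> real"
  assumes f: "Cc_infty f" "\<forall>x. 0 \<le> f x" "\<exists>x. f x \<noteq> 0" "supp f \<subseteq> ball 0 R"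
  shows "0 < (\<integral>x. f x \<partial>lebesgue)"
    and "norm a = 1 \<Longrightarrow> exp (- R) * (\<integral>x. f x \<partial>lebesgue) \<le> (\<integral>x. f x * exp (a \<bullet> x) \<partial>lebesgue)"
proof -
  have c: "continuous_on UNIV f" using f(1) by (simp add: Cc_infty_def smooth_imp_continuous_on)
  have zero: "f x = 0" if "x \<notin> ball 0 R" for x using f(4) supp_eq_0 that by blast
  have int: "integrable lebesgue (\<lambda>x. f x * exp (a \<bullet> x))" for a
  proof -
    obtain w where w: "Cc_infty w" "\<And>y. norm y < \<bar>R\<bar> \<Longrightarrow> w y = exp (a \<bullet> y)"
      by (rule plane_wave_cutoff[of "\<bar>R\<bar>" a], simp, rule that)
    have "(\<lambda>x. f x * exp (a \<bullet> x)) = (\<lambda>x. f x * w x)"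
    proof
      show "f x * exp (a \<bullet> x) = f x * w x" for x using zero[of x] w(2)[of x] by (cases "norm x < R") auto
    qed
    then show ?thesis
      using square_integrable_mult[OF Cc_infty_square_integrable[OF f(1)] Cc_infty_square_integrable[OF w(1)]] by simp
  qed
  have fi: "integrable lebesgue f" using int[of 0] by simp
  have "(\<integral>x. f x \<partial>lebesgue) \<noteq> 0"
  proof
    assume "(\<integral>x. f x \<partial>lebesgue) = 0"
    then have ae: "AE x in lebesgue. f x = 0" using integral_nonneg_eq_0_iff_AE[OF fi] f(2) by auto
    have "open {x. f x \<noteq> 0}"
      using open_Collect_neq[of f "\<lambda>_. 0"] c by auto
    moreover have "negligible {x. f x \<noteq> 0}"
      using ae by (simp add: negligible_iff_null_sets completion.AE_iff_null_sets)
    ultimately show False using open_not_negligible f(3) by blast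
  qed
  moreover have "0 \<le> (\<integral>x. f x \<partial>lebesgue)" using f(2) by (intro integral_nonneg_AE) auto
  ultimately show "0 < (\<integral>x. f x \<partial>lebesgue)" by linarith
  show "exp (- R) * (\<integral>x. f x \<partial>lebesgue) \<le> (\<integral>x. f x * exp (a \<bullet> x) \<partial>lebesgue)" if a: "norm a = 1"
  proof -
    have "exp (- R) * f x \<le> f x * exp (a \<bullet> x)" for x
    proof (cases "x \<in> ball 0 R")
      case True
      then have "- R \<le> a \<bullet> x" using Cauchy_Schwarz_ineq2[of a x] a by (simp add: abs_le_iff)
      then have "f x * exp (- R) \<le> f x * exp (a \<bullet> x)" using f(2) by (intro mult_left_mono) auto
      then show ?thesis by (simp add: mult.commute)
    qed (simp add: zero)
    then have "(\<integral>x. exp (- R) * f x \<partial>lebesgue) \<le> (\<integral>x. f x * exp (a \<bullet> x) \<partial>lebesgue)"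
      using fi int by (intro integral_mono) auto
    then show ?thesis by simp
  qed
qed

section \<open>Initial data, constants and conclusion\<close>

context tricomi_solution
begin

lemma initial_pairings:
  assumes T: "0 < T" and init: "AE x in lebesgue. u (x, 0) = \<epsilon> * f x" "AE x in lebesgue. v (x, 0) = \<epsilon> * g x"
  shows "U a 0 = \<epsilon> * (\<integral>x. f x * exp (a \<bullet> x) \<partial>lebesgue)" "V a 0 = \<epsilon> * (\<integral>x. g x * exp (a \<bullet> x) \<partial>lebesgue)"
proof -
  have 0: "0 \<in> I" using T by (simp add: time_interval_def zero_ereal_def)
  have *: "(\<integral>x. h x * exp (a \<bullet> x) \<partial>lebesgue) = \<epsilon> * (\<integral>x. k x * exp (a \<bullet> x) \<partial>lebesgue)"
    if "h \<in> borel_measurable lebesgue" "AE x in lebesgue. h x = \<epsilon> * k x" for h k :: "real^'n \<Rightarrow> real"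
  proof -
    have "(\<integral>x. h x * exp (a \<bullet> x) \<partial>lebesgue) = (\<integral>x. \<epsilon> * (k x * exp (a \<bullet> x)) \<partial>lebesgue)"
    proof (rule lebesgue_cong_AE(2))
      show "(\<lambda>x. h x * exp (a \<bullet> x)) \<in> borel_measurable lebesgue"
        using that(1) exp_inner_measurable by (intro borel_measurable_times)
      show "AE x in lebesgue. h x * exp (a \<bullet> x) = \<epsilon> * (k x * exp (a \<bullet> x))"
        using that(2) by eventually_elim simp
    qed
    then show ?thesis by simp
  qed
  show "U a 0 = \<epsilon> * (\<integral>x. f x * exp (a \<bullet> x) \<partial>lebesgue)"
    unfolding U_def by (rule *[OF u_measurable[OF 0] init(1)])
  show "V a 0 = \<epsilon> * (\<integral>x. g x * exp (a \<bullet> x) \<partial>lebesgue)"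
    unfolding V_def by (rule *[OF v_measurable[OF 0] init(2)])
qed

lemma V_unit_lower_bound:
  assumes t: "t \<in> I" "onset m \<le> t" and \<alpha>: "0 < \<alpha>" "\<alpha> \<le> U a 0" "\<alpha> \<le> V a 0" and a: "norm a = 1"
  shows "growth_constant m * \<alpha> * t powr (m / 2) * exp (\<xi> m t) \<le> V a t"
proof (rule growth_lower_bound[where U="U a" and V="V a" and b=t, OF m \<alpha> _ _ _ t(2) order.refl])
  show "(U a has_real_derivative V a s) (at s within {0..t})" if "s \<in> {0..t}" for s
    by (rule U_has_derivative[OF t(1) that])
  show "(\<lambda>s. s powr (2 * m) * U a s) integrable_on {0..t}"
    by (rule set_lebesgue_integral_eq_integral(1)[OF U_weighted_integrable[OF t(1)]])
  show "V a s + integral {s..r} (\<lambda>s. s powr (2 * m) * U a s) \<le> V a r" if "0 \<le> s" "s \<le> r" "r \<le> t" for s r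
    by (rule V_increment_unit[OF t(1) that a])
qed

end

text \<open>Collecting powers turns the hypothesis into a bound for
  \<open>\<epsilon> powr (p * (q - 1)) * b powr e\<close>; positivity of e allows the root to be
  taken.\<close>

lemma lifespan_arithmetic:
  fixes b c c1 c2 e k p q \<epsilon> \<nu> \<tau> K :: real
  assumes pos: "0 < c" "0 < c2" "0 < k" "0 < b" "0 < \<epsilon>"
    and e: "e = - \<nu> + (\<tau> + 2) * (q - 1) + 2" "0 < e"
    and le: "c2 * b powr (- \<nu>) * (c * \<epsilon> powr p * k / 32 * b powr (\<tau> + 2)) powr (q - 1) * (b / 2)\<^sup>2 \<le> K"
  shows "b \<le> (K / (c2 * (c * k / 32) powr (q - 1) / 4)) powr (1 / e) * \<epsilon> powr (- (p * (q - 1)) / e)"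
proof -
  define c5 where "c5 = c2 * (c * k / 32) powr (q - 1) / 4"
  have c5: "0 < c5" using pos by (simp add: c5_def)
  have "c * \<epsilon> powr p * k / 32 * b powr (\<tau> + 2) = (c * k / 32) * \<epsilon> powr p * b powr (\<tau> + 2)" by simp
  then have "(c * \<epsilon> powr p * k / 32 * b powr (\<tau> + 2)) powr (q - 1)
      = (c * k / 32) powr (q - 1) * \<epsilon> powr (p * (q - 1)) * b powr ((\<tau> + 2) * (q - 1))"
    using pos by (simp only: powr_mult powr_powr)
  moreover have "(b / 2)\<^sup>2 = b powr 2 / 4" using pos by (simp add: power_divide)
  ultimately have "c2 * b powr (- \<nu>) * (c * \<epsilon> powr p * k / 32 * b powr (\<tau> + 2)) powr (q - 1) * (b / 2)\<^sup>2
      = c5 * \<epsilon> powr (p * (q - 1)) * (b powr (- \<nu>) * b powr ((\<tau> + 2) * (q - 1)) * b powr 2)"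
    by (simp add: c5_def)
  also have "b powr (- \<nu>) * b powr ((\<tau> + 2) * (q - 1)) * b powr 2 = b powr e"
    by (simp only: powr_add[symmetric] e(1))
  finally have "c5 * \<epsilon> powr (p * (q - 1)) * b powr e \<le> K" using le by simp
  have be: "b powr e \<le> (K / c5) * \<epsilon> powr (- (p * (q - 1)))"
  proof -
    define Z where "Z = \<epsilon> powr (p * (q - 1))"
    have Z: "0 < Z" using pos by (simp add: Z_def)
    have "b powr e \<le> K / (c5 * Z)"
      using \<open>c5 * \<epsilon> powr (p * (q - 1)) * b powr e \<le> K\<close> Z c5
      unfolding Z_def[symmetric] by (simp add: field_simps)
    also have "\<dots> = (K / c5) * \<epsilon> powr (- (p * (q - 1)))"
      by (simp add: Z_def powr_minus divide_inverse del: minus_diff_eq mult_minus_right)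
    finally show ?thesis .
  qed
  have "b = (b powr e) powr (1 / e)" using pos e(2) by (simp add: powr_powr)
  also have "\<dots> \<le> ((K / c5) * \<epsilon> powr (- (p * (q - 1)))) powr (1 / e)"
    using be e(2) by (intro powr_mono2) auto
  also have "\<dots> = (K / c5) powr (1 / e) * \<epsilon> powr (- (p * (q - 1)) / e)"
    unfolding powr_mult powr_powr by simp
  finally show ?thesis by (simp add: c5_def)
qed

theorem theorem2p2:
  fixes m R p q :: real and f g :: "real^'n \<Rightarrow> real" and N :: nat
  assumes N: "N = CARD('n)"
    and m: "m \<ge> 0"
    and R: "R > 0"
    and p: "p > 1"
    and q: "q > 1"
    and q_le: "N \<ge> 3 \<Longrightarrow> q \<le> 2 * real N / (real N - 2)"
    and Lambda: "Lambda_exp p q N m < 4"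
    and p_gt: "ereal p > p_tr N m"
    and q_gt: "ereal q > q_C N m"
    and f: "Cc_infty f" "\<forall>x. f x \<ge> 0" "\<exists>x. f x \<noteq> 0" "supp f \<subseteq> ball 0 R"
    and g: "Cc_infty g" "\<forall>x. g x \<ge> 0" "\<exists>x. g x \<noteq> 0" "supp g \<subseteq> ball 0 R"
  shows "\<exists>\<epsilon>0>0. \<exists>C>0. \<forall>\<epsilon>. 0 < \<epsilon> \<and> \<epsilon> \<le> \<epsilon>0 \<longrightarrow>
    (\<forall>(T::ereal) u.
       energy_solution m p q (\<lambda>x. \<epsilon> * f x) (\<lambda>x. \<epsilon> * g x) T u \<and>
       ess_supp (UNIV \<times> time_interval T) u \<subseteq> {(x,t). 0 \<le> t \<and> norm x \<le> \<xi> m t + R} \<longrightarrow>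
       T \<le> ereal (C * \<epsilon> powr (- (2 * p * (q - 1)) / (4 - Lambda_exp p q N m))))"
proof -
  define n where "n = real N - 1"
  define s where "s = p / (p - 1)"
  have s: "1 < s" using p by (simp add: s_def)
  obtain C where C: "0 < C"
    "\<And>\<rho>. 0 \<le> \<rho> \<Longrightarrow> integrable lborel (\<lambda>x::real^'n. (indicator (cball 0 \<rho>) x * wave_average x) powr s)"
    "\<And>\<rho>. 0 \<le> \<rho> \<Longrightarrow> (\<integral>x. (indicator (cball (0::real^'n) \<rho>) x * wave_average x) powr s \<partial>lborel)
      \<le> C * exp (s * \<rho>) * (1 + \<rho>) powr ((real DIM(real^'n) - 1) * (1 - s / 2))"
    by (rule wave_average_power_integral[OF s, where 'a="real^'n"], rule that)
  have dim: "real DIM(real^'n) - 1 = n" by (simp add: n_def N)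
  \<comment> \<open>\<open>\<epsilon> * \<alpha>\<close> bounds both \<open>U a 0\<close> and
    \<open>V a 0\<close> from below for all unit vectors a at once.\<close>
  define \<alpha> where "\<alpha> = exp (- R) * min (\<integral>x. f x \<partial>lebesgue) (\<integral>x. g x \<partial>lebesgue)"
  have \<alpha>: "0 < \<alpha>" using Cc_infty_pairing_exp(1)[OF f] Cc_infty_pairing_exp(1)[OF g] by (simp add: \<alpha>_def)
  define \<omega> where "\<omega> = measure lborel (ball (0::real^'n) 1)"
  have \<omega>: "0 < \<omega>" by (simp add: \<omega>_def content_ball)
  have \<gamma>: "0 < growth_constant m * \<alpha>" using growth_constant_pos[OF m] \<alpha> by simp
  define \<tau> where "\<tau> = m * p / 2 + (m + 1) * n * (1 - p / 2)"
  obtain c where c: "0 < c" "\<And>\<epsilon> t. 0 < \<epsilon> \<Longrightarrow> 1 \<le> t \<Longrightarrow> c * \<epsilon> powr p * t powr \<tau>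
      \<le> (\<omega> * (growth_constant m * \<alpha> * \<epsilon> * t powr (m / 2) * exp (\<xi> m t))) powr p *
        (C * exp (s * (\<xi> m t + R)) * (1 + (\<xi> m t + R)) powr (n * (1 - s / 2))) powr (1 - p)"
    by (rule Hoelder_constant[OF m R p \<omega> \<gamma> C(1), where n=n, folded \<tau>_def s_def], rule that)
  define \<nu> where "\<nu> = (m + 1) * real N * (q - 1)"
  define k where "k = unit_ball_vol (real N) * (1 / (m + 1) + R) ^ N"
  have k: "0 < k" using m R by (simp add: k_def add_pos_pos)
  define c2 where "c2 = k powr (1 - q)"
  have c2: "0 < c2" using k by (simp add: c2_def)
  define kt where "kt = min ((1/4) powr \<tau>) ((1/2) powr \<tau>)"
  have kt: "0 < kt" by (simp add: kt_def)
  define e where "e = (4 - Lambda_exp p q N m) / 2"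
  have e0: "0 < e" using Lambda by (simp add: e_def)
  \<comment> \<open>The right-hand side collects the powers of b in
    \<open>lifespan_inequality\<close>: the volume of the cone, the size of F raised to the power q
    - 1, and the square of the time span. This is where \<Lambda> appears.\<close>
  have e: "e = - \<nu> + (\<tau> + 2) * (q - 1) + 2"
    by (simp add: e_def \<nu>_def \<tau>_def n_def Lambda_exp_def field_simps)
  define K where "K = 2 / (1 - 2 powr (- (q - 1) / 2))\<^sup>2"
  define X where "X = (K / (c2 * (c * kt / 32) powr (q - 1) / 4)) powr (1 / e)"
  \<comment> \<open>The second entry covers times before \<open>4 * onset m\<close>, to which the
    lifespan inequality does not apply: for \<epsilon> \<le> 1 the negative power of \<epsilon> is
    at least 1, so the claimed bound exceeds them. This also explains the choice of 1 as the
    threshold for \<epsilon>.\<close>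
  define C' where "C' = max X (4 * onset m)"
  have on: "1 \<le> onset m" using onset_bounds(1)[OF m order.refl] .
  have C': "X \<le> C'" "4 * onset m \<le> C'" "0 < C'" using on by (auto simp: C'_def)
  have exponent: "- (2 * p * (q - 1)) / (4 - Lambda_exp p q N m) = - (p * (q - 1)) / e"
    using e0 by (simp add: e_def field_simps)
  have main: "T \<le> ereal (C' * \<epsilon> powr (- (p * (q - 1)) / e))"
    if \<epsilon>: "0 < \<epsilon>" "\<epsilon> \<le> 1"
    and sol: "energy_solution m p q (\<lambda>x. \<epsilon> * f x) (\<lambda>x. \<epsilon> * g x) T u"
    and cone: "ess_supp (UNIV \<times> time_interval T) u \<subseteq> {(x,t). 0 \<le> t \<and> norm x \<le> \<xi> m t + R}"
    for \<epsilon> T u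
  proof -
    obtain v where T: "0 < T" and init: "AE x in lebesgue. u (x,0) = \<epsilon> * f x" "AE x in lebesgue. v (x,0) = \<epsilon> * g x"
      and H: "C0_H1 (time_interval T) u" "C1_L2 (time_interval T) u v"
      and weak: "\<And>\<Phi> t. test_function T \<Phi> \<Longrightarrow> t \<in> time_interval T \<Longrightarrow>
        set_integrable lebesgue (UNIV \<times> {0..t})
          (\<lambda>z. (\<bar>v z\<bar> powr p + \<bar>u z\<bar> powr q) * \<Phi> z) \<and>
        (\<integral>x. v (x,t) * \<Phi> (x,t) \<partial>lebesgue)
        - (\<integral>x. v (x,0) * \<Phi> (x,0) \<partial>lebesgue)
        - (LINT s:{0..t}|lebesgue. \<integral>x. v (x,s) * deriv (\<lambda>\<tau>. \<Phi> (x,\<tau>)) s \<partial>lebesgue)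
        + (LINT s:{0..t}|lebesgue. s powr (2 * m) *
             (\<integral>x. weak_grad (\<lambda>y. u (y,s)) x \<bullet> grad (\<lambda>y. \<Phi> (y,s)) x \<partial>lebesgue))
        = (LINT s:{0..t}|lebesgue.
             \<integral>x. (\<bar>v (x,s)\<bar> powr p + \<bar>u (x,s)\<bar> powr q) * \<Phi> (x,s) \<partial>lebesgue)"
      using sol unfolding energy_solution_def by blast
    interpret tricomi_solution m p q R T u v
      by (rule tricomi_solution.intro, fact m, fact R, fact p, fact q, fact H(1), fact H(2),
          rule weak, assumption, assumption, fact cone)
    note ip = initial_pairings[OF T init]
    have UV: "\<epsilon> * \<alpha> \<le> U a 0" "\<epsilon> * \<alpha> \<le> V a 0" if "norm a = 1" for a
    proof -
      have "\<alpha> \<le> exp (- R) * (\<integral>x. f x \<partial>lebesgue)" "\<alpha> \<le> exp (- R) * (\<integral>x. g x \<partial>lebesgue)"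
        by (simp_all add: \<alpha>_def)
      then have "\<alpha> \<le> (\<integral>x. f x * exp (a \<bullet> x) \<partial>lebesgue)" "\<alpha> \<le> (\<integral>x. g x * exp (a \<bullet> x) \<partial>lebesgue)"
        using Cc_infty_pairing_exp(2)[OF f that] Cc_infty_pairing_exp(2)[OF g that] by linarith+
      then show "\<epsilon> * \<alpha> \<le> U a 0" "\<epsilon> * \<alpha> \<le> V a 0" unfolding ip using \<epsilon> by (auto intro: mult_left_mono)
    qed
    have UV0: "0 \<le> U 0 0" "0 \<le> V 0 0"
      unfolding ip using Cc_infty_pairing_exp(1)[OF f] Cc_infty_pairing_exp(1)[OF g] \<epsilon> by (simp_all add: less_imp_le)
    have bound: "b \<le> X * \<epsilon> powr (- (p * (q - 1)) / e)" if b: "b \<in> I" "4 * onset m \<le> b" for b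
    proof -
      have "c2 * b powr (- \<nu>) * ((c * \<epsilon> powr p) * kt / 32 * b powr (\<tau> + 2)) powr (q - 1) * (b / 2)\<^sup>2 \<le> K"
        unfolding kt_def K_def
      proof (rule lifespan_inequality[OF b UV0])
        fix t assume t: "t \<in> I" "onset m \<le> t" "integrable lebesgue (\<lambda>x. \<bar>v (x, t)\<bar> powr p)"
        define L where "L = growth_constant m * (\<epsilon> * \<alpha>) * t powr (m / 2) * exp (\<xi> m t)"
        have \<rho>: "0 \<le> \<xi> m t + R" using xi_nonneg[OF m, of t] R by simp
        have "(\<omega> * L) powr p * (C * exp (s * (\<xi> m t + R)) * (1 + (\<xi> m t + R)) powr (n * (1 - s / 2))) powr (1 - p)
          \<le> (\<integral>x. \<bar>v (x, t)\<bar> powr p \<partial>lebesgue)"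
          unfolding \<omega>_def
        proof (rule v_power_lower_bound[OF t(1) _ _ t(3)])
          show "0 \<le> L" using growth_constant_pos[OF m] \<epsilon> \<alpha> by (simp add: L_def)
          show "L \<le> V a t" if "norm a = 1" for a
            unfolding L_def using \<epsilon> \<alpha> UV[OF that] by (intro V_unit_lower_bound t that) auto
          show "integrable lborel (\<lambda>x::real^'n. (indicator (cball 0 (\<xi> m t + R)) x * wave_average x) powr (p / (p - 1)))"
            using C(2)[OF \<rho>] by (simp add: s_def)
          show "(\<integral>x. (indicator (cball (0::real^'n) (\<xi> m t + R)) x * wave_average x) powr (p / (p - 1)) \<partial>lborel)
            \<le> C * exp (s * (\<xi> m t + R)) * (1 + (\<xi> m t + R)) powr (n * (1 - s / 2))"
            using C(3)[OF \<rho>] unfolding dim s_def .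
          show "0 < C * exp (s * (\<xi> m t + R)) * (1 + (\<xi> m t + R)) powr (n * (1 - s / 2))"
            using C(1) \<rho> by simp
        qed
        moreover have "L = growth_constant m * \<alpha> * \<epsilon> * t powr (m / 2) * exp (\<xi> m t)" by (simp add: L_def)
        ultimately show "c * \<epsilon> powr p * t powr \<tau> \<le> (\<integral>x. \<bar>v (x, t)\<bar> powr p \<partial>lebesgue)"
          using c(2)[of \<epsilon> t] \<epsilon> t on by simp
      next
        fix t F assume t: "t \<in> I" "1 \<le> t" "0 < F" "F \<le> U 0 t" "integrable lebesgue (\<lambda>x. \<bar>u (x, t)\<bar> powr q)"
        define W where "W = k * t powr ((m + 1) * real N)"
        have \<rho>: "0 \<le> \<xi> m t + R" using xi_nonneg[OF m, of t] R by simp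
        have "F powr q * W powr (1 - q) \<le> (\<integral>x. \<bar>u (x, t)\<bar> powr q \<partial>lebesgue)"
        proof (rule u_power_lower_bound[OF t(1) _ t(4,5)])
          show "0 < W" using k t by (simp add: W_def)
          have "measure lborel (cball (0::real^'n) (\<xi> m t + R)) = unit_ball_vol (real N) * (\<xi> m t + R) ^ N"
            using \<rho> by (simp add: content_cball N)
          also have "\<dots> \<le> unit_ball_vol (real N) * ((1 / (m + 1) + R) * t powr (m + 1)) ^ N"
            using cone_radius_bounds(1)[OF m R t(2)] \<rho> by (intro mult_left_mono power_mono) auto
          also have "\<dots> = W"
            using t by (simp add: W_def k_def power_mult_distrib powr_power mult.commute)
          finally show "measure lborel (cball (0::real^'n) (\<xi> m t + R)) \<le> W" .
        qed (use t in auto)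
        moreover have "W powr (1 - q) = c2 * t powr (- \<nu>)"
        proof -
          have "(m + 1) * real N * (1 - q) = - \<nu>" by (simp add: \<nu>_def algebra_simps)
          then show ?thesis using k t by (simp only: W_def c2_def powr_mult powr_powr)
        qed
        ultimately show "c2 * t powr (- \<nu>) * F powr q \<le> (\<integral>x. \<bar>u (x, t)\<bar> powr q \<partial>lebesgue)"
          by (simp add: mult_ac)
      qed (use c c2 \<epsilon> m q in \<open>auto simp: \<nu>_def\<close>)
      then show ?thesis unfolding X_def
        by (intro lifespan_arithmetic[OF c(1) c2 kt _ \<epsilon>(1) e e0]) (use b on in auto)
    qed
    have ge1: "1 \<le> \<epsilon> powr (- (p * (q - 1)) / e)"
    proof -
      have "\<epsilon> powr 0 \<le> \<epsilon> powr (- (p * (q - 1)) / e)"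
        using \<epsilon> p q e0 by (intro powr_mono') (auto simp: divide_nonpos_pos)
      then show ?thesis using \<epsilon> by simp
    qed
    show ?thesis
    proof (rule ccontr)
      assume "\<not> T \<le> ereal (C' * \<epsilon> powr (- (p * (q - 1)) / e))"
      then have "ereal (C' * \<epsilon> powr (- (p * (q - 1)) / e)) < T" by simp
      \<comment> \<open>T may be infinite or not attained, so the argument is run at a real time b
        strictly between the claimed bound and T.\<close>
      then obtain b where b: "C' * \<epsilon> powr (- (p * (q - 1)) / e) < b" "ereal b < T"
        using ereal_dense2 by (metis less_ereal.simps(1))
      have "C' * 1 \<le> C' * \<epsilon> powr (- (p * (q - 1)) / e)" using C' ge1 by (intro mult_left_mono) auto
      then have "4 * onset m \<le> b" using b C' by linarith
      moreover from this have "b \<in> I" using b on by (simp add: time_interval_def)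
      ultimately have "b \<le> X * \<epsilon> powr (- (p * (q - 1)) / e)" by (intro bound)
      also have "\<dots> \<le> C' * \<epsilon> powr (- (p * (q - 1)) / e)" using C' by (intro mult_right_mono) auto
      finally show False using b by simp
    qed
  qed
  show ?thesis
    unfolding exponent
    by (rule exI[of _ 1], intro conjI exI[of _ C'] allI impI) (use C' main in auto)
qed

end
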